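(* Let $\phi:G\times Q\to Q$ be an action of a Lie group $G$ on a manifold $Q$. Let $A,B:G\to\Omega^1_c(Q)$ be two one-cocycles in the cohomology complex $(C^\bullet(G,\Omega^1_c(Q)),\delta_\phi)$ (smooth in the sense that $(g,q)\mapsto A(g)(q)$ and $(g,q)\mapsto B(g)(q)$ are smooth maps $G\times Q\to T^*Q$), and let $\Phi^A$ and $\Phi^B$ be the respective affine symplectic actions on $(T^*Q,\omega_Q)$, $\Phi^A_g=(T^*\phi)_g\circ t_{A(g)}$ and $\Phi^B_g=(T^*\phi)_g\circ t_{B(g)}$. Then there exists a symplectomorphism $F:T^*Q\to T^*Q$ of $(T^*Q,\omega_Q)$ such that $$\pi_Q\circ F=\pi_Q\quad\text{and}\quad F\circ\Phi^A_g=\Phi^B_g\circ F\ \text{ for all } g\in G$$ if and only if $[A]=[B]\in H^1(G,\phi,\Omega^1_c(Q))$.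
   Context: $\pi_Q:T^*Q\to Q$ is the cotangent projection and $\omega_Q=-d\theta_Q$ the canonical symplectic form, with $\theta_Q$ the Liouville $1$-form. Actions are smooth left actions. The cotangent lift of $\phi$ is $(T^*\phi)_g(\alpha_q)=\alpha_q\circ T_{\phi_g(q)}\phi_{g^{-1}}\in T^*_{\phi_g(q)}Q$ for $\alpha_q\in T^*_qQ$. For a $1$-form $\alpha$ on $Q$, $t_\alpha(\gamma_q)=\gamma_q+\alpha(q)$. $\Omega^1_c(Q)$ is the space of closed $1$-forms on $Q$. The complex: $C^n(G,\Omega^1_c(Q))$ is the set of $n$-cochains, i.e. maps $A:G\times\overset{n}{\cdots}\times G\to\Omega^1_c(Q)$ (with $C^0=\Omega^1_c(Q)$), and the coboundary operator is $$(\delta_\phi A)(g_1,\dots,g_{n+1})=(-1)^{n+1}A(g_2,\dots,g_{n+1})+\sum_{i=1}^n(-1)^{n+i+1}A(g_1,\dots,g_{i-1},g_ig_{i+1},\dots,g_{n+1})+\phi_{g_{n+1}}^*(A(g_1,\dots,g_n)).$$ $H^k(G,\phi,\Omega^1_c(Q))$ are its cohomology groups. Thus a one-cocycle satisfies $A(gh)=A(h)+\phi_h^*(A(g))$, and a one-coboundary has the form $g\mapsto\phi_g^*\alpha-\alpha$ with $\alpha\in\Omega^1_c(Q)$. *)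

theory Defs
  imports "HOL-Analysis.Analysis" "HOL-Algebra.Group_Action"
begin

section \<open>Smooth maps between open subsets of normed spaces\<close>

text \<open>
  The model spaces below are types of class \<^class>\<open>real_normed_vector\<close> that are required to be
  finite-dimensional in \<open>smooth_manifold\<close>. In contrast to \<^class>\<open>euclidean_space\<close> this
  admits dimension \<open>0\<close>, hence discrete Lie groups. The definition of \<open>C_k_on\<close> (all iterated
  directional derivatives exist and are differentiable) is the usual notion on open subsets of
  finite-dimensional spaces.
\<close>

primrec C_k_on :: "nat \<Rightarrow> ('a::real_normed_vector \<Rightarrow> 'b::real_normed_vector) \<Rightarrow> 'a set \<Rightarrow> bool" where
  "C_k_on 0 f S \<longleftrightarrow> continuous_on S f"
| "C_k_on (Suc k) f S \<longleftrightarrow>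
     (\<forall>x\<in>S. f differentiable (at x)) \<and> (\<forall>v. C_k_on k (\<lambda>x. frechet_derivative f (at x) v) S)"

definition C_infinity_on :: "('a::real_normed_vector \<Rightarrow> 'b::real_normed_vector) \<Rightarrow> 'a set \<Rightarrow> bool" where
  "C_infinity_on f S \<longleftrightarrow> open S \<and> (\<forall>k. C_k_on k f S)"

section \<open>Manifolds\<close>

text \<open>
  A chart is a domain together with a coordinate map, whose values outside the domain are
  irrelevant. A manifold is given by an atlas; its underlying set is the union of the domains,
  and its topology is the one for which the charts are homeomorphisms onto open sets.
\<close>

type_synonym ('a, 'e) chart = "'a set \<times> ('a \<Rightarrow> 'e)"
type_synonym ('a, 'e) atlas = "('a, 'e) chart set"

abbreviation cdom :: "('a, 'e) chart \<Rightarrow> 'a set" where "cdom c \<equiv> fst c"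
abbreviation cmap :: "('a, 'e) chart \<Rightarrow> 'a \<Rightarrow> 'e" where "cmap c \<equiv> snd c"

definition cinv :: "('a, 'e) chart \<Rightarrow> 'e \<Rightarrow> 'a" where
  "cinv c = inv_into (cdom c) (cmap c)"

definition points :: "('a, 'e) atlas \<Rightarrow> 'a set" where
  "points M = (\<Union>c\<in>M. cdom c)"

definition charts_at :: "('a, 'e) atlas \<Rightarrow> 'a \<Rightarrow> ('a, 'e) chart set" where
  "charts_at M p = {c \<in> M. p \<in> cdom c}"

definition chart_at :: "('a, 'e) atlas \<Rightarrow> 'a \<Rightarrow> ('a, 'e) chart" where
  "chart_at M p = (SOME c. c \<in> charts_at M p)"

definition atlas_open :: "('a, 'e::real_normed_vector) atlas \<Rightarrow> 'a set \<Rightarrow> bool" where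
  "atlas_open M U \<longleftrightarrow> U \<subseteq> points M \<and> (\<forall>c\<in>M. open (cmap c ` (U \<inter> cdom c)))"

definition manifold_topology :: "('a, 'e::real_normed_vector) atlas \<Rightarrow> 'a topology" where
  "manifold_topology M = topology (atlas_open M)"

definition smooth_atlas :: "('a, 'e::real_normed_vector) atlas \<Rightarrow> bool" where
  "smooth_atlas M \<longleftrightarrow>
     (\<forall>c\<in>M. inj_on (cmap c) (cdom c) \<and> open (cmap c ` cdom c)) \<and>
     (\<forall>c\<in>M. \<forall>d\<in>M. C_infinity_on (cmap d \<circ> cinv c) (cmap c ` (cdom c \<inter> cdom d)))"

definition smooth_manifold :: "('a, 'e::real_normed_vector) atlas \<Rightarrow> bool" where
  "smooth_manifold M \<longleftrightarrow>
     (\<exists>B::'e set. finite B \<and> span B = UNIV) \<and>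
     smooth_atlas M \<and>
     Hausdorff_space (manifold_topology M) \<and> second_countable (manifold_topology M)"

lemma istopology_atlas_open:
  assumes "smooth_atlas M"
  shows "istopology (atlas_open M)"
  unfolding istopology_def
proof (intro conjI allI impI)
  fix S T assume ST: "atlas_open M S" "atlas_open M T"
  have "open (cmap c ` (S \<inter> T \<inter> cdom c))" if c: "c \<in> M" for c
  proof -
    have "inj_on (cmap c) (cdom c)"
      using assms c unfolding smooth_atlas_def by blast
    then have "cmap c ` (S \<inter> T \<inter> cdom c) = cmap c ` (S \<inter> cdom c) \<inter> cmap c ` (T \<inter> cdom c)"
      unfolding inj_on_def by blast
    moreover have "open (cmap c ` (S \<inter> cdom c))" "open (cmap c ` (T \<inter> cdom c))"
      using ST c unfolding atlas_open_def by blast+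
    ultimately show ?thesis by (simp add: open_Int)
  qed
  then show "atlas_open M (S \<inter> T)"
    using ST unfolding atlas_open_def by blast
next
  fix K assume K: "\<forall>S\<in>K. atlas_open M S"
  have "open (cmap c ` (\<Union>K \<inter> cdom c))" if c: "c \<in> M" for c
  proof -
    have "cmap c ` (\<Union>K \<inter> cdom c) = (\<Union>S\<in>K. cmap c ` (S \<inter> cdom c))" by blast
    moreover have "\<forall>S\<in>K. open (cmap c ` (S \<inter> cdom c))"
      using K c unfolding atlas_open_def by blast
    ultimately show ?thesis by (simp add: open_UN)
  qed
  moreover have "\<Union>K \<subseteq> points M" using K unfolding atlas_open_def by blast
  ultimately show "atlas_open M (\<Union>K)"
    unfolding atlas_open_def by blast
qed

text \<open>
  Openness of the domains of the local representatives expresses that \<open>f\<close> is continuous.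
\<close>

definition smooth_map ::
  "('a, 'e::real_normed_vector) atlas \<Rightarrow> ('b, 'f::real_normed_vector) atlas \<Rightarrow> ('a \<Rightarrow> 'b) \<Rightarrow> bool" where
  "smooth_map M N f \<longleftrightarrow>
     f \<in> points M \<rightarrow> points N \<and>
     (\<forall>c\<in>M. \<forall>d\<in>N. C_infinity_on (cmap d \<circ> f \<circ> cinv c) (cmap c ` (cdom c \<inter> f -` cdom d)))"

definition diffeomorphism ::
  "('a, 'e::real_normed_vector) atlas \<Rightarrow> ('b, 'f::real_normed_vector) atlas \<Rightarrow> ('a \<Rightarrow> 'b) \<Rightarrow> bool" where
  "diffeomorphism M N f \<longleftrightarrow>
     bij_betw f (points M) (points N) \<and> smooth_map M N f \<and>
     smooth_map N M (inv_into (points M) f)"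

definition prod_atlas :: "('a, 'e) atlas \<Rightarrow> ('b, 'f) atlas \<Rightarrow> ('a \<times> 'b, 'e \<times> 'f) atlas" where
  "prod_atlas M N = {(cdom c \<times> cdom d, map_prod (cmap c) (cmap d)) | c d. c \<in> M \<and> d \<in> N}"

section \<open>Tangent and cotangent spaces\<close>

text \<open>
  A tangent vector at \<open>p\<close> is the family of its components with respect to the charts around \<open>p\<close>,
  related by the derivatives of the transition maps (and \<open>0\<close> at all other charts, so that
  equality of tangent vectors is equality of functions).
\<close>

type_synonym ('a, 'e) tvec = "('a, 'e) chart \<Rightarrow> 'e"

definition tangent_space :: "('a, 'e::real_normed_vector) atlas \<Rightarrow> 'a \<Rightarrow> ('a, 'e) tvec set" where
  "tangent_space M p =
     {v. (\<forall>c. c \<notin> charts_at M p \<longrightarrow> v c = 0) \<and>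
         (\<forall>c\<in>charts_at M p. \<forall>d\<in>charts_at M p.
            v d = frechet_derivative (cmap d \<circ> cinv c) (at (cmap c p)) (v c))}"

definition tangent_map ::
  "('a, 'e::real_normed_vector) atlas \<Rightarrow> ('b, 'f::real_normed_vector) atlas \<Rightarrow> ('a \<Rightarrow> 'b) \<Rightarrow>
   'a \<Rightarrow> ('a, 'e) tvec \<Rightarrow> ('b, 'f) tvec" where
  "tangent_map M N f p v =
     (\<lambda>d. if d \<in> charts_at N (f p)
          then frechet_derivative (cmap d \<circ> f \<circ> cinv (chart_at M p)) (at (cmap (chart_at M p) p))
                 (v (chart_at M p))
          else 0)"

text \<open>The tangent vector at \<open>p\<close> whose component in the chart \<open>c\<close> is \<open>e\<close>.\<close>

definition coord_vector ::
  "('a, 'e::real_normed_vector) atlas \<Rightarrow> ('a, 'e) chart \<Rightarrow> 'a \<Rightarrow> 'e \<Rightarrow> ('a, 'e) tvec" where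
  "coord_vector M c p e =
     (\<lambda>d. if d \<in> charts_at M p
          then frechet_derivative (cmap d \<circ> cinv c) (at (cmap c p)) e
          else 0)"

text \<open>
  The dual of the tangent space. Functionals are \<^const>\<open>undefined\<close> outside the tangent space,
  so that equality of covectors is equality of functions.
\<close>

type_synonym ('a, 'e) covec = "('a, 'e) tvec \<Rightarrow> real"

definition cotangent_space :: "('a, 'e::real_normed_vector) atlas \<Rightarrow> 'a \<Rightarrow> ('a, 'e) covec set" where
  "cotangent_space M p =
     {\<xi> \<in> extensional (tangent_space M p).
        (\<forall>u\<in>tangent_space M p. \<forall>v\<in>tangent_space M p. \<xi> (\<lambda>c. u c + v c) = \<xi> u + \<xi> v) \<and>
        (\<forall>r. \<forall>u\<in>tangent_space M p. \<xi> (\<lambda>c. r *\<^sub>R u c) = r * \<xi> u)}"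

section \<open>The cotangent bundle\<close>

text \<open>
  Points of the cotangent bundle are pairs \<open>(q, \<xi>)\<close>, the projection is \<^const>\<open>fst\<close>. A chart \<open>c\<close>
  of the base induces the bundle chart \<open>(q, \<xi>) \<mapsto> (x, p)\<close> with \<open>x = c(q)\<close> and
  \<open>p(e) = \<xi>(\<partial>\<^sub>e)\<close>, where \<open>\<partial>\<^sub>e\<close> is the coordinate vector with component \<open>e\<close>.
\<close>

definition cotangent_chart ::
  "('a, 'e::real_normed_vector) atlas \<Rightarrow> ('a, 'e) chart \<Rightarrow>
   ('a \<times> ('a, 'e) covec, 'e \<times> ('e \<Rightarrow>\<^sub>L real)) chart" where
  "cotangent_chart M c =
     (Sigma (cdom c) (cotangent_space M),
      \<lambda>(q, \<xi>). (cmap c q, Blinfun (\<lambda>e. \<xi> (coord_vector M c q e))))"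

definition cotangent_bundle ::
  "('a, 'e::real_normed_vector) atlas \<Rightarrow>
   ('a \<times> ('a, 'e) covec, 'e \<times> ('e \<Rightarrow>\<^sub>L real)) atlas" where
  "cotangent_bundle M = cotangent_chart M ` M"

section \<open>Differential forms\<close>

type_synonym ('a, 'e) form1 = "'a \<Rightarrow> ('a, 'e) covec"
type_synonym ('a, 'e) form2 = "'a \<Rightarrow> ('a, 'e) tvec \<Rightarrow> ('a, 'e) tvec \<Rightarrow> real"

definition smooth_form1 :: "('a, 'e::real_normed_vector) atlas \<Rightarrow> ('a, 'e) form1 set" where
  "smooth_form1 M =
     {\<alpha> \<in> (\<Pi>\<^sub>E p\<in>points M. cotangent_space M p).
        smooth_map M (cotangent_bundle M) (\<lambda>p. (p, \<alpha> p))}"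

text \<open>
  The exterior derivative \<open>d\<alpha>(U, V) = U(\<alpha>(V)) - V(\<alpha>(U)) - \<alpha>([U, V])\<close>, evaluated on the
  (commuting) coordinate vector fields \<open>U\<close> and \<open>V\<close> that extend \<open>u\<close> and \<open>v\<close> with constant components
  in a chart around \<open>p\<close>.
\<close>

definition ext_deriv :: "('a, 'e::real_normed_vector) atlas \<Rightarrow> ('a, 'e) form1 \<Rightarrow> ('a, 'e) form2" where
  "ext_deriv M \<alpha> p u v =
     (let c = chart_at M p;
          a = (\<lambda>e x. \<alpha> (cinv c x) (coord_vector M c (cinv c x) e))
      in frechet_derivative (a (v c)) (at (cmap c p)) (u c)
         - frechet_derivative (a (u c)) (at (cmap c p)) (v c))"

definition closed_forms :: "('a, 'e::real_normed_vector) atlas \<Rightarrow> ('a, 'e) form1 set" where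
  "closed_forms M =
     {\<alpha> \<in> smooth_form1 M.
        \<forall>p\<in>points M. \<forall>u\<in>tangent_space M p. \<forall>v\<in>tangent_space M p. ext_deriv M \<alpha> p u v = 0}"

definition pullback1 ::
  "('a, 'e::real_normed_vector) atlas \<Rightarrow> ('b, 'f::real_normed_vector) atlas \<Rightarrow> ('a \<Rightarrow> 'b) \<Rightarrow>
   ('b, 'f) form1 \<Rightarrow> ('a, 'e) form1" where
  "pullback1 M N f \<alpha> =
     (\<lambda>p\<in>points M. \<lambda>v\<in>tangent_space M p. \<alpha> (f p) (tangent_map M N f p v))"

definition symplectomorphism ::
  "('a, 'e::real_normed_vector) atlas \<Rightarrow> ('a, 'e) form2 \<Rightarrow> ('a \<Rightarrow> 'a) \<Rightarrow> bool" where
  "symplectomorphism M \<omega> F \<longleftrightarrow>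
     diffeomorphism M M F \<and>
     (\<forall>x\<in>points M. \<forall>u\<in>tangent_space M x. \<forall>v\<in>tangent_space M x.
        \<omega> (F x) (tangent_map M M F x u) (tangent_map M M F x v) = \<omega> x u v)"

definition liouville_form ::
  "('a, 'e::real_normed_vector) atlas \<Rightarrow>
   ('a \<times> ('a, 'e) covec, 'e \<times> ('e \<Rightarrow>\<^sub>L real)) form1" where
  "liouville_form M =
     (\<lambda>x\<in>points (cotangent_bundle M). \<lambda>w\<in>tangent_space (cotangent_bundle M) x.
        snd x (tangent_map (cotangent_bundle M) M fst x w))"

definition canonical_form ::
  "('a, 'e::real_normed_vector) atlas \<Rightarrow>
   ('a \<times> ('a, 'e) covec, 'e \<times> ('e \<Rightarrow>\<^sub>L real)) form2" where
  "canonical_form M x u v = - ext_deriv (cotangent_bundle M) (liouville_form M) x u v"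

section \<open>Lie groups and actions\<close>

definition lie_group :: "('g, 'm) monoid_scheme \<Rightarrow> ('g, 'f::real_normed_vector) atlas \<Rightarrow> bool" where
  "lie_group G L \<longleftrightarrow>
     group G \<and> smooth_manifold L \<and> points L = carrier G \<and>
     smooth_map (prod_atlas L L) L (\<lambda>(g, h). g \<otimes>\<^bsub>G\<^esub> h) \<and>
     smooth_map L L (\<lambda>g. inv\<^bsub>G\<^esub> g)"

definition smooth_action ::
  "('g, 'm) monoid_scheme \<Rightarrow> ('g, 'f::real_normed_vector) atlas \<Rightarrow>
   ('q, 'e::real_normed_vector) atlas \<Rightarrow> ('g \<Rightarrow> 'q \<Rightarrow> 'q) \<Rightarrow> bool" where
  "smooth_action G L Q \<phi> \<longleftrightarrow>
     group_action G (points Q) \<phi> \<and> smooth_map (prod_atlas L Q) Q (\<lambda>(g, q). \<phi> g q)"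

definition cotangent_lift ::
  "('g, 'm) monoid_scheme \<Rightarrow> ('q, 'e::real_normed_vector) atlas \<Rightarrow> ('g \<Rightarrow> 'q \<Rightarrow> 'q) \<Rightarrow> 'g \<Rightarrow>
   'q \<times> ('q, 'e) covec \<Rightarrow> 'q \<times> ('q, 'e) covec" where
  "cotangent_lift G Q \<phi> g =
     (\<lambda>(q, \<xi>). (\<phi> g q,
        \<lambda>w\<in>tangent_space Q (\<phi> g q). \<xi> (tangent_map Q Q (\<phi> (inv\<^bsub>G\<^esub> g)) (\<phi> g q) w)))"

definition fibre_translation ::
  "('q, 'e::real_normed_vector) atlas \<Rightarrow> ('q, 'e) form1 \<Rightarrow>
   'q \<times> ('q, 'e) covec \<Rightarrow> 'q \<times> ('q, 'e) covec" where
  "fibre_translation Q \<alpha> = (\<lambda>(q, \<xi>). (q, \<lambda>v\<in>tangent_space Q q. \<xi> v + \<alpha> q v))"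

section \<open>The cohomology of a group action with values in closed one-forms\<close>

text \<open>
  An \<open>n\<close>-cochain is a function on the lists of length \<open>n\<close> over the group. Following the convention
  of the library for functions between carriers, it is \<^const>\<open>undefined\<close> on other lists, and likewise
  for one-forms off the manifold.
\<close>

type_synonym ('g, 'q, 'e) cochain = "'g list \<Rightarrow> ('q, 'e) form1"

definition tuples :: "('g, 'm) monoid_scheme \<Rightarrow> nat \<Rightarrow> 'g list set" where
  "tuples G n = {gs. length gs = n \<and> set gs \<subseteq> carrier G}"

definition make_cochain ::
  "('g, 'm) monoid_scheme \<Rightarrow> ('q, 'e::real_normed_vector) atlas \<Rightarrow> nat \<Rightarrow>
   ('g list \<Rightarrow> 'q \<Rightarrow> ('q, 'e) tvec \<Rightarrow> real) \<Rightarrow> ('g, 'q, 'e) cochain" where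
  "make_cochain G Q n f =
     (\<lambda>gs\<in>tuples G n. \<lambda>q\<in>points Q. \<lambda>v\<in>tangent_space Q q. f gs q v)"

definition cochain_group ::
  "('g, 'm) monoid_scheme \<Rightarrow> ('q, 'e::real_normed_vector) atlas \<Rightarrow> nat \<Rightarrow>
   ('g, 'q, 'e) cochain monoid" where
  "cochain_group G Q n =
     \<lparr>carrier = tuples G n \<rightarrow>\<^sub>E closed_forms Q,
      mult = (\<lambda>A B. make_cochain G Q n (\<lambda>gs q v. A gs q v + B gs q v)),
      one = make_cochain G Q n (\<lambda>gs q v. 0)\<rparr>"

text \<open>\<open>merge G i [g\<^sub>1, \<dots>, g\<^sub>m] = [g\<^sub>1, \<dots>, g\<^sub>i g\<^sub>i\<^sub>+\<^sub>1, \<dots>, g\<^sub>m]\<close> for \<open>1 \<le> i < m\<close>.\<close>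

definition merge :: "('g, 'm) monoid_scheme \<Rightarrow> nat \<Rightarrow> 'g list \<Rightarrow> 'g list" where
  "merge G i gs = take (i - 1) gs @ (gs ! (i - 1) \<otimes>\<^bsub>G\<^esub> gs ! i) # drop (i + 1) gs"

definition coboundary ::
  "('g, 'm) monoid_scheme \<Rightarrow> ('q, 'e::real_normed_vector) atlas \<Rightarrow> ('g \<Rightarrow> 'q \<Rightarrow> 'q) \<Rightarrow> nat \<Rightarrow>
   ('g, 'q, 'e) cochain \<Rightarrow> ('g, 'q, 'e) cochain" where
  "coboundary G Q \<phi> n A =
     make_cochain G Q (n + 1) (\<lambda>gs q v.
       (- 1) ^ (n + 1) * A (tl gs) q v
       + (\<Sum>i=1..n. (- 1) ^ (n + i + 1) * A (merge G i gs) q v)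
       + pullback1 Q Q (\<phi> (last gs)) (A (butlast gs)) q v)"

definition cocycle_group ::
  "('g, 'm) monoid_scheme \<Rightarrow> ('q, 'e::real_normed_vector) atlas \<Rightarrow> ('g \<Rightarrow> 'q \<Rightarrow> 'q) \<Rightarrow> nat \<Rightarrow>
   ('g, 'q, 'e) cochain monoid" where
  "cocycle_group G Q \<phi> n =
     (cochain_group G Q n)
       \<lparr>carrier := {A \<in> carrier (cochain_group G Q n).
                     coboundary G Q \<phi> n A = \<one>\<^bsub>cochain_group G Q (n + 1)\<^esub>}\<rparr>"

definition coboundaries ::
  "('g, 'm) monoid_scheme \<Rightarrow> ('q, 'e::real_normed_vector) atlas \<Rightarrow> ('g \<Rightarrow> 'q \<Rightarrow> 'q) \<Rightarrow> nat \<Rightarrow>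
   ('g, 'q, 'e) cochain set" where
  "coboundaries G Q \<phi> n =
     (case n of 0 \<Rightarrow> {\<one>\<^bsub>cochain_group G Q 0\<^esub>}
      | Suc m \<Rightarrow> coboundary G Q \<phi> m ` carrier (cochain_group G Q m))"

definition cohomology_group ::
  "('g, 'm) monoid_scheme \<Rightarrow> ('q, 'e::real_normed_vector) atlas \<Rightarrow> ('g \<Rightarrow> 'q \<Rightarrow> 'q) \<Rightarrow> nat \<Rightarrow>
   ('g, 'q, 'e) cochain set monoid" where
  "cohomology_group G Q \<phi> n = cocycle_group G Q \<phi> n Mod coboundaries G Q \<phi> n"

definition cohomology_class ::
  "('g, 'm) monoid_scheme \<Rightarrow> ('q, 'e::real_normed_vector) atlas \<Rightarrow> ('g \<Rightarrow> 'q \<Rightarrow> 'q) \<Rightarrow> nat \<Rightarrow>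
   ('g, 'q, 'e) cochain \<Rightarrow> ('g, 'q, 'e) cochain set" where
  "cohomology_class G Q \<phi> n A = coboundaries G Q \<phi> n #>\<^bsub>cocycle_group G Q \<phi> n\<^esub> A"

lemma carrier_cohomology_group:
  "carrier (cohomology_group G Q \<phi> n) =
     cohomology_class G Q \<phi> n ` carrier (cocycle_group G Q \<phi> n)"
  by (auto simp: cohomology_group_def cohomology_class_def FactGroup_def RCOSETS_def)

lemma one_cocycle:
  assumes "A \<in> carrier (cocycle_group G Q \<phi> 1)" "g \<in> carrier G" "h \<in> carrier G" "group G"
    and "q \<in> points Q" "v \<in> tangent_space Q q"
  shows "A [g \<otimes>\<^bsub>G\<^esub> h] q v = A [h] q v + pullback1 Q Q (\<phi> h) (A [g]) q v"
proof -
  have "coboundary G Q \<phi> 1 A [g, h] q v = \<one>\<^bsub>cochain_group G Q 2\<^esub> [g, h] q v"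
    using assms(1) by (simp add: cocycle_group_def numeral_2_eq_2)
  then show ?thesis
    using assms(2-)
    by (simp add: coboundary_def make_cochain_def cochain_group_def tuples_def merge_def
        numeral_2_eq_2)
qed

lemma one_coboundary:
  assumes "g \<in> carrier G" "q \<in> points Q" "v \<in> tangent_space Q q"
  shows "coboundary G Q \<phi> 0 a [g] q v = pullback1 Q Q (\<phi> g) (a []) q v - a [] q v"
  using assms by (simp add: coboundary_def make_cochain_def tuples_def)

text \<open>A one-cocycle \<open>A\<close> takes the value \<open>A [g]\<close> at the group element \<open>g\<close>.\<close>

definition affine_action ::
  "('g, 'm) monoid_scheme \<Rightarrow> ('q, 'e::real_normed_vector) atlas \<Rightarrow> ('g \<Rightarrow> 'q \<Rightarrow> 'q) \<Rightarrow>
   ('g, 'q, 'e) cochain \<Rightarrow> 'g \<Rightarrow> 'q \<times> ('q, 'e) covec \<Rightarrow> 'q \<times> ('q, 'e) covec" where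
  "affine_action G Q \<phi> A g = cotangent_lift G Q \<phi> g \<circ> fibre_translation Q (A [g])"

end

(* In canonical coordinates (x, p) of T*Q the canonical form is the standard one, so a symplectomorphism
   over the identity has the form (x, p) -> (x, f(x, p)) with df/dp = id. The fibres being vector spaces,
   f(x, p) = p + a(x): the symplectomorphism is the translation by the one-form a, the image of the zero
   section, and preservation of the canonical form says that a is closed. Conversely translations by closed
   one-forms are symplectic. Since T*phi_g intertwines translations through the pullback by phi_g,
   equivariance of the translation by a with respect to the two affine actions says exactly that
   B(g) = A(g) + phi_g^* a - a. *)

theory Submission
  imports Defs
begin

section \<open>Finite-dimensional normed spaces\<close>

text \<open>Closedness of a form is defined at each point through one arbitrarily chosen chart, and
  the chart chosen on the bundle lies over a base chart that need not be that one. So closedness has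
  to be shown independent of the chart, which rests on the symmetry of second derivatives of
  transition maps. The model spaces are normed spaces with a finite spanning set; bounded coordinate
  functionals are derived from that set, and they reduce the smoothness of composites and of maps
  into the dual to finitely many components. In the equivariance equation the covector occurs on
  both sides and cancels, which leaves an identity of one-forms. Maps of the bundle are compared
  only on its underlying set, whereas cochains are compared as functions; the restrictions built
  into the definitions of forms and cochains bridge the two.\<close>

definition finite_dim :: "'a::real_normed_vector itself \<Rightarrow> bool" where
  "finite_dim _ \<longleftrightarrow> (\<exists>B::'a set. finite B \<and> span B = UNIV)"

text \<open>Take for \<open>d\<close> the radius of a ball around \<open>b\<close> that misses the
  closed subspace \<open>span B\<close>. Dividing \<open>x - t *\<^sub>R b\<close> by
  \<open>- t\<close> gives a point of the subspace at distance \<open>norm x / \<bar>t\<bar>\<close>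
  from \<open>b\<close>, so this distance is at least \<open>d\<close>.\<close>

lemma span_insert_closed_coeff_bound:
  fixes b :: "'a::real_normed_vector"
  assumes "closed (span B)" "b \<notin> span B"
  obtains d where "d > 0" "\<And>t x. x - t *\<^sub>R b \<in> span B \<Longrightarrow> \<bar>t\<bar> * d \<le> norm x"
proof -
  have "open (- span B)" using assms(1) by blast
  then obtain d where d: "d > 0" "\<And>y. dist y b < d \<Longrightarrow> y \<notin> span B"
    using assms(2) unfolding open_dist by (metis ComplD ComplI)
  have "\<bar>t\<bar> * d \<le> norm x" if x: "x - t *\<^sub>R b \<in> span B" for t x
  proof (cases "t = 0")
    case False
    let ?y = "(- 1 / t) *\<^sub>R (x - t *\<^sub>R b)"
    have "?y \<in> span B" using x by (rule span_scale)
    then have "d \<le> dist ?y b" using d(2) by force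
    also have "?y - b = (- 1 / t) *\<^sub>R x" using False by (simp add: algebra_simps)
    then have "dist ?y b = norm x / \<bar>t\<bar>" by (simp add: dist_norm)
    finally show ?thesis using False by (simp add: field_simps)
  qed simp
  then show ?thesis using that d(1) by blast
qed

text \<open>Completeness has to be carried through the induction along with boundedness: it makes
  the smaller span closed, and closedness bounds the coefficient of the new basis vector by the
  norm. That bound drives both halves of the induction step.\<close>

lemma finite_span_complete_bounded:
  fixes B :: "'a::real_normed_vector set"
  assumes "finite B" "independent B"
  shows "complete (span B) \<and>
    (\<forall>f::'a \<Rightarrow> real. linear f \<longrightarrow> (\<exists>K. \<forall>x\<in>span B. \<bar>f x\<bar> \<le> K * norm x))"
  using assms
proof (induction B rule: finite_induct)
  case empty
  have "\<forall>x\<in>{0::'a}. \<bar>f x\<bar> \<le> 0 * norm x" if "linear f" for f :: "'a \<Rightarrow> real"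
    using linear_0[OF that] by simp
  then show ?case by (metis finite.emptyI finite_imp_compact compact_imp_complete finite_insert span_empty)
next
  case (insert b B)
  then have ind: "independent B" and b: "b \<notin> span B"
    by (auto simp: independent_insert)
  note IH = insert.IH[OF ind]
  then obtain d where d: "d > 0" "\<And>t x. x - t *\<^sub>R b \<in> span B \<Longrightarrow> \<bar>t\<bar> * d \<le> norm x"
    using span_insert_closed_coeff_bound complete_imp_closed b by metis
  have "\<exists>l\<in>span (insert b B). \<sigma> \<longlonglongrightarrow> l" if \<sigma>: "\<forall>n. \<sigma> n \<in> span (insert b B)" "Cauchy \<sigma>" for \<sigma>
  proof -
    obtain t where t: "\<And>n. \<sigma> n - t n *\<^sub>R b \<in> span B"
      using \<sigma>(1) unfolding span_breakdown_eq by metis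
    \<comment> \<open>The coefficient of \<open>b\<close> in a difference of two terms is the
      difference of their coefficients, so the bound makes the coefficients of a Cauchy sequence
      Cauchy; the remainders in \<open>span B\<close> are then Cauchy too.\<close>
    have *: "\<bar>t m - t n\<bar> * d \<le> norm (\<sigma> m - \<sigma> n)" for m n
    proof -
      have "(\<sigma> m - \<sigma> n) - (t m - t n) *\<^sub>R b = (\<sigma> m - t m *\<^sub>R b) - (\<sigma> n - t n *\<^sub>R b)"
        by (simp add: algebra_simps)
      then show ?thesis using d(2) span_diff[OF t t] by metis
    qed
    have ct: "Cauchy t"
      unfolding Cauchy_def dist_norm
    proof (intro allI impI)
      fix e :: real assume e: "e > 0"
      then obtain M where M: "\<And>m n. m \<ge> M \<Longrightarrow> n \<ge> M \<Longrightarrow> norm (\<sigma> m - \<sigma> n) < e * d"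
        using \<sigma>(2) d(1) unfolding Cauchy_def dist_norm by (meson mult_pos_pos)
      have "norm (t m - t n) < e" if "m \<ge> M" "n \<ge> M" for m n
      proof -
        have "\<bar>t m - t n\<bar> * d < e * d" using *[of m n] M[OF that] by linarith
        then show ?thesis using d(1) by simp
      qed
      then show "\<exists>M. \<forall>m\<ge>M. \<forall>n\<ge>M. norm (t m - t n) < e" by blast
    qed
    then obtain s where s: "t \<longlonglongrightarrow> s" using Cauchy_convergent convergent_def by blast
    have "Cauchy (\<lambda>n. \<sigma> n - t n *\<^sub>R b)"
    proof (rule CauchyI)
      fix e :: real assume e: "e > 0"
      have "Cauchy (\<lambda>n. t n *\<^sub>R b)"
        using ct by (rule bounded_linear.Cauchy[OF bounded_linear_scaleR_left])
      from CauchyD[OF this half_gt_zero[OF e]] CauchyD[OF \<sigma>(2) half_gt_zero[OF e]]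
      obtain M N where MN: "\<And>m n. m \<ge> M \<Longrightarrow> n \<ge> M \<Longrightarrow> norm (t m *\<^sub>R b - t n *\<^sub>R b) < e / 2"
        "\<And>m n. m \<ge> N \<Longrightarrow> n \<ge> N \<Longrightarrow> norm (\<sigma> m - \<sigma> n) < e / 2"
        by blast
      have "norm ((\<sigma> m - t m *\<^sub>R b) - (\<sigma> n - t n *\<^sub>R b)) < e"
        if "m \<ge> max M N" "n \<ge> max M N" for m n
      proof -
        have "(\<sigma> m - t m *\<^sub>R b) - (\<sigma> n - t n *\<^sub>R b) = (\<sigma> m - \<sigma> n) - (t m *\<^sub>R b - t n *\<^sub>R b)"
          by simp
        moreover have "norm (t m *\<^sub>R b - t n *\<^sub>R b) < e / 2" "norm (\<sigma> m - \<sigma> n) < e / 2"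
          using MN that by auto
        then have "norm ((\<sigma> m - \<sigma> n) - (t m *\<^sub>R b - t n *\<^sub>R b)) < e"
          using norm_triangle_ineq4[of "\<sigma> m - \<sigma> n" "t m *\<^sub>R b - t n *\<^sub>R b"] by linarith
        ultimately show ?thesis by (simp only:)
      qed
      then show "\<exists>M. \<forall>m\<ge>M. \<forall>n\<ge>M. norm (\<sigma> m - t m *\<^sub>R b - (\<sigma> n - t n *\<^sub>R b)) < e" by blast
    qed
    then obtain l where l: "l \<in> span B" "(\<lambda>n. \<sigma> n - t n *\<^sub>R b) \<longlonglongrightarrow> l"
      using IH t unfolding complete_def by meson
    have "\<sigma> \<longlonglongrightarrow> l + s *\<^sub>R b"
      using tendsto_add[OF l(2) tendsto_scaleR[OF s tendsto_const[of b]]] by simp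
    moreover have "l + s *\<^sub>R b \<in> span (insert b B)"
      using l(1) unfolding span_breakdown_eq by (metis add_diff_cancel_right')
    ultimately show ?thesis by blast
  qed
  then have "complete (span (insert b B))" unfolding complete_def by blast
  moreover have "\<exists>K. \<forall>x\<in>span (insert b B). \<bar>f x\<bar> \<le> K * norm x" if f: "linear f" for f :: "'a \<Rightarrow> real"
  proof -
    obtain K0 where K0: "\<And>x. x \<in> span B \<Longrightarrow> \<bar>f x\<bar> \<le> K0 * norm x" using IH f by blast
    \<comment> \<open>A nonnegative constant is needed, since the estimate of
      \<open>norm (x - t *\<^sub>R b)\<close> is multiplied by it below.\<close>
    define K where "K = max K0 0"
    have K: "\<bar>f x\<bar> \<le> K * norm x" if "x \<in> span B" for x
      using K0[OF that] mult_right_mono[of K0 K "norm x"] by (simp add: K_def)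
    \<comment> \<open>Split \<open>x\<close> into its part in \<open>span B\<close> and
      \<open>t *\<^sub>R b\<close>, and insert \<open>\<bar>t\<bar> \<le> norm x / d\<close> in both
      contributions.\<close>
    have "\<bar>f x\<bar> \<le> (K * (1 + norm b / d) + \<bar>f b\<bar> / d) * norm x" if x: "x \<in> span (insert b B)" for x
    proof -
      obtain t where t: "x - t *\<^sub>R b \<in> span B" using x unfolding span_breakdown_eq by blast
      have td: "\<bar>t\<bar> \<le> norm x / d" using d(2)[OF t] d(1) by (simp add: field_simps)
      have "f x = f (x - t *\<^sub>R b) + t * f b"
        using f by (simp add: linear_diff linear_scale)
      then have "\<bar>f x\<bar> \<le> K * norm (x - t *\<^sub>R b) + \<bar>t\<bar> * \<bar>f b\<bar>"
        using K[OF t] abs_triangle_ineq[of "f (x - t *\<^sub>R b)" "t * f b"] abs_mult[of t "f b"]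
        by linarith
      moreover have "norm (x - t *\<^sub>R b) \<le> norm x + \<bar>t\<bar> * norm b"
        by (metis norm_triangle_ineq4 norm_scaleR)
      moreover have "\<bar>t\<bar> * norm b \<le> norm x / d * norm b" "\<bar>t\<bar> * \<bar>f b\<bar> \<le> norm x / d * \<bar>f b\<bar>"
        by (intro mult_right_mono td; simp)+
      moreover have "K * norm (x - t *\<^sub>R b) \<le> K * (norm x + norm x / d * norm b)"
        if "norm (x - t *\<^sub>R b) \<le> norm x + norm x / d * norm b"
        using that by (simp add: K_def mult_left_mono)
      ultimately have "\<bar>f x\<bar> \<le> K * (norm x + norm x / d * norm b) + norm x / d * \<bar>f b\<bar>"
        by linarith
      then show ?thesis by (simp add: algebra_simps)
    qed
    then show ?thesis by blast
  qed
  ultimately show ?case by blast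
qed

lemma finite_dim_basis:
  assumes "finite_dim TYPE('a)"
  obtains B :: "'a::real_normed_vector set" where "finite B" "independent B" "span B = UNIV"
proof -
  obtain S :: "'a set" where S: "finite S" "span S = UNIV"
    using assms unfolding finite_dim_def by blast
  obtain B where "B \<subseteq> S" "independent B" "S \<subseteq> span B"
    using maximal_independent_subset by blast
  then show ?thesis
    using that S by (metis finite_subset span_mono span_span top.extremum_uniqueI)
qed

lemma finite_dim_bounded_linear:
  fixes f :: "'a::real_normed_vector \<Rightarrow> real"
  assumes "finite_dim TYPE('a)" "linear f"
  shows "bounded_linear f"
proof -
  obtain B :: "'a set" where B: "finite B" "independent B" "span B = UNIV"
    using finite_dim_basis[OF assms(1)] .
  then obtain K where "\<forall>x. \<bar>f x\<bar> \<le> K * norm x"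
    using finite_span_complete_bounded[OF B(1,2)] assms(2) by (metis UNIV_I)
  then show ?thesis
    using assms(2) by (intro bounded_linear_intro[where K=K]) (auto simp: linear_add linear_scale mult.commute)
qed

text \<open>Supplies coordinates: the coefficients with respect to a basis are linear, hence
  bounded. Statements on maps into the space, or on functionals on it, can thereby be checked on
  finitely many components.\<close>

lemma finite_dim_dual_basis:
  assumes "finite_dim TYPE('a)"
  obtains B :: "'a::real_normed_vector set" and \<beta> :: "'a \<Rightarrow> 'a \<Rightarrow>\<^sub>L real"
  where "finite B" "\<And>x. (\<Sum>b\<in>B. \<beta> b x *\<^sub>R b) = x"
proof -
  obtain B :: "'a set" where B: "finite B" "independent B" "span B = UNIV"
    using finite_dim_basis[OF assms] .
  have "linear (\<lambda>x. representation B x b)" for b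
    using B by (intro linearI) (simp_all add: representation_add representation_scale)
  then have bl: "bounded_linear (\<lambda>x. representation B x b)" for b
    using finite_dim_bounded_linear[OF assms] by blast
  have "(\<Sum>b\<in>B. Blinfun (\<lambda>x. representation B x b) x *\<^sub>R b) = x" for x
    using sum_representation_eq[of B x B] B by (simp add: bounded_linear_Blinfun_apply[OF bl])
  then show ?thesis by (rule that[OF B(1)])
qed

section \<open>Calculus of smooth maps\<close>

text \<open>A derivative at a point depends on the values nearby, and for open \<open>S\<close>
  these are values at points of \<open>S\<close>.\<close>

lemma C_k_on_cong:
  assumes "open S" "\<And>x. x \<in> S \<Longrightarrow> f x = g x"
  shows "C_k_on k f S \<longleftrightarrow> C_k_on k g S"
  using assms(2)
proof (induction k arbitrary: f g)
  case 0
  then show ?case by (simp cong: continuous_on_cong)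
next
  case (Suc k)
  have eq: "(f has_derivative D) (at x) \<longleftrightarrow> (g has_derivative D) (at x)" if "x \<in> S" for x D
    using has_derivative_transform_within_open[OF _ assms(1) that] Suc.prems by metis
  have "frechet_derivative f (at x) = frechet_derivative g (at x)" if "x \<in> S" for x
    unfolding frechet_derivative_def using eq[OF that] by simp
  moreover have "f differentiable (at x) \<longleftrightarrow> g differentiable (at x)" if "x \<in> S" for x
    unfolding differentiable_def using eq[OF that] by simp
  ultimately show ?case
    using Suc.IH[of "\<lambda>x. frechet_derivative f (at x) v" "\<lambda>x. frechet_derivative g (at x) v" for v]
    by auto
qed

lemma C_k_on_subset: "C_k_on k f T \<Longrightarrow> S \<subseteq> T \<Longrightarrow> C_k_on k f S"
  by (induction k arbitrary: f) (auto intro: continuous_on_subset)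

text \<open>Derivatives are unique, so any explicit formula for them may replace
  \<open>frechet_derivative\<close>.\<close>

lemma C_k_on_SucI:
  assumes "open S" "\<And>x. x \<in> S \<Longrightarrow> (f has_derivative f' x) (at x)"
    "\<And>v. C_k_on k (\<lambda>x. f' x v) S"
  shows "C_k_on (Suc k) f S"
proof -
  have "frechet_derivative f (at x) = f' x" if "x \<in> S" for x
    using frechet_derivative_at[OF assms(2)[OF that]] by simp
  then have "C_k_on k (\<lambda>x. frechet_derivative f (at x) v) S" for v
    using assms(3)[of v] C_k_on_cong[OF assms(1), of "\<lambda>x. frechet_derivative f (at x) v"] by simp
  then show ?thesis using assms(2) by (auto simp: differentiable_def)
qed

lemma C_k_on_SucD:
  assumes "C_k_on (Suc k) f S"
  shows "C_k_on k f S"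
  using assms
proof (induction k arbitrary: f)
  case 0
  then show ?case
    by (auto intro!: continuous_at_imp_continuous_on differentiable_imp_continuous_within)
qed auto

lemma C_k_on_derivative:
  assumes "C_k_on (Suc k) f S" "x \<in> S"
  shows "(f has_derivative frechet_derivative f (at x)) (at x)"
  using assms frechet_derivative_works by auto

lemma C_k_on_const: "C_k_on k (\<lambda>x. c) S"
  by (induction k arbitrary: c) auto

lemma C_k_on_linear:
  assumes "open S" "bounded_linear h" "C_k_on k f S"
  shows "C_k_on k (\<lambda>x. h (f x)) S"
  using assms(3)
proof (induction k arbitrary: f)
  case 0
  then show ?case by (simp add: bounded_linear.continuous_on[OF assms(2)])
next
  case (Suc k)
  show ?case
  proof (rule C_k_on_SucI[OF assms(1)])
    show "((\<lambda>x. h (f x)) has_derivative (\<lambda>v. h (frechet_derivative f (at x) v))) (at x)"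
      if "x \<in> S" for x
      using C_k_on_derivative[OF Suc.prems that] by (rule bounded_linear.has_derivative[OF assms(2)])
  qed (use Suc in auto)
qed

lemma C_k_on_add:
  assumes "open S" "C_k_on k f S" "C_k_on k g S"
  shows "C_k_on k (\<lambda>x. f x + g x) S"
  using assms(2,3)
proof (induction k arbitrary: f g)
  case 0
  then show ?case by (auto intro!: continuous_intros)
next
  case (Suc k)
  show ?case
  proof (rule C_k_on_SucI[OF assms(1)])
    show "((\<lambda>x. f x + g x) has_derivative
        (\<lambda>v. frechet_derivative f (at x) v + frechet_derivative g (at x) v)) (at x)"
      if "x \<in> S" for x
      using C_k_on_derivative[OF Suc.prems(1) that] C_k_on_derivative[OF Suc.prems(2) that]
      by (rule has_derivative_add)
  qed (use Suc in auto)
qed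

lemma C_k_on_sum:
  assumes "open S" "\<And>i. i \<in> I \<Longrightarrow> C_k_on k (f i) S"
  shows "C_k_on k (\<lambda>x. \<Sum>i\<in>I. f i x) S"
  using assms(2)
  by (induction I rule: infinite_finite_induct)
     (auto intro!: C_k_on_add[OF assms(1)] C_k_on_const)

lemma C_k_on_bilinear:
  assumes "open S" "bounded_bilinear h" "C_k_on k f S" "C_k_on k g S"
  shows "C_k_on k (\<lambda>x. h (f x) (g x)) S"
  using assms(3,4)
proof (induction k arbitrary: f g)
  case 0
  then show ?case by (simp add: bounded_bilinear.continuous_on[OF assms(2)])
next
  case (Suc k)
  show ?case
  proof (rule C_k_on_SucI[OF assms(1)])
    show "((\<lambda>x. h (f x) (g x)) has_derivative
        (\<lambda>v. h (f x) (frechet_derivative g (at x) v) + h (frechet_derivative f (at x) v) (g x))) (at x)"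
      if "x \<in> S" for x
      using C_k_on_derivative[OF Suc.prems(1) that] C_k_on_derivative[OF Suc.prems(2) that]
      by (rule bounded_bilinear.FDERIV[OF assms(2)])
    show "C_k_on k (\<lambda>x. h (f x) (frechet_derivative g (at x) v)
        + h (frechet_derivative f (at x) v) (g x)) S" for v
      \<comment> \<open>Each summand of the product rule contains one undifferentiated factor, which
        is used here only to order \<open>k\<close>.\<close>
      using Suc.prems Suc.prems[THEN C_k_on_SucD]
      by (intro C_k_on_add[OF assms(1)] Suc.IH) (auto simp only: C_k_on.simps)
  qed
qed

lemma C_k_on_ident: "open S \<Longrightarrow> C_k_on k (\<lambda>x. x) S"
proof (induction k)
  case (Suc k)
  show ?case
    by (rule C_k_on_SucI[where f'="\<lambda>_ v. v"]) (use Suc in \<open>auto intro: C_k_on_const\<close>)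
qed auto

text \<open>The chain rule evaluates the derivative of \<open>g\<close> in the direction
  \<open>frechet_derivative f (at x) v\<close>, which varies with \<open>x\<close>, while
  \<open>C_k_on\<close> controls derivatives of \<open>g\<close> in fixed directions only. Expanding
  the varying direction in a basis turns the derivative into a finite sum of products, to which the
  induction hypothesis applies.\<close>

lemma C_k_on_compose:
  fixes f :: "'a::real_normed_vector \<Rightarrow> 'b::real_normed_vector" and g :: "'b \<Rightarrow> 'c::real_normed_vector"
  assumes "finite_dim TYPE('b)" "open S" "C_k_on k f S" "C_k_on k g T" "f ` S \<subseteq> T"
  shows "C_k_on k (\<lambda>x. g (f x)) S"
proof -
  obtain B :: "'b set" and \<beta> :: "'b \<Rightarrow> 'b \<Rightarrow>\<^sub>L real"
    where B: "finite B" "\<And>x. (\<Sum>b\<in>B. \<beta> b x *\<^sub>R b) = x"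
    using finite_dim_dual_basis[OF assms(1)] by blast
  show ?thesis using assms(3,4)
  proof (induction k arbitrary: g)
    case 0
    then show ?case
      using assms(5) by (auto intro: continuous_on_compose2)
  next
    case (Suc k)
    let ?f' = "\<lambda>x. frechet_derivative f (at x)" and ?g' = "\<lambda>y. frechet_derivative g (at y)"
    show ?case
    proof (rule C_k_on_SucI[OF assms(2)])
      fix x assume x: "x \<in> S"
      then have fx: "f x \<in> T" using assms(5) by blast
      show "((\<lambda>x. g (f x)) has_derivative (\<lambda>v. \<Sum>b\<in>B. \<beta> b (?f' x v) *\<^sub>R ?g' (f x) b)) (at x)"
      proof -
        have "linear (?g' (f x))"
          using C_k_on_derivative[OF Suc.prems(2) fx] has_derivative_linear by blast
        then have "(\<Sum>b\<in>B. \<beta> b w *\<^sub>R ?g' (f x) b) = ?g' (f x) w" for w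
          using arg_cong[OF B(2)[of w], of "?g' (f x)"] by (simp add: linear_sum linear_scale)
        then show ?thesis
          using has_derivative_compose[OF C_k_on_derivative[OF Suc.prems(1) x] C_k_on_derivative[OF Suc.prems(2) fx]]
          by simp
      qed
    next
      fix v
      have "C_k_on k f S" using Suc.prems(1) by (rule C_k_on_SucD)
      then show "C_k_on k (\<lambda>x. \<Sum>b\<in>B. \<beta> b (?f' x v) *\<^sub>R ?g' (f x) b) S"
        using Suc.prems
        by (intro C_k_on_sum[OF assms(2)] C_k_on_bilinear[OF assms(2) bounded_bilinear_scaleR]
            C_k_on_linear[OF assms(2) blinfun.bounded_linear_right] Suc.IH) auto
    qed
  qed
qed

section \<open>Smooth maps of infinite order\<close>

lemma C_infinity_on_open: "C_infinity_on f S \<Longrightarrow> open S"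
  by (simp add: C_infinity_on_def)

lemma C_infinity_on_cong:
  "(\<And>x. x \<in> S \<Longrightarrow> f x = g x) \<Longrightarrow> C_infinity_on f S \<longleftrightarrow> C_infinity_on g S"
  unfolding C_infinity_on_def using C_k_on_cong by blast

lemma C_infinity_on_subset: "C_infinity_on f T \<Longrightarrow> open S \<Longrightarrow> S \<subseteq> T \<Longrightarrow> C_infinity_on f S"
  unfolding C_infinity_on_def using C_k_on_subset by blast

lemma C_infinity_on_has_derivative:
  "C_infinity_on f S \<Longrightarrow> x \<in> S \<Longrightarrow> (f has_derivative frechet_derivative f (at x)) (at x)"
  unfolding C_infinity_on_def using C_k_on_derivative by blast

lemma C_infinity_on_derivative:
  "C_infinity_on f S \<Longrightarrow> C_infinity_on (\<lambda>x. frechet_derivative f (at x) v) S"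
  unfolding C_infinity_on_def using C_k_on.simps(2) by blast

lemma C_infinity_on_const: "open S \<Longrightarrow> C_infinity_on (\<lambda>x. c) S"
  unfolding C_infinity_on_def using C_k_on_const by blast

lemma C_infinity_on_ident: "open S \<Longrightarrow> C_infinity_on (\<lambda>x. x) S"
  unfolding C_infinity_on_def using C_k_on_ident by blast

lemma C_infinity_on_linear:
  "bounded_linear h \<Longrightarrow> C_infinity_on f S \<Longrightarrow> C_infinity_on (\<lambda>x. h (f x)) S"
  unfolding C_infinity_on_def using C_k_on_linear by blast

lemma C_infinity_on_add:
  "C_infinity_on f S \<Longrightarrow> C_infinity_on g S \<Longrightarrow> C_infinity_on (\<lambda>x. f x + g x) S"
  unfolding C_infinity_on_def using C_k_on_add by blast

lemma C_infinity_on_bilinear: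
  "bounded_bilinear h \<Longrightarrow> C_infinity_on f S \<Longrightarrow> C_infinity_on g S \<Longrightarrow>
    C_infinity_on (\<lambda>x. h (f x) (g x)) S"
  unfolding C_infinity_on_def using C_k_on_bilinear by blast

lemma C_infinity_on_compose:
  fixes f :: "'a::real_normed_vector \<Rightarrow> 'b::real_normed_vector" and g :: "'b \<Rightarrow> 'c::real_normed_vector"
  assumes "finite_dim TYPE('b)" "C_infinity_on f S" "C_infinity_on g T" "f ` S \<subseteq> T"
  shows "C_infinity_on (\<lambda>x. g (f x)) S"
  using assms C_k_on_compose unfolding C_infinity_on_def by blast

text \<open>An affine inner map has a constant derivative, so the outer map is only ever
  differentiated in the fixed directions \<open>h v\<close> and no basis of the intermediate space
  enters. That space may thus be a product of model spaces.\<close>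

lemma C_k_on_compose_affine:
  assumes "open T" "bounded_linear h" "C_k_on k g T"
  shows "C_k_on k (\<lambda>x. g (h x + c)) ((\<lambda>x. h x + c) -` T)"
  using assms(3)
proof (induction k arbitrary: g)
  case 0
  have "continuous_on UNIV (\<lambda>x. h x + c)"
    by (intro continuous_intros bounded_linear.continuous_on[OF assms(2)])
  then have "continuous_on ((\<lambda>x. h x + c) -` T) (\<lambda>x. h x + c)"
    using continuous_on_subset by blast
  moreover have "continuous_on T g" using 0 by simp
  ultimately show ?case
    by (simp add: continuous_on_compose2[where g=g and f="\<lambda>x. h x + c"] image_vimage_subset)
next
  case (Suc k)
  have h: "((\<lambda>x. h x + c) has_derivative h) (at x)" for x
    using bounded_linear_imp_has_derivative[OF assms(2)] has_derivative_add_const by blast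
  have "continuous_on UNIV (\<lambda>x. h x + c)"
    by (intro continuous_intros bounded_linear.continuous_on[OF assms(2)])
  then have op: "open ((\<lambda>x. h x + c) -` T)"
    using assms(1) by (simp add: open_vimage)
  show ?case
  proof (rule C_k_on_SucI[OF op])
    show "((\<lambda>x. g (h x + c)) has_derivative (\<lambda>v. frechet_derivative g (at (h x + c)) (h v))) (at x)"
      if "x \<in> (\<lambda>x. h x + c) -` T" for x
      using has_derivative_compose[OF h C_k_on_derivative[OF Suc.prems]] that by simp
  qed (use Suc in auto)
qed

lemma C_infinity_on_compose_affine:
  assumes "bounded_linear h" "C_infinity_on g T"
  shows "C_infinity_on (\<lambda>x. g (h x + c)) ((\<lambda>x. h x + c) -` T)"
proof -
  have "continuous_on UNIV (\<lambda>x. h x + c)"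
    by (intro continuous_intros bounded_linear.continuous_on[OF assms(1)])
  then show ?thesis
    using assms C_k_on_compose_affine unfolding C_infinity_on_def by (metis open_vimage)
qed

lemma C_infinity_on_Pair:
  assumes "C_infinity_on f S" "C_infinity_on g S"
  shows "C_infinity_on (\<lambda>x. (f x, g x)) S"
proof -
  have "bounded_linear (\<lambda>u. (u, 0))" "bounded_linear (\<lambda>u. (0, u))"
    by (intro bounded_linear_intros)+
  from C_infinity_on_add[OF C_infinity_on_linear[OF this(1) assms(1)] C_infinity_on_linear[OF this(2) assms(2)]]
  show ?thesis by simp
qed

text \<open>A functional is the combination of the coordinate functionals with its own values on the
  basis as coefficients, so smoothness of these finitely many values suffices.\<close>

lemma C_infinity_on_blinfun:
  fixes f :: "'a::real_normed_vector \<Rightarrow> 'b::real_normed_vector \<Rightarrow>\<^sub>L real"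
  assumes "finite_dim TYPE('b)" "open S" "\<And>e. C_infinity_on (\<lambda>x. f x e) S"
  shows "C_infinity_on f S"
proof -
  obtain B :: "'b set" and \<beta> :: "'b \<Rightarrow> 'b \<Rightarrow>\<^sub>L real"
    where B: "finite B" "\<And>x. (\<Sum>b\<in>B. \<beta> b x *\<^sub>R b) = x"
    using finite_dim_dual_basis[OF assms(1)] by blast
  have *: "f x e = (\<Sum>b\<in>B. f x b *\<^sub>R \<beta> b) e" for x e
    using arg_cong[OF B(2)[of e], of "f x"]
    by (simp add: blinfun.sum_right blinfun.sum_left blinfun.scaleR_left blinfun.scaleR_right mult.commute)
  have eq: "f = (\<lambda>x. \<Sum>b\<in>B. f x b *\<^sub>R \<beta> b)"
    by (rule ext, rule blinfun_eqI, rule *)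
  have "C_k_on k (\<lambda>x. \<Sum>b\<in>B. f x b *\<^sub>R \<beta> b) S" for k
    using assms(2,3) unfolding C_infinity_on_def
    by (intro C_k_on_sum C_k_on_linear[of S "\<lambda>r. r *\<^sub>R c" for c] bounded_linear_scaleR_left) auto
  then have "C_infinity_on (\<lambda>x. \<Sum>b\<in>B. f x b *\<^sub>R \<beta> b) S"
    using assms(2) unfolding C_infinity_on_def by blast
  then show ?thesis by (simp only: eq[symmetric])
qed

section \<open>Symmetry of second derivatives\<close>

lemma C_infinity_on_directional_DERIV:
  fixes f :: "'a::real_normed_vector \<Rightarrow> real"
  assumes "C_infinity_on f S" "x + t *\<^sub>R v \<in> S"
  shows "((\<lambda>t. f (x + t *\<^sub>R v)) has_real_derivative
    frechet_derivative f (at (x + t *\<^sub>R v)) v) (at t)"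
proof -
  let ?D = "frechet_derivative f (at (x + t *\<^sub>R v))"
  have f: "(f has_derivative ?D) (at (x + t *\<^sub>R v))"
    using C_infinity_on_has_derivative[OF assms] .
  have "((\<lambda>t. x + t *\<^sub>R v) has_derivative (\<lambda>h. h *\<^sub>R v)) (at t)"
    by (auto intro!: derivative_eq_intros)
  from has_derivative_compose[OF this f]
  have "((\<lambda>t. f (x + t *\<^sub>R v)) has_derivative (\<lambda>h. ?D (h *\<^sub>R v))) (at t)" .
  moreover have "?D (h *\<^sub>R v) = ?D v * h" for h
    using linear_scale[OF has_derivative_linear[OF f]] by simp
  ultimately show ?thesis by (simp add: has_field_derivative_def)
qed

text \<open>The mean value theorem is applied twice: in direction \<open>u\<close> to the difference
  of \<open>f\<close> along two opposite sides of the parallelogram, then in direction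
  \<open>v\<close> to the directional derivative so obtained.\<close>

lemma second_difference_mvt:
  fixes f :: "'a::real_normed_vector \<Rightarrow> real"
  assumes f: "C_infinity_on f S" and s: "s > 0"
    and S: "\<And>a b. 0 \<le> a \<Longrightarrow> a \<le> s \<Longrightarrow> 0 \<le> b \<Longrightarrow> b \<le> s \<Longrightarrow> x + a *\<^sub>R u + b *\<^sub>R v \<in> S"
  obtains a b where "0 \<le> a" "a \<le> s" "0 \<le> b" "b \<le> s"
    "f (x + s *\<^sub>R u + s *\<^sub>R v) - f (x + s *\<^sub>R u) - f (x + s *\<^sub>R v) + f x =
      s * s * frechet_derivative (\<lambda>y. frechet_derivative f (at y) u) (at (x + a *\<^sub>R u + b *\<^sub>R v)) v"
proof -
  let ?g = "\<lambda>y. frechet_derivative f (at y) u"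
  have "((\<lambda>a. f (x + s *\<^sub>R v + a *\<^sub>R u) - f (x + a *\<^sub>R u)) has_real_derivative
      ?g (x + s *\<^sub>R v + a *\<^sub>R u) - ?g (x + a *\<^sub>R u)) (at a)" if "0 \<le> a" "a \<le> s" for a
    using S[OF that, of s] S[OF that, of 0] s
    by (intro DERIV_diff C_infinity_on_directional_DERIV[OF f]) (auto simp: algebra_simps)
  from MVT2[OF s this] obtain a where a: "0 < a" "a < s"
    "(f (x + s *\<^sub>R v + s *\<^sub>R u) - f (x + s *\<^sub>R u)) - (f (x + s *\<^sub>R v + 0 *\<^sub>R u) - f (x + 0 *\<^sub>R u))
      = (s - 0) * (?g (x + s *\<^sub>R v + a *\<^sub>R u) - ?g (x + a *\<^sub>R u))"
    by blast
  have "((\<lambda>b. ?g (x + a *\<^sub>R u + b *\<^sub>R v)) has_real_derivative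
      frechet_derivative ?g (at (x + a *\<^sub>R u + b *\<^sub>R v)) v) (at b)" if "0 \<le> b" "b \<le> s" for b
    using S[OF _ _ that, of a] a(1,2)
    by (intro C_infinity_on_directional_DERIV[OF C_infinity_on_derivative[OF f]]) auto
  from MVT2[OF s this] obtain b where b: "0 < b" "b < s"
    "?g (x + a *\<^sub>R u + s *\<^sub>R v) - ?g (x + a *\<^sub>R u + 0 *\<^sub>R v)
      = (s - 0) * frechet_derivative ?g (at (x + a *\<^sub>R u + b *\<^sub>R v)) v"
    by blast
  have eqs: "x + s *\<^sub>R v + s *\<^sub>R u = x + s *\<^sub>R u + s *\<^sub>R v" "x + s *\<^sub>R v + a *\<^sub>R u = x + a *\<^sub>R u + s *\<^sub>R v"
    by simp_all
  have "f (x + s *\<^sub>R u + s *\<^sub>R v) - f (x + s *\<^sub>R u) - f (x + s *\<^sub>R v) + f x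
      = s * (?g (x + a *\<^sub>R u + s *\<^sub>R v) - ?g (x + a *\<^sub>R u))"
    using a(3) unfolding eqs by simp
  also have "\<dots> = s * s * frechet_derivative ?g (at (x + a *\<^sub>R u + b *\<^sub>R v)) v"
    using b(3) by simp
  finally show ?thesis using that a(1,2) b(1,2) by (meson less_imp_le)
qed

text \<open>The second difference over a parallelogram is symmetric in \<open>u\<close> and
  \<open>v\<close>. It equals the squared scale times either mixed derivative, each at some point of
  the parallelogram; shrinking the scale and using continuity makes the two derivatives agree at
  \<open>x\<close>.\<close>

lemma second_derivative_symmetric_real:
  fixes f :: "'a::real_normed_vector \<Rightarrow> real"
  assumes f: "C_infinity_on f S" and x: "x \<in> S"
  shows "frechet_derivative (\<lambda>y. frechet_derivative f (at y) u) (at x) v =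
    frechet_derivative (\<lambda>y. frechet_derivative f (at y) v) (at x) u"
proof -
  define P where "P = (\<lambda>y. frechet_derivative (\<lambda>y. frechet_derivative f (at y) u) (at y) v)"
  define R where "R = (\<lambda>y. frechet_derivative (\<lambda>y. frechet_derivative f (at y) v) (at y) u)"
  have opS: "open S" using C_infinity_on_open[OF f] .
  have "C_infinity_on P S" "C_infinity_on R S"
    unfolding P_def R_def by (intro C_infinity_on_derivative f)+
  then have "C_k_on 0 P S" "C_k_on 0 R S"
    unfolding C_infinity_on_def by blast+
  then have cont: "isCont P x" "isCont R x"
    using opS x by (simp_all add: continuous_on_eq_continuous_at)
  have "\<bar>P x - R x\<bar> \<le> e" if e: "e > 0" for e
  proof -
    obtain d1 where d1: "d1 > 0" "\<And>y. dist y x < d1 \<Longrightarrow> dist (P y) (P x) < e / 2"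
      using cont(1) half_gt_zero[OF e] unfolding continuous_at_eps_delta by blast
    obtain d2 where d2: "d2 > 0" "\<And>y. dist y x < d2 \<Longrightarrow> dist (R y) (R x) < e / 2"
      using cont(2) half_gt_zero[OF e] unfolding continuous_at_eps_delta by blast
    obtain d3 where d3: "d3 > 0" "\<And>y. dist y x < d3 \<Longrightarrow> y \<in> S"
      using opS x unfolding open_dist by blast
    define d where "d = min d1 (min d2 d3)"
    \<comment> \<open>This scale keeps the parallelogram inside the ball of radius \<open>d\<close>.
      The summand 1 keeps the denominator positive even for zero vectors and makes the estimate
      strict.\<close>
    define s where "s = d / (norm u + norm v + 1)"
    have d: "d > 0" and s: "s > 0" using d1 d2 d3 by (simp_all add: d_def s_def add_nonneg_pos)
    have near: "dist (x + a *\<^sub>R u + b *\<^sub>R v) x < d"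
      if "0 \<le> a" "a \<le> s" "0 \<le> b" "b \<le> s" for a b
    proof -
      have "dist (x + a *\<^sub>R u + b *\<^sub>R v) x \<le> norm (a *\<^sub>R u) + norm (b *\<^sub>R v)"
        using norm_triangle_ineq[of "a *\<^sub>R u" "b *\<^sub>R v"] by (simp add: dist_norm add.assoc)
      also have "\<dots> \<le> s * norm u + s * norm v"
        using that by (intro add_mono) (simp_all add: mult_right_mono)
      also have "\<dots> < s * (norm u + norm v + 1)" using s by (simp add: algebra_simps)
      also have "\<dots> = d"
        using norm_ge_zero[of u] norm_ge_zero[of v] unfolding s_def by (simp add: add_nonneg_eq_0_iff)
      finally show ?thesis .
    qed
    have S: "x + a *\<^sub>R u + b *\<^sub>R v \<in> S"
      if "0 \<le> a" "a \<le> s" "0 \<le> b" "b \<le> s" for a b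
      using near[OF that] d3(2) by (simp add: d_def)
    \<comment> \<open>The same parallelogram with its sides listed in the other order, for the
      second use of the mean value theorem.\<close>
    have S': "x + b *\<^sub>R v + a *\<^sub>R u \<in> S"
      if "0 \<le> b" "b \<le> s" "0 \<le> a" "a \<le> s" for a b
      using S[OF that(3,4,1,2)] by (simp add: algebra_simps)
    obtain a b where ab: "0 \<le> a" "a \<le> s" "0 \<le> b" "b \<le> s"
      "f (x + s *\<^sub>R u + s *\<^sub>R v) - f (x + s *\<^sub>R u) - f (x + s *\<^sub>R v) + f x =
        s * s * P (x + a *\<^sub>R u + b *\<^sub>R v)"
      using second_difference_mvt[OF f s S] unfolding P_def .
    obtain a' b' where ab': "0 \<le> b'" "b' \<le> s" "0 \<le> a'" "a' \<le> s"
      "f (x + s *\<^sub>R v + s *\<^sub>R u) - f (x + s *\<^sub>R v) - f (x + s *\<^sub>R u) + f x =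
        s * s * R (x + b' *\<^sub>R v + a' *\<^sub>R u)"
      using second_difference_mvt[OF f s S'] unfolding R_def .
    have eqs: "x + s *\<^sub>R v + s *\<^sub>R u = x + s *\<^sub>R u + s *\<^sub>R v"
      "x + b' *\<^sub>R v + a' *\<^sub>R u = x + a' *\<^sub>R u + b' *\<^sub>R v"
      by simp_all
    have "s * s * P (x + a *\<^sub>R u + b *\<^sub>R v) = s * s * R (x + a' *\<^sub>R u + b' *\<^sub>R v)"
      using ab(5) ab'(5) unfolding eqs by linarith
    then have "P (x + a *\<^sub>R u + b *\<^sub>R v) = R (x + a' *\<^sub>R u + b' *\<^sub>R v)" using s by simp
    moreover have "dist (P (x + a *\<^sub>R u + b *\<^sub>R v)) (P x) < e / 2"
      using near[OF ab(1-4)] by (intro d1) (simp add: d_def)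
    moreover have "dist (R (x + a' *\<^sub>R u + b' *\<^sub>R v)) (R x) < e / 2"
      using near[OF ab'(3,4,1,2)] by (intro d2) (simp add: d_def)
    ultimately show ?thesis unfolding dist_real_def by linarith
  qed
  then have "\<bar>P x - R x\<bar> \<le> 0" by (rule field_le_epsilon) simp
  then show ?thesis unfolding P_def R_def by simp
qed

text \<open>Coordinate functionals are bounded linear and so commute with both differentiations; the
  real case holds for each component and the basis expansion reassembles them.\<close>

lemma second_derivative_symmetric:
  fixes f :: "'a::real_normed_vector \<Rightarrow> 'b::real_normed_vector"
  assumes fin: "finite_dim TYPE('b)" and f: "C_infinity_on f S" and x: "x \<in> S"
  shows "frechet_derivative (\<lambda>y. frechet_derivative f (at y) u) (at x) v =
    frechet_derivative (\<lambda>y. frechet_derivative f (at y) v) (at x) u"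
proof -
  obtain B :: "'b set" and \<beta> :: "'b \<Rightarrow> 'b \<Rightarrow>\<^sub>L real"
    where B: "finite B" "\<And>x. (\<Sum>b\<in>B. \<beta> b x *\<^sub>R b) = x"
    using finite_dim_dual_basis[OF fin] by blast
  have opS: "open S" using C_infinity_on_open[OF f] .
  have D1: "frechet_derivative (\<lambda>y. \<beta> b (g y)) (at y) w = \<beta> b (frechet_derivative g (at y) w)"
    if "C_infinity_on g S" "y \<in> S" for b y w and g :: "'a \<Rightarrow> 'b"
    using frechet_derivative_at[OF bounded_linear.has_derivative[OF blinfun.bounded_linear_right
          C_infinity_on_has_derivative[OF that], of "\<beta> b"]] by metis
  have D2: "frechet_derivative (\<lambda>y. frechet_derivative (\<lambda>y. \<beta> b (f y)) (at y) w) (at x) w'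
      = \<beta> b (frechet_derivative (\<lambda>y. frechet_derivative f (at y) w) (at x) w')" for b w w'
  proof -
    have g: "C_infinity_on (\<lambda>y. frechet_derivative f (at y) w) S"
      using f by (rule C_infinity_on_derivative)
    have "((\<lambda>y. \<beta> b (frechet_derivative f (at y) w)) has_derivative
        (\<lambda>w'. \<beta> b (frechet_derivative (\<lambda>y. frechet_derivative f (at y) w) (at x) w'))) (at x)"
      using C_infinity_on_has_derivative[OF g x]
      by (rule bounded_linear.has_derivative[OF blinfun.bounded_linear_right])
    then have "((\<lambda>y. frechet_derivative (\<lambda>y. \<beta> b (f y)) (at y) w) has_derivative
        (\<lambda>w'. \<beta> b (frechet_derivative (\<lambda>y. frechet_derivative f (at y) w) (at x) w'))) (at x)"
      by (rule has_derivative_transform_within_open[OF _ opS x]) (simp add: D1[OF f])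
    then show ?thesis using frechet_derivative_at by metis
  qed
  have "\<beta> b (frechet_derivative (\<lambda>y. frechet_derivative f (at y) u) (at x) v) =
    \<beta> b (frechet_derivative (\<lambda>y. frechet_derivative f (at y) v) (at x) u)" for b
    using second_derivative_symmetric_real[OF C_infinity_on_linear[OF blinfun.bounded_linear_right f] x, of "\<beta> b" u v]
    unfolding D2 .
  then have "(\<Sum>b\<in>B. \<beta> b (frechet_derivative (\<lambda>y. frechet_derivative f (at y) u) (at x) v) *\<^sub>R b) =
    (\<Sum>b\<in>B. \<beta> b (frechet_derivative (\<lambda>y. frechet_derivative f (at y) v) (at x) u) *\<^sub>R b)"
    by simp
  then show ?thesis unfolding B(2) .
qed

section \<open>Charts and tangent vectors\<close>

lemma smooth_manifold_finite_dim:
  "smooth_manifold (M :: ('a, 'e::real_normed_vector) atlas) \<Longrightarrow> finite_dim TYPE('e)"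
  by (auto simp: smooth_manifold_def finite_dim_def)

lemma smooth_manifold_atlas: "smooth_manifold M \<Longrightarrow> smooth_atlas M"
  by (simp add: smooth_manifold_def)

lemma charts_atD: "c \<in> charts_at M p \<Longrightarrow> c \<in> M" "c \<in> charts_at M p \<Longrightarrow> p \<in> cdom c"
  by (auto simp: charts_at_def)

lemma chart_at_charts_at: "p \<in> points M \<Longrightarrow> chart_at M p \<in> charts_at M p"
  unfolding chart_at_def by (rule someI_ex) (auto simp: points_def charts_at_def)

lemma charts_at_points: "c \<in> charts_at M p \<Longrightarrow> p \<in> points M"
  by (auto simp: points_def charts_at_def)

lemma cmap_cinv: "x \<in> cmap c ` cdom c \<Longrightarrow> cmap c (cinv c x) = x"
  unfolding cinv_def by (rule f_inv_into_f)

lemma cinv_in_cdom: "x \<in> cmap c ` cdom c \<Longrightarrow> cinv c x \<in> cdom c"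
  unfolding cinv_def by (rule inv_into_into)

lemma cinv_cmap: "smooth_atlas M \<Longrightarrow> c \<in> M \<Longrightarrow> p \<in> cdom c \<Longrightarrow> cinv c (cmap c p) = p"
  unfolding cinv_def smooth_atlas_def by (auto intro: inv_into_f_f)

lemma open_chart_image: "smooth_atlas M \<Longrightarrow> c \<in> M \<Longrightarrow> open (cmap c ` cdom c)"
  by (auto simp: smooth_atlas_def)

lemma transition_smooth:
  "smooth_atlas M \<Longrightarrow> c \<in> M \<Longrightarrow> d \<in> M \<Longrightarrow>
    C_infinity_on (cmap d \<circ> cinv c) (cmap c ` (cdom c \<inter> cdom d))"
  by (auto simp: smooth_atlas_def)

text \<open>Transition maps are the local representatives of \<open>id\<close>; through this lemma
  the rules for smooth maps also yield those for changes of chart.\<close>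

lemma smooth_map_id: "smooth_atlas M \<Longrightarrow> smooth_map M M id"
  by (auto simp: smooth_map_def transition_smooth)

lemma smooth_map_local:
  "smooth_map M N f \<Longrightarrow> c \<in> M \<Longrightarrow> d \<in> N \<Longrightarrow>
    C_infinity_on (cmap d \<circ> f \<circ> cinv c) (cmap c ` (cdom c \<inter> f -` cdom d))"
  by (auto simp: smooth_map_def)

lemma smooth_map_derivative:
  assumes "smooth_map M N f" "c \<in> charts_at M p" "d \<in> charts_at N (f p)"
  shows "(cmap d \<circ> f \<circ> cinv c has_derivative
    frechet_derivative (cmap d \<circ> f \<circ> cinv c) (at (cmap c p))) (at (cmap c p))"
proof (rule C_infinity_on_has_derivative)
  show "C_infinity_on (cmap d \<circ> f \<circ> cinv c) (cmap c ` (cdom c \<inter> f -` cdom d))"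
    using smooth_map_local[OF assms(1) charts_atD(1)[OF assms(2)] charts_atD(1)[OF assms(3)]] .
  show "cmap c p \<in> cmap c ` (cdom c \<inter> f -` cdom d)"
    using assms(2,3) by (auto dest: charts_atD)
qed

text \<open>Near \<open>cmap c p\<close> the intermediate chart \<open>d\<close> cancels, so the
  ordinary chain rule applies. The cancellation holds only on the open set of coordinates whose
  points \<open>f\<close> sends into \<open>cdom d\<close>.\<close>

lemma smooth_map_chain:
  assumes "smooth_atlas M" "smooth_atlas N" "smooth_map M N f" "smooth_map N P h"
    and "c \<in> charts_at M p" "d \<in> charts_at N (f p)" "e \<in> charts_at P (h (f p))"
  shows "frechet_derivative (cmap e \<circ> (h \<circ> f) \<circ> cinv c) (at (cmap c p)) v =
    frechet_derivative (cmap e \<circ> h \<circ> cinv d) (at (cmap d (f p)))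
      (frechet_derivative (cmap d \<circ> f \<circ> cinv c) (at (cmap c p)) v)"
proof -
  let ?S = "cmap c ` (cdom c \<inter> f -` cdom d)"
  note c = charts_atD[OF assms(5)] and d = charts_atD[OF assms(6)]
  have p: "cinv c (cmap c p) = p" using cinv_cmap[OF assms(1) c] .
  have "open ?S" using smooth_map_local[OF assms(3) c(1) d(1)] C_infinity_on_open by blast
  moreover have "cmap c p \<in> ?S" using c d by auto
  moreover have "((cmap e \<circ> h \<circ> cinv d) \<circ> (cmap d \<circ> f \<circ> cinv c) has_derivative
      frechet_derivative (cmap e \<circ> h \<circ> cinv d) (at (cmap d (f p))) \<circ>
      frechet_derivative (cmap d \<circ> f \<circ> cinv c) (at (cmap c p))) (at (cmap c p))"
    using smooth_map_derivative[OF assms(3,5,6)] smooth_map_derivative[OF assms(4,6,7)]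
    by (intro diff_chain_at) (simp_all add: p)
  moreover have "((cmap e \<circ> h \<circ> cinv d) \<circ> (cmap d \<circ> f \<circ> cinv c)) x = (cmap e \<circ> (h \<circ> f) \<circ> cinv c) x"
    if "x \<in> ?S" for x
    using that cinv_cmap[OF assms(1) c(1)] cinv_cmap[OF assms(2) d(1)] by auto
  ultimately have "(cmap e \<circ> (h \<circ> f) \<circ> cinv c has_derivative
      frechet_derivative (cmap e \<circ> h \<circ> cinv d) (at (cmap d (f p))) \<circ>
      frechet_derivative (cmap d \<circ> f \<circ> cinv c) (at (cmap c p))) (at (cmap c p))"
    using has_derivative_transform_within_open by blast
  from frechet_derivative_at[OF this] show ?thesis by (metis comp_apply)
qed

lemma transition_derivative:
  assumes "smooth_atlas M" "c \<in> charts_at M p" "d \<in> charts_at M p"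
  shows "(cmap d \<circ> cinv c has_derivative frechet_derivative (cmap d \<circ> cinv c) (at (cmap c p)))
    (at (cmap c p))"
  using smooth_map_derivative[OF smooth_map_id[OF assms(1)] assms(2), of d] assms(3) by simp

lemma transition_chain:
  assumes "smooth_atlas M" "c \<in> charts_at M p" "d \<in> charts_at M p" "e \<in> charts_at M p"
  shows "frechet_derivative (cmap e \<circ> cinv c) (at (cmap c p)) v =
    frechet_derivative (cmap e \<circ> cinv d) (at (cmap d p))
      (frechet_derivative (cmap d \<circ> cinv c) (at (cmap c p)) v)"
  using smooth_map_chain[OF assms(1) assms(1) smooth_map_id[OF assms(1)] smooth_map_id[OF assms(1)] assms(2), of d e]
    assms(3,4) by simp

lemma transition_self:
  assumes "smooth_atlas M" "c \<in> charts_at M p"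
  shows "frechet_derivative (cmap c \<circ> cinv c) (at (cmap c p)) v = v"
proof -
  have "(cmap c \<circ> cinv c has_derivative (\<lambda>v. v)) (at (cmap c p))"
  proof (rule has_derivative_transform_within_open[OF has_derivative_ident])
    show "open (cmap c ` cdom c)" using open_chart_image[OF assms(1) charts_atD(1)[OF assms(2)]] .
    show "cmap c p \<in> cmap c ` cdom c" using charts_atD(2)[OF assms(2)] by blast
  qed (simp add: cmap_cinv)
  then show ?thesis using frechet_derivative_at by metis
qed

section \<open>Tangent vectors and tangent maps\<close>

lemma tangent_spaceI:
  assumes "\<And>c. c \<notin> charts_at M p \<Longrightarrow> v c = 0"
    and "\<And>c d. c \<in> charts_at M p \<Longrightarrow> d \<in> charts_at M p \<Longrightarrow>
      v d = frechet_derivative (cmap d \<circ> cinv c) (at (cmap c p)) (v c)"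
  shows "v \<in> tangent_space M p"
  using assms unfolding tangent_space_def by blast

lemma tangent_space_outside:
  assumes "v \<in> tangent_space M p" "c \<notin> charts_at M p"
  shows "v c = 0"
  using assms unfolding tangent_space_def by blast

lemma tangent_space_transition:
  assumes "v \<in> tangent_space M p" "c \<in> charts_at M p" "d \<in> charts_at M p"
  shows "v d = frechet_derivative (cmap d \<circ> cinv c) (at (cmap c p)) (v c)"
  using assms unfolding tangent_space_def by blast

lemma coord_vector_tangent:
  assumes "smooth_atlas M" "c \<in> charts_at M p"
  shows "coord_vector M c p e \<in> tangent_space M p"
  by (rule tangent_spaceI) (simp_all add: coord_vector_def transition_chain[OF assms, symmetric])

lemma coord_vector_self:
  assumes "smooth_atlas M" "c \<in> charts_at M p"
  shows "coord_vector M c p e c = e"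
  using transition_self[OF assms] assms(2) by (simp add: coord_vector_def)

text \<open>Together with \<open>coord_vector_self\<close> this says that evaluation at a chart
  identifies the tangent space with the model space, which is how every tangent vector is handled
  below.\<close>

lemma coord_vector_component:
  assumes "c \<in> charts_at M p" "v \<in> tangent_space M p"
  shows "coord_vector M c p (v c) = v"
  using tangent_space_transition[OF assms(2,1)] tangent_space_outside[OF assms(2)]
  unfolding coord_vector_def by (intro ext) (metis (full_types))

lemma tangent_space_eqI:
  assumes "u \<in> tangent_space M p" "v \<in> tangent_space M p" "c \<in> charts_at M p" "u c = v c"
  shows "u = v"
  using coord_vector_component[OF assms(3)] assms by metis

lemma coord_vector_change:
  assumes "smooth_atlas M" "c \<in> charts_at M p" "d \<in> charts_at M p"
  shows "coord_vector M c p e = coord_vector M d p (frechet_derivative (cmap d \<circ> cinv c) (at (cmap c p)) e)"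
  by (rule tangent_space_eqI[OF coord_vector_tangent[OF assms(1,2)] coord_vector_tangent[OF assms(1,3)] assms(3)])
    (simp add: coord_vector_self[OF assms(1,3)], simp add: coord_vector_def assms(3))

lemma linear_transition:
  assumes "smooth_atlas M" "c \<in> charts_at M p" "d \<in> charts_at M p"
  shows "linear (frechet_derivative (cmap d \<circ> cinv c) (at (cmap c p)))"
  using has_derivative_linear[OF transition_derivative[OF assms]] .

lemma coord_vector_add:
  assumes "smooth_atlas M" "c \<in> charts_at M p"
  shows "coord_vector M c p (u + v) = (\<lambda>d. coord_vector M c p u d + coord_vector M c p v d)"
  using linear_add[OF linear_transition[OF assms]] by (auto simp: coord_vector_def)

lemma coord_vector_scaleR:
  assumes "smooth_atlas M" "c \<in> charts_at M p"
  shows "coord_vector M c p (r *\<^sub>R u) = (\<lambda>d. r *\<^sub>R coord_vector M c p u d)"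
  using linear_scale[OF linear_transition[OF assms]] by (auto simp: coord_vector_def)

lemma tangent_space_add:
  assumes "smooth_atlas M" "u \<in> tangent_space M p" "v \<in> tangent_space M p"
  shows "(\<lambda>c. u c + v c) \<in> tangent_space M p"
  by (rule tangent_spaceI)
    (simp_all add: tangent_space_outside[OF assms(2)] tangent_space_outside[OF assms(3)]
      linear_add[OF linear_transition[OF assms(1)]]
      tangent_space_transition[OF assms(2), symmetric] tangent_space_transition[OF assms(3), symmetric])

lemma tangent_space_scaleR:
  assumes "smooth_atlas M" "u \<in> tangent_space M p"
  shows "(\<lambda>c. r *\<^sub>R u c) \<in> tangent_space M p"
  by (rule tangent_spaceI)
    (simp_all add: tangent_space_outside[OF assms(2)] linear_scale[OF linear_transition[OF assms(1)]]
      tangent_space_transition[OF assms(2), symmetric])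

text \<open>Frees \<open>tangent_map\<close> from the chart selected by \<open>chart_at\<close>:
  passing to another source chart is the chain rule with \<open>id\<close> as first map.\<close>

lemma tangent_map_component:
  assumes "smooth_atlas M" "smooth_map M N f"
    and "c \<in> charts_at M p" "d \<in> charts_at N (f p)" "v \<in> tangent_space M p"
  shows "tangent_map M N f p v d = frechet_derivative (cmap d \<circ> f \<circ> cinv c) (at (cmap c p)) (v c)"
proof -
  let ?c = "chart_at M p"
  have c: "?c \<in> charts_at M p" using chart_at_charts_at charts_at_points[OF assms(3)] .
  have "tangent_map M N f p v d = frechet_derivative (cmap d \<circ> f \<circ> cinv ?c) (at (cmap ?c p)) (v ?c)"
    using assms(4) by (simp add: tangent_map_def)
  also have "v ?c = frechet_derivative (cmap ?c \<circ> id \<circ> cinv c) (at (cmap c p)) (v c)"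
    using tangent_space_transition[OF assms(5,3) c] by simp
  also have "frechet_derivative (cmap d \<circ> f \<circ> cinv ?c) (at (cmap ?c p)) \<dots> =
      frechet_derivative (cmap d \<circ> (f \<circ> id) \<circ> cinv c) (at (cmap c p)) (v c)"
    using smooth_map_chain[OF assms(1,1) smooth_map_id[OF assms(1)] assms(2,3), of ?c d] c assms(4) by simp
  finally show ?thesis by simp
qed

lemma tangent_map_coord_vector:
  assumes "smooth_atlas M" "smooth_atlas N" "smooth_map M N f"
    and "c \<in> charts_at M p" "d \<in> charts_at N (f p)" "v \<in> tangent_space M p"
  shows "tangent_map M N f p v =
    coord_vector N d (f p) (frechet_derivative (cmap d \<circ> f \<circ> cinv c) (at (cmap c p)) (v c))"
proof
  fix e
  show "tangent_map M N f p v e =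
    coord_vector N d (f p) (frechet_derivative (cmap d \<circ> f \<circ> cinv c) (at (cmap c p)) (v c)) e"
  proof (cases "e \<in> charts_at N (f p)")
    case True
    show ?thesis
      using tangent_map_component[OF assms(1,3,4) True assms(6)] True
        smooth_map_chain[OF assms(1,2,3) smooth_map_id[OF assms(2)] assms(4,5), of e]
      by (simp add: coord_vector_def)
  qed (simp add: tangent_map_def coord_vector_def)
qed

lemma tangent_map_tangent:
  assumes "smooth_atlas M" "smooth_atlas N" "smooth_map M N f" "p \<in> points M" "v \<in> tangent_space M p"
  shows "tangent_map M N f p v \<in> tangent_space N (f p)"
proof -
  have "f p \<in> points N" using assms(3,4) by (auto simp: smooth_map_def)
  then have d: "chart_at N (f p) \<in> charts_at N (f p)" by (rule chart_at_charts_at)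
  show ?thesis
    unfolding tangent_map_coord_vector[OF assms(1-3) chart_at_charts_at[OF assms(4)] d assms(5)]
    by (rule coord_vector_tangent[OF assms(2) d])
qed

lemma tangent_map_compose:
  assumes "smooth_atlas M" "smooth_atlas N" "smooth_map M N f" "smooth_map N P h"
    and "p \<in> points M" "v \<in> tangent_space M p"
  shows "tangent_map N P h (f p) (tangent_map M N f p v) = tangent_map M P (h \<circ> f) p v"
proof
  fix e
  have fp: "f p \<in> points N" using assms(3,5) by (auto simp: smooth_map_def)
  note c = chart_at_charts_at[OF assms(5)] and d = chart_at_charts_at[OF fp]
  show "tangent_map N P h (f p) (tangent_map M N f p v) e = tangent_map M P (h \<circ> f) p v e"
    using smooth_map_chain[OF assms(1-4) c d, of e] tangent_map_component[OF assms(1,3) c d assms(6)]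
    by (simp add: tangent_map_def)
qed

text \<open>Agreement with the identity is required on the manifold only, because an action followed
  by its inverse is known to be the identity just there.\<close>

lemma tangent_map_ident:
  assumes "smooth_atlas M" "\<And>q. q \<in> points M \<Longrightarrow> f q = q"
    and "p \<in> points M" "v \<in> tangent_space M p"
  shows "tangent_map M M f p v = v"
proof
  fix d
  let ?c = "chart_at M p"
  note c = chart_at_charts_at[OF assms(3)]
  show "tangent_map M M f p v d = v d"
  proof (cases "d \<in> charts_at M p")
    case True
    have "((cmap d \<circ> f \<circ> cinv ?c) has_derivative frechet_derivative (cmap d \<circ> cinv ?c) (at (cmap ?c p))) (at (cmap ?c p))"
    proof (rule has_derivative_transform_within_open[OF transition_derivative[OF assms(1) c True]])
      show "open (cmap ?c ` cdom ?c)" using open_chart_image[OF assms(1) charts_atD(1)[OF c]] .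
      show "cmap ?c p \<in> cmap ?c ` cdom ?c" using charts_atD(2)[OF c] by blast
      show "(cmap d \<circ> cinv ?c) x = (cmap d \<circ> f \<circ> cinv ?c) x" if "x \<in> cmap ?c ` cdom ?c" for x
      proof -
        have "cinv ?c x \<in> points M"
          using cinv_in_cdom[OF that] charts_atD(1)[OF c] unfolding points_def by blast
        then show ?thesis using assms(2) by simp
      qed
    qed
    from frechet_derivative_at[OF this] show ?thesis
      using True assms(2,3) tangent_space_transition[OF assms(4) c True]
      by (simp add: tangent_map_def)
  next
    case False
    then show ?thesis using assms(2,3) tangent_space_outside[OF assms(4)] by (simp add: tangent_map_def)
  qed
qed

text \<open>In product charts the inclusion of the slice at \<open>g\<close> is the affine map
  \<open>x \<mapsto> (cmap l g, x)\<close>, so the slice inherits smoothness by composition with an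
  affine map.\<close>

lemma smooth_map_slice:
  fixes L :: "('g, 'f::real_normed_vector) atlas" and Q :: "('q, 'e::real_normed_vector) atlas"
  assumes "smooth_atlas L" "smooth_atlas Q" "smooth_map (prod_atlas L Q) N (\<lambda>(g, q). f g q)" "g \<in> points L"
  shows "smooth_map Q N (f g)"
  unfolding smooth_map_def
proof (intro conjI ballI)
  show "f g \<in> points Q \<rightarrow> points N"
  proof
    fix q assume q: "q \<in> points Q"
    obtain l c where lc: "l \<in> L" "g \<in> cdom l" "c \<in> Q" "q \<in> cdom c"
      using assms(4) q unfolding points_def by blast
    then have "(cdom l \<times> cdom c, map_prod (cmap l) (cmap c)) \<in> prod_atlas L Q"
      unfolding prod_atlas_def by blast
    then have "(g, q) \<in> points (prod_atlas L Q)"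
      unfolding points_def using lc by fastforce
    then have "(\<lambda>(g, q). f g q) (g, q) \<in> points N"
      using assms(3) unfolding smooth_map_def by blast
    then show "f g q \<in> points N" by simp
  qed
next
  fix c d assume c: "c \<in> Q" and d: "d \<in> N"
  obtain l where l: "l \<in> L" "g \<in> cdom l" using assms(4) by (auto simp: points_def)
  let ?k = "(cdom l \<times> cdom c, map_prod (cmap l) (cmap c))"
  let ?T = "cmap ?k ` (cdom ?k \<inter> (\<lambda>(g, q). f g q) -` cdom d)"
  have k: "?k \<in> prod_atlas L Q" using l(1) c unfolding prod_atlas_def by blast
  have inj: "inj_on (cmap ?k) (cdom ?k)"
    using assms(1,2) l(1) c unfolding smooth_atlas_def by (auto intro!: map_prod_inj_on)
  have "bounded_linear (\<lambda>x::'e. (0::'f, x))" by (intro bounded_linear_intros)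
  from C_infinity_on_compose_affine[OF this smooth_map_local[OF assms(3) k d], of "(cmap l g, 0)"]
  have *: "C_infinity_on (\<lambda>x. (cmap d \<circ> (\<lambda>(g, q). f g q) \<circ> cinv ?k) (cmap l g, x)) ((\<lambda>x. (cmap l g, x)) -` ?T)"
    by simp
  \<comment> \<open>Injectivity of the chart \<open>l\<close> forces the group component of a
    preimage to be \<open>g\<close> itself.\<close>
  have eq: "(\<lambda>x. (cmap l g, x)) -` ?T = cmap c ` (cdom c \<inter> f g -` cdom d)"
  proof
    show "(\<lambda>x. (cmap l g, x)) -` ?T \<subseteq> cmap c ` (cdom c \<inter> f g -` cdom d)"
    proof
      fix x assume "x \<in> (\<lambda>x. (cmap l g, x)) -` ?T"
      then obtain g' q where *: "g' \<in> cdom l" "q \<in> cdom c" "f g' q \<in> cdom d" "cmap l g = cmap l g'" "x = cmap c q"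
        by auto
      then have "g' = g" using assms(1) l unfolding smooth_atlas_def by (metis inj_onD)
      then show "x \<in> cmap c ` (cdom c \<inter> f g -` cdom d)" using * by blast
    qed
    show "cmap c ` (cdom c \<inter> f g -` cdom d) \<subseteq> (\<lambda>x. (cmap l g, x)) -` ?T"
    proof
      fix x assume "x \<in> cmap c ` (cdom c \<inter> f g -` cdom d)"
      then obtain q where q: "q \<in> cdom c" "f g q \<in> cdom d" "x = cmap c q" by blast
      then have "cmap ?k (g, q) \<in> ?T" using l(2) by (intro imageI) simp
      then show "x \<in> (\<lambda>x. (cmap l g, x)) -` ?T" using q(3) by simp
    qed
  qed
  have "(cmap d \<circ> (\<lambda>(g, q). f g q) \<circ> cinv ?k) (cmap l g, x) = (cmap d \<circ> f g \<circ> cinv c) x"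
    if "x \<in> cmap c ` (cdom c \<inter> f g -` cdom d)" for x
  proof -
    obtain q where q: "q \<in> cdom c" "x = cmap c q" using \<open>x \<in> _\<close> by blast
    have "cinv ?k (cmap ?k (g, q)) = (g, q)"
      unfolding cinv_def using inj q l by (intro inv_into_f_f) auto
    then show ?thesis using q cinv_cmap[OF assms(2) c] by simp
  qed
  then show "C_infinity_on (cmap d \<circ> f g \<circ> cinv c) (cmap c ` (cdom c \<inter> f g -` cdom d))"
    by (rule iffD1[OF C_infinity_on_cong *[unfolded eq]])
qed

section \<open>Canonical coordinates on the cotangent bundle\<close>

text \<open>The fibre coordinate \<open>p\<close> of \<open>cotangent_chart\<close>.
  \<open>Blinfun\<close> yields the intended functional only for a bounded linear argument;
  \<open>momentum_apply\<close> secures this from finite dimension.\<close>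

definition momentum ::
  "('a, 'e::real_normed_vector) atlas \<Rightarrow> ('a, 'e) chart \<Rightarrow> 'a \<Rightarrow> ('a, 'e) covec \<Rightarrow> 'e \<Rightarrow>\<^sub>L real" where
  "momentum M c q \<xi> = Blinfun (\<lambda>e. \<xi> (coord_vector M c q e))"

text \<open>Inverse to \<open>momentum\<close> at points of the chart domain; the restriction makes
  the result extensional, as \<open>cotangent_space\<close> demands.\<close>

definition covector ::
  "('a, 'e::real_normed_vector) atlas \<Rightarrow> ('a, 'e) chart \<Rightarrow> 'a \<Rightarrow> ('e \<Rightarrow>\<^sub>L real) \<Rightarrow> ('a, 'e) covec" where
  "covector M c q \<pi> = (\<lambda>v\<in>tangent_space M q. \<pi> (v c))"

text \<open>The component function \<open>a\<close> of the form in a chart, with values in the dual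
  of the model space: classically the form is the sum of the \<open>a_i dx^i\<close>.\<close>

definition local_rep ::
  "('a, 'e::real_normed_vector) atlas \<Rightarrow> ('a, 'e) chart \<Rightarrow> ('a, 'e) form1 \<Rightarrow> 'e \<Rightarrow> 'e \<Rightarrow>\<^sub>L real" where
  "local_rep M c \<alpha> x = momentum M c (cinv c x) (\<alpha> (cinv c x))"

definition covec_add ::
  "('a, 'e::real_normed_vector) atlas \<Rightarrow> 'a \<Rightarrow> ('a, 'e) covec \<Rightarrow> ('a, 'e) covec \<Rightarrow> ('a, 'e) covec" where
  "covec_add M q \<xi> \<eta> = (\<lambda>v\<in>tangent_space M q. \<xi> v + \<eta> v)"

definition covec_scale ::
  "('a, 'e::real_normed_vector) atlas \<Rightarrow> 'a \<Rightarrow> real \<Rightarrow> ('a, 'e) covec \<Rightarrow> ('a, 'e) covec" where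
  "covec_scale M q r \<xi> = (\<lambda>v\<in>tangent_space M q. r * \<xi> v)"

lemma fibre_translation_apply: "fibre_translation M \<alpha> (q, \<xi>) = (q, covec_add M q \<xi> (\<alpha> q))"
  by (simp add: fibre_translation_def covec_add_def)

lemma cdom_cotangent_chart: "cdom (cotangent_chart M c) = Sigma (cdom c) (cotangent_space M)"
  by (simp add: cotangent_chart_def)

lemma cmap_cotangent_chart: "cmap (cotangent_chart M c) (q, \<xi>) = (cmap c q, momentum M c q \<xi>)"
  by (simp add: cotangent_chart_def momentum_def)

lemma points_cotangent_bundle: "points (cotangent_bundle M) = Sigma (points M) (cotangent_space M)"
  by (auto simp: points_def cotangent_bundle_def cdom_cotangent_chart)

lemma charts_at_cotangent_bundle:
  assumes "\<xi> \<in> cotangent_space M q"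
  shows "charts_at (cotangent_bundle M) (q, \<xi>) = cotangent_chart M ` charts_at M q"
  using assms by (auto simp: charts_at_def cotangent_bundle_def cdom_cotangent_chart)

lemma cotangent_space_extensional: "\<xi> \<in> cotangent_space M q \<Longrightarrow> \<xi> \<in> extensional (tangent_space M q)"
  by (simp add: cotangent_space_def)

lemma cotangent_space_add:
  "\<xi> \<in> cotangent_space M q \<Longrightarrow> u \<in> tangent_space M q \<Longrightarrow> v \<in> tangent_space M q \<Longrightarrow>
    \<xi> (\<lambda>c. u c + v c) = \<xi> u + \<xi> v"
  by (simp add: cotangent_space_def)

lemma cotangent_space_scaleR:
  "\<xi> \<in> cotangent_space M q \<Longrightarrow> u \<in> tangent_space M q \<Longrightarrow> \<xi> (\<lambda>c. r *\<^sub>R u c) = r * \<xi> u"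
  by (simp add: cotangent_space_def)

lemma cotangent_spaceI:
  assumes "\<xi> \<in> extensional (tangent_space M q)"
    and "\<And>u v. u \<in> tangent_space M q \<Longrightarrow> v \<in> tangent_space M q \<Longrightarrow> \<xi> (\<lambda>c. u c + v c) = \<xi> u + \<xi> v"
    and "\<And>r u. u \<in> tangent_space M q \<Longrightarrow> \<xi> (\<lambda>c. r *\<^sub>R u c) = r * \<xi> u"
  shows "\<xi> \<in> cotangent_space M q"
  using assms by (simp add: cotangent_space_def)

locale finite_dim_atlas =
  fixes M :: "('a, 'e::real_normed_vector) atlas"
  assumes atlas: "smooth_atlas M" and fin: "finite_dim TYPE('e)"
begin

abbreviation TM :: "('a \<times> ('a, 'e) covec, 'e \<times> ('e \<Rightarrow>\<^sub>L real)) atlas" where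
  "TM \<equiv> cotangent_bundle M"

abbreviation overlap :: "('a, 'e) chart \<Rightarrow> ('a, 'e) chart \<Rightarrow> 'e set" where
  "overlap c d \<equiv> cmap c ` (cdom c \<inter> cdom d)"

lemma overlapD:
  assumes "c \<in> M" "d \<in> M" "x \<in> overlap c d"
  shows "cinv c x \<in> cdom c" "cinv c x \<in> cdom d" "c \<in> charts_at M (cinv c x)"
    "d \<in> charts_at M (cinv c x)" "cmap c (cinv c x) = x"
  using assms cinv_cmap[OF atlas assms(1)] unfolding charts_at_def by auto

lemma open_overlap: "c \<in> M \<Longrightarrow> d \<in> M \<Longrightarrow> open (overlap c d)"
  using transition_smooth[OF atlas] C_infinity_on_open by blast

lemma momentum_apply:
  assumes "c \<in> charts_at M q" "\<xi> \<in> cotangent_space M q"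
  shows "momentum M c q \<xi> e = \<xi> (coord_vector M c q e)"
proof -
  note tan = coord_vector_tangent[OF atlas assms(1)]
  have "linear (\<lambda>e. \<xi> (coord_vector M c q e))"
    by (rule linearI)
      (simp_all add: coord_vector_add[OF atlas assms(1)] coord_vector_scaleR[OF atlas assms(1)]
        cotangent_space_add[OF assms(2) tan tan] cotangent_space_scaleR[OF assms(2) tan])
  then show ?thesis
    unfolding momentum_def
    by (simp add: bounded_linear_Blinfun_apply finite_dim_bounded_linear[OF fin])
qed

lemma covector_cotangent: "covector M c q \<pi> \<in> cotangent_space M q"
  by (rule cotangent_spaceI)
    (simp_all add: covector_def tangent_space_add[OF atlas] tangent_space_scaleR[OF atlas]
      blinfun.add_right blinfun.scaleR_right)

lemma momentum_covector:
  assumes "c \<in> charts_at M q"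
  shows "momentum M c q (covector M c q \<pi>) = \<pi>"
  by (rule blinfun_eqI, unfold momentum_apply[OF assms covector_cotangent])
    (simp add: covector_def coord_vector_tangent[OF atlas assms] coord_vector_self[OF atlas assms])

lemma momentum_component:
  assumes "c \<in> charts_at M q" "\<xi> \<in> cotangent_space M q" "v \<in> tangent_space M q"
  shows "momentum M c q \<xi> (v c) = \<xi> v"
  by (simp add: momentum_apply[OF assms(1,2)] coord_vector_component[OF assms(1,3)])

lemma covector_momentum:
  assumes "c \<in> charts_at M q" "\<xi> \<in> cotangent_space M q"
  shows "covector M c q (momentum M c q \<xi>) = \<xi>"
  using cotangent_space_extensional[OF assms(2)]
  by (intro extensionalityI[of _ "tangent_space M q"])
    (simp_all add: covector_def momentum_component[OF assms])

lemma momentum_inject: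
  assumes "c \<in> charts_at M q" "\<xi> \<in> cotangent_space M q" "\<eta> \<in> cotangent_space M q"
    "momentum M c q \<xi> = momentum M c q \<eta>"
  shows "\<xi> = \<eta>"
  using covector_momentum[OF assms(1)] assms(2-4) by metis

lemma momentum_change:
  assumes "c \<in> charts_at M q" "d \<in> charts_at M q" "\<xi> \<in> cotangent_space M q"
  shows "momentum M d q \<xi> e =
    momentum M c q \<xi> (frechet_derivative (cmap c \<circ> cinv d) (at (cmap d q)) e)"
  by (simp add: momentum_apply[OF assms(1,3)] momentum_apply[OF assms(2,3)]
      coord_vector_change[OF atlas assms(2,1), symmetric])

lemma covec_add_cotangent:
  assumes "\<xi> \<in> cotangent_space M q" "\<eta> \<in> cotangent_space M q"
  shows "covec_add M q \<xi> \<eta> \<in> cotangent_space M q"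
  by (rule cotangent_spaceI)
    (simp_all add: covec_add_def tangent_space_add[OF atlas] tangent_space_scaleR[OF atlas]
      cotangent_space_add[OF assms(1)] cotangent_space_add[OF assms(2)]
      cotangent_space_scaleR[OF assms(1)] cotangent_space_scaleR[OF assms(2)] distrib_left)

lemma covec_scale_cotangent:
  assumes "\<xi> \<in> cotangent_space M q"
  shows "covec_scale M q r \<xi> \<in> cotangent_space M q"
  by (rule cotangent_spaceI)
    (simp_all add: covec_scale_def tangent_space_add[OF atlas] tangent_space_scaleR[OF atlas]
      cotangent_space_add[OF assms(1)] cotangent_space_scaleR[OF assms(1)] distrib_left)

lemma momentum_add:
  assumes "c \<in> charts_at M q" "\<xi> \<in> cotangent_space M q" "\<eta> \<in> cotangent_space M q"
  shows "momentum M c q (covec_add M q \<xi> \<eta>) = momentum M c q \<xi> + momentum M c q \<eta>"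
  by (rule blinfun_eqI, unfold momentum_apply[OF assms(1) covec_add_cotangent[OF assms(2,3)]])
    (simp add: momentum_apply[OF assms(1)] assms covec_add_def
      coord_vector_tangent[OF atlas assms(1)] blinfun.add_left)

lemma momentum_scale:
  assumes "c \<in> charts_at M q" "\<xi> \<in> cotangent_space M q"
  shows "momentum M c q (covec_scale M q r \<xi>) = r *\<^sub>R momentum M c q \<xi>"
  by (rule blinfun_eqI, unfold momentum_apply[OF assms(1) covec_scale_cotangent[OF assms(2)]])
    (simp add: momentum_apply[OF assms] covec_scale_def
      coord_vector_tangent[OF atlas assms(1)] blinfun.scaleR_left)

text \<open>Every momentum is attained by some covector, so a chart image is a full cylinder over
  the base image; all domains of coordinate expressions on the bundle take this shape.\<close>

lemma image_cotangent_chart: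
  assumes "c \<in> M" "U \<subseteq> cdom c"
  shows "cmap (cotangent_chart M c) ` Sigma U (cotangent_space M) = cmap c ` U \<times> UNIV"
proof
  show "cmap (cotangent_chart M c) ` Sigma U (cotangent_space M) \<subseteq> cmap c ` U \<times> UNIV"
    by (auto simp: cmap_cotangent_chart)
  show "cmap c ` U \<times> UNIV \<subseteq> cmap (cotangent_chart M c) ` Sigma U (cotangent_space M)"
  proof
    fix y assume "y \<in> cmap c ` U \<times> (UNIV :: ('e \<Rightarrow>\<^sub>L real) set)"
    then obtain q \<pi> where y: "q \<in> U" "y = (cmap c q, \<pi>)" by auto
    then have c: "c \<in> charts_at M q" using assms by (auto simp: charts_at_def)
    have "y = cmap (cotangent_chart M c) (q, covector M c q \<pi>)"
      by (simp add: cmap_cotangent_chart momentum_covector[OF c] y(2))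
    then show "y \<in> cmap (cotangent_chart M c) ` Sigma U (cotangent_space M)"
      using y(1) covector_cotangent by blast
  qed
qed

lemma inj_on_cotangent_chart:
  assumes "c \<in> M"
  shows "inj_on (cmap (cotangent_chart M c)) (cdom (cotangent_chart M c))"
proof (rule inj_onI)
  fix x y assume x: "x \<in> cdom (cotangent_chart M c)" and y: "y \<in> cdom (cotangent_chart M c)"
    and eq: "cmap (cotangent_chart M c) x = cmap (cotangent_chart M c) y"
  obtain q \<xi> where x': "x = (q, \<xi>)" "q \<in> cdom c" "\<xi> \<in> cotangent_space M q"
    using x by (auto simp: cdom_cotangent_chart)
  obtain q' \<eta> where y': "y = (q', \<eta>)" "q' \<in> cdom c" "\<eta> \<in> cotangent_space M q'"
    using y by (auto simp: cdom_cotangent_chart)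
  have "cmap c q = cmap c q'" and m: "momentum M c q \<xi> = momentum M c q' \<eta>"
    using eq by (simp_all add: x' y' cmap_cotangent_chart)
  then have "q = q'" using cinv_cmap[OF atlas assms] x'(2) y'(2) by metis
  moreover have "c \<in> charts_at M q" using assms x'(2) by (simp add: charts_at_def)
  ultimately show "x = y" using momentum_inject x' y' m by simp
qed

lemma cinv_cotangent_chart:
  assumes "c \<in> M" "x \<in> cmap c ` cdom c"
  shows "cinv (cotangent_chart M c) (x, \<pi>) = (cinv c x, covector M c (cinv c x) \<pi>)"
proof -
  let ?q = "cinv c x"
  have q: "?q \<in> cdom c" "c \<in> charts_at M ?q"
    using cinv_in_cdom[OF assms(2)] assms(1) by (simp_all add: charts_at_def)
  have "cmap (cotangent_chart M c) (?q, covector M c ?q \<pi>) = (x, \<pi>)"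
    by (simp add: cmap_cotangent_chart momentum_covector[OF q(2)] cmap_cinv[OF assms(2)])
  moreover have "(?q, covector M c ?q \<pi>) \<in> cdom (cotangent_chart M c)"
    using q covector_cotangent by (simp add: cdom_cotangent_chart)
  ultimately show ?thesis
    unfolding cinv_def using inv_into_f_f[OF inj_on_cotangent_chart[OF assms(1)]] by metis
qed

text \<open>Momenta transform by the transpose of the derivative of the inverse transition map. As
  that inverse is itself a transition map, no inversion of linear maps occurs: the new momentum,
  evaluated at \<open>e\<close>, is a bilinear expression in smooth functions of
  \<open>(x, p)\<close>.\<close>

lemma momentum_transition_smooth:
  assumes c: "c \<in> M" and d: "d \<in> M"
  shows "C_infinity_on (\<lambda>y. momentum M d (cinv c (fst y)) (covector M c (cinv c (fst y)) (snd y)))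
    (overlap c d \<times> UNIV)"
proof (rule C_infinity_on_blinfun[OF fin])
  let ?\<tau> = "cmap d \<circ> cinv c" and ?\<sigma> = "cmap c \<circ> cinv d"
  show op: "open (overlap c d \<times> (UNIV :: ('e \<Rightarrow>\<^sub>L real) set))"
    using open_overlap[OF c d] by (simp add: open_Times)
  fix e
  have "C_infinity_on (\<lambda>x. frechet_derivative ?\<sigma> (at (?\<tau> x)) e) (overlap c d)"
  proof (rule C_infinity_on_compose[OF fin transition_smooth[OF atlas c d]])
    show "C_infinity_on (\<lambda>x. frechet_derivative ?\<sigma> (at x) e) (overlap d c)"
      by (rule C_infinity_on_derivative[OF transition_smooth[OF atlas d c]])
    show "?\<tau> ` overlap c d \<subseteq> overlap d c" using overlapD[OF c d] by auto
  qed
  from C_infinity_on_compose_affine[OF bounded_linear_fst this, of 0]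
  have 1: "C_infinity_on (\<lambda>y. frechet_derivative ?\<sigma> (at (?\<tau> (fst y))) e)
      (overlap c d \<times> (UNIV :: ('e \<Rightarrow>\<^sub>L real) set))"
    by (simp add: vimage_fst)
  have 2: "C_infinity_on snd (overlap c d \<times> (UNIV :: ('e \<Rightarrow>\<^sub>L real) set))"
    using C_infinity_on_linear[OF bounded_linear_snd C_infinity_on_ident[OF op]] .
  have "C_infinity_on (\<lambda>y. blinfun_apply (snd y) (frechet_derivative ?\<sigma> (at (?\<tau> (fst y))) e))
      (overlap c d \<times> (UNIV :: ('e \<Rightarrow>\<^sub>L real) set))"
    by (rule C_infinity_on_bilinear[OF bounded_bilinear_blinfun_apply 2 1])
  then show "C_infinity_on (\<lambda>y. momentum M d (cinv c (fst y)) (covector M c (cinv c (fst y)) (snd y)) e)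
      (overlap c d \<times> (UNIV :: ('e \<Rightarrow>\<^sub>L real) set))"
  proof (rule iffD2[OF C_infinity_on_cong, rotated])
    fix y :: "'e \<times> ('e \<Rightarrow>\<^sub>L real)" assume "y \<in> overlap c d \<times> UNIV"
    then have "fst y \<in> overlap c d" by auto
    note o = overlapD[OF c d this]
    show "momentum M d (cinv c (fst y)) (covector M c (cinv c (fst y)) (snd y)) e =
      snd y (frechet_derivative ?\<sigma> (at (?\<tau> (fst y))) e)"
      using momentum_change[OF o(3,4) covector_cotangent] momentum_covector[OF o(3)] by simp
  qed
qed

text \<open>Used with the identity for the base coordinate of a bundle map, and with a
  \<open>local_rep\<close> for the term added by a fibre translation.\<close>

lemma base_transition_smooth:
  assumes c: "c \<in> M" and d: "d \<in> M" and g: "C_infinity_on g (cmap d ` cdom d)"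
  shows "C_infinity_on (\<lambda>y. g (cmap d (cinv c (fst y)))) (overlap c d \<times> (UNIV :: ('e \<Rightarrow>\<^sub>L real) set))"
proof -
  have "C_infinity_on (\<lambda>x. g ((cmap d \<circ> cinv c) x)) (overlap c d)"
    by (rule C_infinity_on_compose[OF fin transition_smooth[OF atlas c d] g])
      (use overlapD[OF c d] in auto)
  from C_infinity_on_compose_affine[OF bounded_linear_fst this, of 0]
  show ?thesis by (simp add: vimage_fst)
qed

lemma cotangent_chart_overlap:
  "cdom (cotangent_chart M c) \<inter> cdom (cotangent_chart M d) = Sigma (cdom c \<inter> cdom d) (cotangent_space M)"
  by (auto simp: cdom_cotangent_chart)

lemma cotangent_transition:
  assumes c: "c \<in> M" and d: "d \<in> M"
    and y: "y \<in> overlap c d \<times> UNIV"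
  shows "cmap (cotangent_chart M d) (cinv (cotangent_chart M c) y) =
    (cmap d (cinv c (fst y)), momentum M d (cinv c (fst y)) (covector M c (cinv c (fst y)) (snd y)))"
proof -
  have "fst y \<in> cmap c ` cdom c" using y by auto
  then show ?thesis using cinv_cotangent_chart[OF c, of "fst y" "snd y"]
    by (simp add: cmap_cotangent_chart)
qed

lemma smooth_atlas_cotangent_bundle: "smooth_atlas TM"
proof -
  have "C_infinity_on (cmap (cotangent_chart M d) \<circ> cinv (cotangent_chart M c))
    (cmap (cotangent_chart M c) ` (cdom (cotangent_chart M c) \<inter> cdom (cotangent_chart M d)))"
    if c: "c \<in> M" and d: "d \<in> M" for c d
    unfolding cotangent_chart_overlap image_cotangent_chart[OF c Int_lower1]
  proof (rule iffD2[OF C_infinity_on_cong])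
    show "C_infinity_on (\<lambda>y. (cmap d (cinv c (fst y)),
        momentum M d (cinv c (fst y)) (covector M c (cinv c (fst y)) (snd y)))) (overlap c d \<times> UNIV)"
      using base_transition_smooth[OF c d C_infinity_on_ident[OF open_chart_image[OF atlas d]]]
      by (intro C_infinity_on_Pair momentum_transition_smooth[OF c d])
  qed (simp add: cotangent_transition[OF c d])
  moreover have "open (cmap (cotangent_chart M c) ` cdom (cotangent_chart M c))" if c: "c \<in> M" for c
    unfolding cdom_cotangent_chart image_cotangent_chart[OF c order_refl]
    using open_chart_image[OF atlas c] by (simp add: open_Times)
  ultimately show ?thesis
    unfolding smooth_atlas_def cotangent_bundle_def using inj_on_cotangent_chart by blast
qed

lemma smooth_map_projection: "smooth_map TM M fst"
  unfolding smooth_map_def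
proof (intro conjI ballI)
  show "fst \<in> points TM \<rightarrow> points M" by (auto simp: points_cotangent_bundle)
  fix C d assume C: "C \<in> TM" and d: "d \<in> M"
  obtain c where c: "c \<in> M" "C = cotangent_chart M c" using C by (auto simp: cotangent_bundle_def)
  have dom: "cdom C \<inter> fst -` cdom d = Sigma (cdom c \<inter> cdom d) (cotangent_space M)"
    by (auto simp: c cdom_cotangent_chart)
  show "C_infinity_on (cmap d \<circ> fst \<circ> cinv C) (cmap C ` (cdom C \<inter> fst -` cdom d))"
    unfolding dom unfolding c(2) image_cotangent_chart[OF c(1) Int_lower1]
  proof (rule iffD2[OF C_infinity_on_cong])
    show "C_infinity_on (\<lambda>y. cmap d (cinv c (fst y))) (overlap c d \<times> (UNIV :: ('e \<Rightarrow>\<^sub>L real) set))"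
      using base_transition_smooth[OF c(1) d C_infinity_on_ident[OF open_chart_image[OF atlas d]]] .
    show "(cmap d \<circ> fst \<circ> cinv (cotangent_chart M c)) y = cmap d (cinv c (fst y))"
      if "y \<in> overlap c d \<times> UNIV" for y
      using cinv_cotangent_chart[OF c(1), of "fst y" "snd y"] that by auto
  qed
qed

section \<open>The canonical form in canonical coordinates\<close>

lemma cotangent_chart_charts_at:
  assumes "c \<in> charts_at M q" "\<xi> \<in> cotangent_space M q"
  shows "cotangent_chart M c \<in> charts_at TM (q, \<xi>)"
  unfolding charts_at_cotangent_bundle[OF assms(2)] using assms(1) by (rule imageI)

lemma projection_derivative:
  assumes "c \<in> charts_at M q" "\<xi> \<in> cotangent_space M q"
  shows "frechet_derivative (cmap c \<circ> fst \<circ> cinv (cotangent_chart M c))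
    (at (cmap (cotangent_chart M c) (q, \<xi>))) = fst"
proof -
  let ?C = "cotangent_chart M c"
  note c = charts_atD[OF assms(1)]
  have "(cmap c \<circ> fst \<circ> cinv ?C has_derivative fst) (at (cmap ?C (q, \<xi>)))"
  proof (rule has_derivative_transform_within_open[OF bounded_linear_imp_has_derivative[OF bounded_linear_fst]])
    show "open (cmap c ` cdom c \<times> (UNIV :: ('e \<Rightarrow>\<^sub>L real) set))"
      using open_chart_image[OF atlas c(1)] by (simp add: open_Times)
    show "cmap ?C (q, \<xi>) \<in> cmap c ` cdom c \<times> UNIV" using c(2) by (simp add: cmap_cotangent_chart)
    show "fst y = (cmap c \<circ> fst \<circ> cinv ?C) y" if "y \<in> cmap c ` cdom c \<times> UNIV" for y
      using cinv_cotangent_chart[OF c(1), of "fst y" "snd y"] that cmap_cinv[of "fst y" c] by auto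
  qed
  then show ?thesis using frechet_derivative_at by metis
qed

text \<open>This is \<open>p dx\<close>: the projection is \<open>fst\<close> in canonical
  coordinates, so only the base part of the vector is paired with the momentum.\<close>

lemma liouville_form_coord_vector:
  assumes "c \<in> charts_at M q" "\<xi> \<in> cotangent_space M q"
  shows "liouville_form M (q, \<xi>) (coord_vector TM (cotangent_chart M c) (q, \<xi>) e) =
    momentum M c q \<xi> (fst e)"
proof -
  let ?C = "cotangent_chart M c"
  let ?w = "coord_vector TM ?C (q, \<xi>) e"
  note C = cotangent_chart_charts_at[OF assms]
  have w: "?w \<in> tangent_space TM (q, \<xi>)" by (rule coord_vector_tangent[OF smooth_atlas_cotangent_bundle C])
  have "(q, \<xi>) \<in> points TM" using C by (rule charts_at_points)
  then have "liouville_form M (q, \<xi>) ?w = \<xi> (tangent_map TM M fst (q, \<xi>) ?w)"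
    using w by (simp add: liouville_form_def)
  also have "tangent_map TM M fst (q, \<xi>) ?w = coord_vector M c q (fst e)"
    using tangent_map_coord_vector[OF smooth_atlas_cotangent_bundle atlas smooth_map_projection C _ w, of c] assms(1)
    by (simp add: projection_derivative[OF assms] coord_vector_self[OF smooth_atlas_cotangent_bundle C])
  finally show ?thesis by (simp add: momentum_apply[OF assms])
qed

text \<open>The bundle chart is selected on the bundle itself; its base chart need not be
  \<open>chart_at M (fst x)\<close>.\<close>

lemma chart_at_cotangent_bundle:
  assumes "x \<in> points TM"
  obtains c where "c \<in> charts_at M (fst x)" "chart_at TM x = cotangent_chart M c"
proof -
  have "chart_at TM x \<in> charts_at TM (fst x, snd x)" using chart_at_charts_at[OF assms] by simp
  then have "chart_at TM x \<in> cotangent_chart M ` charts_at M (fst x)"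
    using assms by (subst (asm) charts_at_cotangent_bundle) (auto simp: points_cotangent_bundle)
  then show ?thesis using that by blast
qed

text \<open>The charts around a point of the bundle depend only on its base point, and the choice
  operator picks the same element from equal sets. A map over the identity can therefore be studied
  in one chart for both source and target.\<close>

lemma chart_at_fibre:
  assumes "x \<in> points TM" "y \<in> points TM" "fst x = fst y"
  shows "chart_at TM x = chart_at TM y"
proof -
  have "charts_at TM (fst x, snd x) = charts_at TM (fst y, snd y)"
    using assms by (subst (1 2) charts_at_cotangent_bundle) (auto simp: points_cotangent_bundle)
  then show ?thesis by (simp add: chart_at_def)
qed

text \<open>The coefficient of \<open>p dx\<close> on a coordinate field is linear in
  \<open>(x, p)\<close>, hence equal to its own derivative; antisymmetrising and negating gives the
  standard form \<open>dx \<and> dp\<close>.\<close>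

lemma canonical_form_coordinates:
  assumes "x \<in> points TM"
  shows "canonical_form M x u v =
    snd (v (chart_at TM x)) (fst (u (chart_at TM x))) - snd (u (chart_at TM x)) (fst (v (chart_at TM x)))"
proof -
  let ?C = "chart_at TM x"
  obtain c where c: "c \<in> charts_at M (fst x)" "?C = cotangent_chart M c"
    using chart_at_cotangent_bundle[OF assms] .
  note c' = charts_atD[OF c(1)]
  have "frechet_derivative (\<lambda>y. liouville_form M (cinv ?C y) (coord_vector TM ?C (cinv ?C y) e))
      (at (cmap ?C x)) w = snd w (fst e)" for e w
  proof -
    have "((\<lambda>y. liouville_form M (cinv ?C y) (coord_vector TM ?C (cinv ?C y) e)) has_derivative
        (\<lambda>w. blinfun_apply (snd w) (fst e))) (at (cmap ?C x))"
    proof (rule has_derivative_transform_within_open)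
      have "bounded_linear (\<lambda>w :: 'e \<times> ('e \<Rightarrow>\<^sub>L real). blinfun_apply (snd w) (fst e))"
        by (rule bounded_linear_compose[OF blinfun.bounded_linear_left bounded_linear_snd])
      then show "((\<lambda>w. blinfun_apply (snd w) (fst e)) has_derivative (\<lambda>w. blinfun_apply (snd w) (fst e)))
          (at (cmap ?C x))"
        by (rule bounded_linear_imp_has_derivative)
      show "open (cmap c ` cdom c \<times> (UNIV :: ('e \<Rightarrow>\<^sub>L real) set))"
        using open_chart_image[OF atlas c'(1)] by (simp add: open_Times)
      show "cmap ?C x \<in> cmap c ` cdom c \<times> UNIV"
        using c'(2) cmap_cotangent_chart[of M c "fst x" "snd x"] by (simp add: c(2))
      fix y :: "'e \<times> ('e \<Rightarrow>\<^sub>L real)" assume "y \<in> cmap c ` cdom c \<times> UNIV"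
      then have y: "fst y \<in> cmap c ` cdom c" by auto
      then have q: "c \<in> charts_at M (cinv c (fst y))"
        using cinv_in_cdom[OF y] c'(1) by (simp add: charts_at_def)
      show "snd y (fst e) = liouville_form M (cinv ?C y) (coord_vector TM ?C (cinv ?C y) e)"
        using cinv_cotangent_chart[OF c'(1) y, of "snd y"]
          liouville_form_coord_vector[OF q covector_cotangent, of c "snd y" e]
        by (simp only: c(2) momentum_covector[OF q] prod.collapse)
    qed
    from fun_cong[OF frechet_derivative_at[OF this], of w] show ?thesis by (rule sym)
  qed
  then show ?thesis unfolding canonical_form_def ext_deriv_def Let_def by simp
qed

end

text \<open>Smoothness depends on the values on the manifold alone; translations and inverses are
  identified with other maps only there.\<close>

lemma smooth_map_cong:
  assumes "\<And>x. x \<in> points M \<Longrightarrow> f x = g x" "smooth_map M N f"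
  shows "smooth_map M N g"
  unfolding smooth_map_def
proof (intro conjI ballI)
  show "g \<in> points M \<rightarrow> points N"
  proof
    fix x assume x: "x \<in> points M"
    then have "f x \<in> points N" using assms(2) unfolding smooth_map_def by blast
    then show "g x \<in> points N" using assms(1)[OF x] by simp
  qed
  fix c d assume c: "c \<in> M" and d: "d \<in> N"
  have fg: "f x = g x" if "x \<in> cdom c" for x using that c assms(1) unfolding points_def by blast
  then have dom: "cdom c \<inter> f -` cdom d = cdom c \<inter> g -` cdom d" by auto
  show "C_infinity_on (cmap d \<circ> g \<circ> cinv c) (cmap c ` (cdom c \<inter> g -` cdom d))"
    using smooth_map_local[OF assms(2) c d] unfolding dom
  proof (rule iffD1[OF C_infinity_on_cong, rotated])
    fix x assume "x \<in> cmap c ` (cdom c \<inter> g -` cdom d)"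
    then have "cinv c x \<in> cdom c" by (auto intro!: cinv_in_cdom)
    then show "(cmap d \<circ> f \<circ> cinv c) x = (cmap d \<circ> g \<circ> cinv c) x" by (simp add: fg)
  qed
qed

context finite_dim_atlas
begin

section \<open>One-forms in coordinates\<close>

text \<open>Symmetry of the Jacobian of the components in one chart. The chart is a parameter
  because \<open>ext_deriv\<close> and the computation on the bundle may refer to different
  charts.\<close>

definition closed_at :: "('a, 'e) form1 \<Rightarrow> ('a, 'e) chart \<Rightarrow> 'a \<Rightarrow> bool" where
  "closed_at \<alpha> c q \<longleftrightarrow> (\<forall>u v.
     blinfun_apply (frechet_derivative (local_rep M c \<alpha>) (at (cmap c q)) u) v =
     blinfun_apply (frechet_derivative (local_rep M c \<alpha>) (at (cmap c q)) v) u)"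

lemma points_charts_at: "q \<in> points M \<longleftrightarrow> (\<exists>c. c \<in> charts_at M q)"
  unfolding points_def charts_at_def by blast

lemma chart_imageD:
  assumes "c \<in> M" "x \<in> cmap c ` cdom c"
  shows "c \<in> charts_at M (cinv c x)" "cinv c x \<in> points M"
  using assms cinv_in_cdom[OF assms(2)] by (auto simp: charts_at_def points_def)

lemma chart_image_charts_at: "c \<in> charts_at M q \<Longrightarrow> cmap c q \<in> cmap c ` cdom c"
  by (simp add: charts_at_def)

lemma cinv_cmap_charts_at: "c \<in> charts_at M q \<Longrightarrow> cinv c (cmap c q) = q"
  using cinv_cmap[OF atlas] by (simp add: charts_at_def)

text \<open>In a bundle chart over \<open>d\<close> the section has the components
  \<open>cmap d\<close> and the local representative in \<open>d\<close>. Equal source and target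
  charts give one direction; the other composes with transition maps.\<close>

lemma smooth_form1_iff:
  "\<alpha> \<in> smooth_form1 M \<longleftrightarrow> \<alpha> \<in> (\<Pi>\<^sub>E p\<in>points M. cotangent_space M p) \<and>
    (\<forall>c\<in>M. C_infinity_on (local_rep M c \<alpha>) (cmap c ` cdom c))"
proof (cases "\<alpha> \<in> (\<Pi>\<^sub>E p\<in>points M. cotangent_space M p)")
  case True
  then have \<alpha>: "\<alpha> p \<in> cotangent_space M p" if "p \<in> points M" for p using that by blast
  have dom: "cdom c \<inter> (\<lambda>p. (p, \<alpha> p)) -` cdom (cotangent_chart M d) = cdom c \<inter> cdom d"
    if "d \<in> M" for c d
    using that \<alpha> by (auto simp: cdom_cotangent_chart points_def)
  have eq: "(cmap (cotangent_chart M d) \<circ> (\<lambda>p. (p, \<alpha> p)) \<circ> cinv c) x =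
      (cmap d (cinv c x), local_rep M d \<alpha> (cmap d (cinv c x)))"
    if "c \<in> M" "d \<in> M" "x \<in> overlap c d" for c d x
    using cinv_cmap_charts_at[OF overlapD(4)[OF that]] by (simp add: cmap_cotangent_chart local_rep_def)
  have "smooth_map M TM (\<lambda>p. (p, \<alpha> p)) \<longleftrightarrow> (\<forall>c\<in>M. \<forall>d\<in>M.
      C_infinity_on (cmap (cotangent_chart M d) \<circ> (\<lambda>p. (p, \<alpha> p)) \<circ> cinv c) (overlap c d))"
    unfolding smooth_map_def using \<alpha> by (auto simp: cotangent_bundle_def dom points_cotangent_bundle[unfolded cotangent_bundle_def])
  also have "\<dots> \<longleftrightarrow> (\<forall>c\<in>M. \<forall>d\<in>M.
      C_infinity_on (\<lambda>x. (cmap d (cinv c x), local_rep M d \<alpha> (cmap d (cinv c x)))) (overlap c d))"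
    by (intro ball_cong refl C_infinity_on_cong eq)
  also have "\<dots> \<longleftrightarrow> (\<forall>c\<in>M. C_infinity_on (local_rep M c \<alpha>) (cmap c ` cdom c))"
  proof (intro iffI ballI)
    fix c assume c: "c \<in> M" and all: "\<forall>c\<in>M. \<forall>d\<in>M.
      C_infinity_on (\<lambda>x. (cmap d (cinv c x), local_rep M d \<alpha> (cmap d (cinv c x)))) (overlap c d)"
    have "C_infinity_on (\<lambda>x. (cmap c (cinv c x), local_rep M c \<alpha> (cmap c (cinv c x)))) (cmap c ` cdom c)"
      using all c by fastforce
    from C_infinity_on_linear[OF bounded_linear_snd this]
    show "C_infinity_on (local_rep M c \<alpha>) (cmap c ` cdom c)"
      by (rule iffD1[OF C_infinity_on_cong, rotated]) (simp add: cmap_cinv)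
  next
    fix c d assume c: "c \<in> M" and d: "d \<in> M"
      and "\<forall>c\<in>M. C_infinity_on (local_rep M c \<alpha>) (cmap c ` cdom c)"
    then have "C_infinity_on (local_rep M d \<alpha>) (cmap d ` cdom d)" by blast
    from C_infinity_on_compose[OF fin transition_smooth[OF atlas c d] this]
    have "C_infinity_on (\<lambda>x. local_rep M d \<alpha> (cmap d (cinv c x))) (overlap c d)"
      using overlapD[OF c d] by (simp add: image_subset_iff)
    moreover have "C_infinity_on (\<lambda>x. cmap d (cinv c x)) (overlap c d)"
      using transition_smooth[OF atlas c d] by (simp add: comp_def)
    ultimately show "C_infinity_on (\<lambda>x. (cmap d (cinv c x), local_rep M d \<alpha> (cmap d (cinv c x)))) (overlap c d)"
      by (intro C_infinity_on_Pair)
  qed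
  finally show ?thesis using True by (simp add: smooth_form1_def)
qed (simp add: smooth_form1_def)

lemma smooth_form1_cotangent: "\<alpha> \<in> smooth_form1 M \<Longrightarrow> q \<in> points M \<Longrightarrow> \<alpha> q \<in> cotangent_space M q"
  by (auto simp: smooth_form1_def)

lemma local_rep_smooth: "\<alpha> \<in> smooth_form1 M \<Longrightarrow> c \<in> M \<Longrightarrow> C_infinity_on (local_rep M c \<alpha>) (cmap c ` cdom c)"
  by (simp add: smooth_form1_iff)

lemma local_rep_apply:
  assumes "\<alpha> \<in> smooth_form1 M" "c \<in> M" "x \<in> cmap c ` cdom c"
  shows "local_rep M c \<alpha> x e = \<alpha> (cinv c x) (coord_vector M c (cinv c x) e)"
  unfolding local_rep_def
  using assms by (intro momentum_apply chart_imageD smooth_form1_cotangent)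

lemma local_rep_derivative:
  assumes "\<alpha> \<in> smooth_form1 M" "c \<in> charts_at M q"
  shows "(local_rep M c \<alpha> has_derivative frechet_derivative (local_rep M c \<alpha>) (at (cmap c q))) (at (cmap c q))"
  using C_infinity_on_has_derivative[OF local_rep_smooth[OF assms(1) charts_atD(1)[OF assms(2)]]
      chart_image_charts_at[OF assms(2)]] .

lemma ext_deriv_coordinates:
  assumes "\<alpha> \<in> smooth_form1 M" "q \<in> points M"
  shows "ext_deriv M \<alpha> q u v =
    blinfun_apply (frechet_derivative (local_rep M (chart_at M q) \<alpha>) (at (cmap (chart_at M q) q)) (u (chart_at M q))) (v (chart_at M q)) -
    blinfun_apply (frechet_derivative (local_rep M (chart_at M q) \<alpha>) (at (cmap (chart_at M q) q)) (v (chart_at M q))) (u (chart_at M q))"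
proof -
  let ?c = "chart_at M q"
  note c = chart_at_charts_at[OF assms(2)]
  have "frechet_derivative (\<lambda>x. \<alpha> (cinv ?c x) (coord_vector M ?c (cinv ?c x) e)) (at (cmap ?c q)) w =
      blinfun_apply (frechet_derivative (local_rep M ?c \<alpha>) (at (cmap ?c q)) w) e" for e w
  proof -
    have "((\<lambda>x. blinfun_apply (local_rep M ?c \<alpha> x) e) has_derivative
        (\<lambda>w. blinfun_apply (frechet_derivative (local_rep M ?c \<alpha>) (at (cmap ?c q)) w) e)) (at (cmap ?c q))"
      by (rule bounded_linear.has_derivative[OF blinfun.bounded_linear_left local_rep_derivative[OF assms(1) c]])
    then have "((\<lambda>x. \<alpha> (cinv ?c x) (coord_vector M ?c (cinv ?c x) e)) has_derivative
        (\<lambda>w. blinfun_apply (frechet_derivative (local_rep M ?c \<alpha>) (at (cmap ?c q)) w) e)) (at (cmap ?c q))"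
      by (rule has_derivative_transform_within_open[OF _ open_chart_image[OF atlas charts_atD(1)[OF c]] chart_image_charts_at[OF c]])
        (rule local_rep_apply[OF assms(1) charts_atD(1)[OF c]])
    from fun_cong[OF frechet_derivative_at[OF this], of w] show ?thesis by (rule sym)
  qed
  then show ?thesis unfolding ext_deriv_def Let_def by simp
qed

lemma local_rep_change:
  assumes "\<alpha> \<in> smooth_form1 M" "c \<in> M" "d \<in> M" "y \<in> overlap d c"
  shows "local_rep M d \<alpha> y e =
    local_rep M c \<alpha> (cmap c (cinv d y)) (frechet_derivative (cmap c \<circ> cinv d) (at y) e)"
proof -
  let ?q = "cinv d y"
  note o = overlapD[OF assms(3,2,4)]
  have "\<alpha> ?q \<in> cotangent_space M ?q"
    using smooth_form1_cotangent[OF assms(1)] o(3) points_charts_at by blast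
  from momentum_change[OF o(4,3) this, of e] show ?thesis
    by (simp add: local_rep_def cinv_cmap_charts_at[OF o(4)] o(5))
qed

text \<open>
  The additional term in the derivative of the transformed representative involves the second
  derivative of the transition map, whose symmetry makes closedness independent of the chart.
\<close>

lemma closed_at_change:
  assumes \<alpha>: "\<alpha> \<in> smooth_form1 M" and c: "c \<in> charts_at M q" and d: "d \<in> charts_at M q"
    and closed: "closed_at \<alpha> c q"
  shows "closed_at \<alpha> d q"
proof -
  let ?\<sigma> = "cmap c \<circ> cinv d" and ?y = "cmap d q"
  let ?D\<sigma> = "\<lambda>y. frechet_derivative ?\<sigma> (at y)"
  let ?A = "frechet_derivative (local_rep M c \<alpha>) (at (cmap c q))"
  note cM = charts_atD[OF c] and dM = charts_atD[OF d]
  have y: "?y \<in> overlap d c" using cM dM by blast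
  have op: "open (overlap d c)" using open_overlap[OF dM(1) cM(1)] .
  note \<sigma> = transition_smooth[OF atlas dM(1) cM(1)]
  have \<sigma>y: "?\<sigma> ?y = cmap c q" by (simp add: cinv_cmap_charts_at[OF d])
  have "blinfun_apply (frechet_derivative (local_rep M d \<alpha>) (at ?y) u) v =
      local_rep M c \<alpha> (cmap c q) (frechet_derivative (\<lambda>y. ?D\<sigma> y v) (at ?y) u) +
      blinfun_apply (?A (?D\<sigma> ?y u)) (?D\<sigma> ?y v)" for u v
  proof -
    have 1: "((\<lambda>y. local_rep M c \<alpha> (?\<sigma> y)) has_derivative (\<lambda>u. ?A (?D\<sigma> ?y u))) (at ?y)"
      using has_derivative_compose[OF C_infinity_on_has_derivative[OF \<sigma> y], of "local_rep M c \<alpha>" ?A]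
        local_rep_derivative[OF \<alpha> c] unfolding \<sigma>y by blast
    have 2: "((\<lambda>y. ?D\<sigma> y v) has_derivative frechet_derivative (\<lambda>y. ?D\<sigma> y v) (at ?y)) (at ?y)"
      by (rule C_infinity_on_has_derivative[OF C_infinity_on_derivative[OF \<sigma>] y])
    have "((\<lambda>y. blinfun_apply (local_rep M c \<alpha> (?\<sigma> y)) (?D\<sigma> y v)) has_derivative
      (\<lambda>u. local_rep M c \<alpha> (?\<sigma> ?y) (frechet_derivative (\<lambda>y. ?D\<sigma> y v) (at ?y) u) +
        blinfun_apply (?A (?D\<sigma> ?y u)) (?D\<sigma> ?y v))) (at ?y)"
      by (rule bounded_bilinear.FDERIV[OF bounded_bilinear_blinfun_apply 1 2])
    then have "((\<lambda>y. blinfun_apply (local_rep M d \<alpha> y) v) has_derivative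
      (\<lambda>u. local_rep M c \<alpha> (?\<sigma> ?y) (frechet_derivative (\<lambda>y. ?D\<sigma> y v) (at ?y) u) +
        blinfun_apply (?A (?D\<sigma> ?y u)) (?D\<sigma> ?y v))) (at ?y)"
      by (rule has_derivative_transform_within_open[OF _ op y])
        (simp add: local_rep_change[OF \<alpha> cM(1) dM(1)])
    from frechet_derivative_at[OF this] frechet_derivative_at[OF
        bounded_linear.has_derivative[OF blinfun.bounded_linear_left local_rep_derivative[OF \<alpha> d]], of v]
    have "(\<lambda>u. blinfun_apply (frechet_derivative (local_rep M d \<alpha>) (at ?y) u) v) =
      (\<lambda>u. local_rep M c \<alpha> (?\<sigma> ?y) (frechet_derivative (\<lambda>y. ?D\<sigma> y v) (at ?y) u) +
        blinfun_apply (?A (?D\<sigma> ?y u)) (?D\<sigma> ?y v))"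
      by (rule trans[OF _ sym, rotated])
    from fun_cong[OF this, of u] show ?thesis unfolding \<sigma>y .
  qed
  moreover have "frechet_derivative (\<lambda>y. ?D\<sigma> y v) (at ?y) u = frechet_derivative (\<lambda>y. ?D\<sigma> y u) (at ?y) v" for u v
    by (rule second_derivative_symmetric[OF fin \<sigma> y])
  moreover have "blinfun_apply (?A (?D\<sigma> ?y u)) (?D\<sigma> ?y v) = blinfun_apply (?A (?D\<sigma> ?y v)) (?D\<sigma> ?y u)" for u v
    using closed unfolding closed_at_def by blast
  ultimately show ?thesis unfolding closed_at_def by metis
qed

text \<open>Symmetry in a single chart per point is enough because \<open>closed_at_change\<close>
  carries it to the chart used by \<open>ext_deriv\<close>.\<close>

lemma closed_forms_iff:
  "\<alpha> \<in> closed_forms M \<longleftrightarrow> \<alpha> \<in> smooth_form1 M \<and> (\<forall>q\<in>points M. \<exists>c\<in>charts_at M q. closed_at \<alpha> c q)"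
proof (cases "\<alpha> \<in> smooth_form1 M")
  case \<alpha>: True
  have "(\<forall>u\<in>tangent_space M q. \<forall>v\<in>tangent_space M q. ext_deriv M \<alpha> q u v = 0) \<longleftrightarrow>
      (\<exists>c\<in>charts_at M q. closed_at \<alpha> c q)" (is "?L \<longleftrightarrow> ?R") if q: "q \<in> points M" for q
  proof -
    let ?c = "chart_at M q"
    note c = chart_at_charts_at[OF q]
    have "?L \<longleftrightarrow> closed_at \<alpha> ?c q"
    proof
      assume L: ?L
      show "closed_at \<alpha> ?c q"
        unfolding closed_at_def
      proof (intro allI)
        fix u v
        show "blinfun_apply (frechet_derivative (local_rep M ?c \<alpha>) (at (cmap ?c q)) u) v =
          blinfun_apply (frechet_derivative (local_rep M ?c \<alpha>) (at (cmap ?c q)) v) u"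
          using L[rule_format, OF coord_vector_tangent[OF atlas c, of u] coord_vector_tangent[OF atlas c, of v]]
          unfolding ext_deriv_coordinates[OF \<alpha> q] coord_vector_self[OF atlas c] by simp
      qed
    qed (simp add: ext_deriv_coordinates[OF \<alpha> q] closed_at_def)
    also have "\<dots> \<longleftrightarrow> ?R" using closed_at_change[OF \<alpha> _ c] c by blast
    finally show ?thesis .
  qed
  then show ?thesis using \<alpha> by (simp add: closed_forms_def)
qed (simp add: closed_forms_def)

lemma closed_forms_closed_at:
  assumes "\<alpha> \<in> closed_forms M" "c \<in> charts_at M q"
  shows "closed_at \<alpha> c q"
  using assms closed_at_change charts_at_points unfolding closed_forms_iff by meson

section \<open>Fibre translations\<close>

lemma fibre_translation_point:
  assumes "\<alpha> \<in> smooth_form1 M" "x \<in> points TM"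
  shows "fibre_translation M \<alpha> x \<in> points TM"
  using assms covec_add_cotangent smooth_form1_cotangent[OF assms(1)]
  by (auto simp: points_cotangent_bundle fibre_translation_apply)

lemma fibre_translation_coordinates:
  assumes "\<alpha> \<in> smooth_form1 M" "c \<in> M" "d \<in> M" "y \<in> overlap c d \<times> UNIV"
  shows "cmap (cotangent_chart M d) (fibre_translation M \<alpha> (cinv (cotangent_chart M c) y)) =
    (cmap d (cinv c (fst y)), momentum M d (cinv c (fst y)) (covector M c (cinv c (fst y)) (snd y)) +
      local_rep M d \<alpha> (cmap d (cinv c (fst y))))"
proof -
  have x: "fst y \<in> overlap c d" using assms(4) by auto
  then have x': "fst y \<in> cmap c ` cdom c" by blast
  note o = overlapD[OF assms(2,3) x]
  have \<alpha>: "\<alpha> (cinv c (fst y)) \<in> cotangent_space M (cinv c (fst y))"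
    using smooth_form1_cotangent[OF assms(1)] o(3) points_charts_at by blast
  have "cinv (cotangent_chart M c) y = (cinv c (fst y), covector M c (cinv c (fst y)) (snd y))"
    using cinv_cotangent_chart[OF assms(2) x', of "snd y"] by (simp only: prod.collapse)
  then show ?thesis
    using momentum_add[OF o(4) covector_cotangent \<alpha>]
    by (simp only: fibre_translation_apply cmap_cotangent_chart local_rep_def cinv_cmap_charts_at[OF o(4)])
qed

lemma smooth_map_fibre_translation:
  assumes "\<alpha> \<in> smooth_form1 M"
  shows "smooth_map TM TM (fibre_translation M \<alpha>)"
  unfolding smooth_map_def
proof (intro conjI ballI)
  show "fibre_translation M \<alpha> \<in> points TM \<rightarrow> points TM"
    using fibre_translation_point[OF assms] by blast
  fix C D assume "C \<in> TM" "D \<in> TM"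
  then obtain c d where c: "c \<in> M" "C = cotangent_chart M c" and d: "d \<in> M" "D = cotangent_chart M d"
    by (auto simp: cotangent_bundle_def)
  have "covec_add M q \<xi> (\<alpha> q) \<in> cotangent_space M q" if "q \<in> cdom c" "\<xi> \<in> cotangent_space M q" for q \<xi>
    using that c(1) by (intro covec_add_cotangent smooth_form1_cotangent[OF assms]) (auto simp: points_def)
  then have dom: "cdom C \<inter> fibre_translation M \<alpha> -` cdom D = Sigma (cdom c \<inter> cdom d) (cotangent_space M)"
    by (auto simp: c(2) d(2) cdom_cotangent_chart fibre_translation_apply)
  show "C_infinity_on (cmap D \<circ> fibre_translation M \<alpha> \<circ> cinv C)
    (cmap C ` (cdom C \<inter> fibre_translation M \<alpha> -` cdom D))"
    unfolding dom unfolding c(2) image_cotangent_chart[OF c(1) Int_lower1]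
  proof (rule iffD2[OF C_infinity_on_cong])
    show "C_infinity_on (\<lambda>y. (cmap d (cinv c (fst y)),
        momentum M d (cinv c (fst y)) (covector M c (cinv c (fst y)) (snd y)) +
        local_rep M d \<alpha> (cmap d (cinv c (fst y))))) (overlap c d \<times> UNIV)"
      using base_transition_smooth[OF c(1) d(1) C_infinity_on_ident[OF open_chart_image[OF atlas d(1)]]]
        base_transition_smooth[OF c(1) d(1) local_rep_smooth[OF assms d(1)]]
      by (intro C_infinity_on_Pair C_infinity_on_add momentum_transition_smooth[OF c(1) d(1)])
  qed (simp add: d(2) fibre_translation_coordinates[OF assms c(1) d(1)])
qed

text \<open>The Jacobian in canonical coordinates, with one chart for source and target: it is
  applied to maps over the identity.\<close>

definition canonical_derivative ::
  "('a \<times> ('a, 'e) covec \<Rightarrow> 'a \<times> ('a, 'e) covec) \<Rightarrow> ('a, 'e) chart \<Rightarrow> 'a \<times> ('a, 'e) covec \<Rightarrow>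
   'e \<times> ('e \<Rightarrow>\<^sub>L real) \<Rightarrow> 'e \<times> ('e \<Rightarrow>\<^sub>L real)" where
  "canonical_derivative F c x = frechet_derivative
     (cmap (cotangent_chart M c) \<circ> F \<circ> cinv (cotangent_chart M c)) (at (cmap (cotangent_chart M c) x))"

text \<open>Source and target share the chosen chart since \<open>F\<close> preserves fibres, and
  the canonical form has constant coefficients in it. The components of tangent vectors exhaust the
  model space, so quantifying over vectors becomes quantifying over \<open>a\<close> and
  \<open>b\<close>.\<close>

lemma symplectic_coordinates:
  assumes F: "smooth_map TM TM F" and fibre: "\<And>x. x \<in> points TM \<Longrightarrow> fst (F x) = fst x"
    and x: "x \<in> points TM" and c: "c \<in> charts_at M (fst x)" "chart_at TM x = cotangent_chart M c"
  shows "(\<forall>u\<in>tangent_space TM x. \<forall>v\<in>tangent_space TM x.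
        canonical_form M (F x) (tangent_map TM TM F x u) (tangent_map TM TM F x v) =
        canonical_form M x u v) \<longleftrightarrow>
     (\<forall>a b. blinfun_apply (snd (canonical_derivative F c x b)) (fst (canonical_derivative F c x a)) -
        blinfun_apply (snd (canonical_derivative F c x a)) (fst (canonical_derivative F c x b)) =
        blinfun_apply (snd b) (fst a) - blinfun_apply (snd a) (fst b))"
proof -
  let ?C = "cotangent_chart M c"
  have Fx: "F x \<in> points TM" using F x by (auto simp: smooth_map_def)
  have C: "?C \<in> charts_at TM x" using chart_at_charts_at[OF x] by (simp add: c(2))
  have C_Fx: "chart_at TM (F x) = ?C" using chart_at_fibre[OF Fx x fibre[OF x]] by (simp add: c(2))
  then have "?C \<in> charts_at TM (F x)" using chart_at_charts_at[OF Fx] by simp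
  then have TF: "tangent_map TM TM F x u ?C = canonical_derivative F c x (u ?C)"
    if "u \<in> tangent_space TM x" for u
    using tangent_map_component[OF smooth_atlas_cotangent_bundle F C _ that]
    by (simp add: canonical_derivative_def)
  have coord: "coord_vector TM ?C x a \<in> tangent_space TM x" "coord_vector TM ?C x a ?C = a" for a
    using coord_vector_tangent[OF smooth_atlas_cotangent_bundle C]
      coord_vector_self[OF smooth_atlas_cotangent_bundle C] by blast+
  show ?thesis
  proof (intro iffI allI ballI)
    fix a b
    assume "\<forall>u\<in>tangent_space TM x. \<forall>v\<in>tangent_space TM x.
        canonical_form M (F x) (tangent_map TM TM F x u) (tangent_map TM TM F x v) = canonical_form M x u v"
    from this[rule_format, OF coord(1)[of a] coord(1)[of b]]
    show "blinfun_apply (snd (canonical_derivative F c x b)) (fst (canonical_derivative F c x a)) -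
        blinfun_apply (snd (canonical_derivative F c x a)) (fst (canonical_derivative F c x b)) =
        blinfun_apply (snd b) (fst a) - blinfun_apply (snd a) (fst b)"
      by (simp add: canonical_form_coordinates[OF x] canonical_form_coordinates[OF Fx] C_Fx c(2)
          TF[OF coord(1)] coord(2))
  next
    fix u v assume uv: "u \<in> tangent_space TM x" "v \<in> tangent_space TM x"
      and "\<forall>a b. blinfun_apply (snd (canonical_derivative F c x b)) (fst (canonical_derivative F c x a)) -
        blinfun_apply (snd (canonical_derivative F c x a)) (fst (canonical_derivative F c x b)) =
        blinfun_apply (snd b) (fst a) - blinfun_apply (snd a) (fst b)"
    from this(3)[rule_format, of "v ?C" "u ?C"]
    show "canonical_form M (F x) (tangent_map TM TM F x u) (tangent_map TM TM F x v) = canonical_form M x u v"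
      by (simp add: canonical_form_coordinates[OF x] canonical_form_coordinates[OF Fx] C_Fx c(2)
          TF[OF uv(1)] TF[OF uv(2)])
  qed
qed

text \<open>A translation reads \<open>(x, p) \<mapsto> (x, p + a(x))\<close>, so its Jacobian is a
  shear by the derivative of \<open>a\<close>.\<close>

lemma canonical_derivative_translation:
  assumes \<alpha>: "\<alpha> \<in> smooth_form1 M" and F: "\<And>x. x \<in> points TM \<Longrightarrow> F x = fibre_translation M \<alpha> x"
    and x: "x \<in> points TM" and c: "c \<in> charts_at M (fst x)"
  shows "canonical_derivative F c x a =
    (fst a, snd a + frechet_derivative (local_rep M c \<alpha>) (at (cmap c (fst x))) (fst a))"
proof -
  let ?C = "cotangent_chart M c" and ?A = "frechet_derivative (local_rep M c \<alpha>) (at (cmap c (fst x)))"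
  note cM = charts_atD[OF c]
  have Cx: "cmap ?C x = (cmap c (fst x), momentum M c (fst x) (snd x))"
    using cmap_cotangent_chart[of M c "fst x" "snd x"] by simp
  have "(local_rep M c \<alpha> has_derivative ?A) (at (fst (cmap ?C x)))"
    using local_rep_derivative[OF \<alpha> c] by (simp add: Cx)
  from has_derivative_compose[OF bounded_linear_imp_has_derivative[OF bounded_linear_fst] this]
  have "((\<lambda>y. (fst y, snd y + local_rep M c \<alpha> (fst y))) has_derivative (\<lambda>a. (fst a, snd a + ?A (fst a))))
      (at (cmap ?C x))"
    by (intro has_derivative_Pair has_derivative_add bounded_linear_imp_has_derivative
        bounded_linear_fst bounded_linear_snd)
  then have "(cmap ?C \<circ> F \<circ> cinv ?C has_derivative (\<lambda>a. (fst a, snd a + ?A (fst a)))) (at (cmap ?C x))"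
  proof (rule has_derivative_transform_within_open)
    show "open (cmap c ` cdom c \<times> (UNIV :: ('e \<Rightarrow>\<^sub>L real) set))"
      using open_chart_image[OF atlas cM(1)] by (simp add: open_Times)
    show "cmap ?C x \<in> cmap c ` cdom c \<times> UNIV" using cM(2) by (simp add: Cx)
    fix y :: "'e \<times> ('e \<Rightarrow>\<^sub>L real)" assume y: "y \<in> cmap c ` cdom c \<times> UNIV"
    then have y': "fst y \<in> cmap c ` cdom c" "y \<in> overlap c c \<times> UNIV" by auto
    note q = chart_imageD[OF cM(1) y'(1)]
    have "cinv ?C y = (cinv c (fst y), covector M c (cinv c (fst y)) (snd y))"
      using cinv_cotangent_chart[OF cM(1) y'(1), of "snd y"] by (simp only: prod.collapse)
    then have "cinv ?C y \<in> points TM"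
      using q(2) covector_cotangent by (simp add: points_cotangent_bundle)
    then show "(fst y, snd y + local_rep M c \<alpha> (fst y)) = (cmap ?C \<circ> F \<circ> cinv ?C) y"
      using fibre_translation_coordinates[OF \<alpha> cM(1) cM(1) y'(2)]
      by (simp add: F momentum_covector[OF q(1)] cmap_cinv[OF y'(1)])
  qed
  from fun_cong[OF frechet_derivative_at[OF this], of a] show ?thesis
    unfolding canonical_derivative_def by (rule sym)
qed

lemma symplectic_translation_iff:
  assumes \<alpha>: "\<alpha> \<in> smooth_form1 M" and F: "\<And>x. x \<in> points TM \<Longrightarrow> F x = fibre_translation M \<alpha> x"
  shows "(\<forall>x\<in>points TM. \<forall>u\<in>tangent_space TM x. \<forall>v\<in>tangent_space TM x.
      canonical_form M (F x) (tangent_map TM TM F x u) (tangent_map TM TM F x v) = canonical_form M x u v)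
    \<longleftrightarrow> \<alpha> \<in> closed_forms M"
proof -
  have sm: "smooth_map TM TM F"
    using smooth_map_cong[OF _ smooth_map_fibre_translation[OF \<alpha>]] F by metis
  have fibre: "fst (F x) = fst x" if "x \<in> points TM" for x
    using F[OF that] by (simp add: fibre_translation_def split: prod.splits)
  \<comment> \<open>Such a shear preserves the standard form exactly when its off-diagonal part is
    symmetric, which is closedness in coordinates.\<close>
  have alg: "(\<forall>a b. (snd b + A (fst b)) (fst a) - (snd a + A (fst a)) (fst b) = snd b (fst a) - snd a (fst b)) \<longleftrightarrow>
      (\<forall>u v. A u v = A v u)" for A :: "'e \<Rightarrow> 'e \<Rightarrow>\<^sub>L real"
    by (auto simp: blinfun.add_left)
  have local: "\<exists>c\<in>charts_at M (fst x). (\<forall>u\<in>tangent_space TM x. \<forall>v\<in>tangent_space TM x.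
      canonical_form M (F x) (tangent_map TM TM F x u) (tangent_map TM TM F x v) = canonical_form M x u v) \<longleftrightarrow>
      closed_at \<alpha> c (fst x)" if x: "x \<in> points TM" for x
  proof -
    obtain c where c: "c \<in> charts_at M (fst x)" "chart_at TM x = cotangent_chart M c"
      using chart_at_cotangent_bundle[OF x] .
    have iff: "(\<forall>u\<in>tangent_space TM x. \<forall>v\<in>tangent_space TM x.
        canonical_form M (F x) (tangent_map TM TM F x u) (tangent_map TM TM F x v) =
        canonical_form M x u v) \<longleftrightarrow>
     (\<forall>a b. blinfun_apply (snd (canonical_derivative F c x b)) (fst (canonical_derivative F c x a)) -
        blinfun_apply (snd (canonical_derivative F c x a)) (fst (canonical_derivative F c x b)) =
        blinfun_apply (snd b) (fst a) - blinfun_apply (snd a) (fst b))"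
      by (rule symplectic_coordinates[OF sm fibre x c])
    have "canonical_derivative F c x a =
        (fst a, snd a + frechet_derivative (local_rep M c \<alpha>) (at (cmap c (fst x))) (fst a))" for a
      by (rule canonical_derivative_translation[OF \<alpha> F x c(1)])
    then show ?thesis
      using c(1) by (intro bexI[of _ c]) (simp_all only: iff fst_conv snd_conv alg closed_at_def)
  qed
  \<comment> \<open>The zero section meets every fibre, so a condition at points of the bundle
    yields closedness at every point of the base.\<close>
  have zero: "(q, covector M c q 0) \<in> points TM" if "q \<in> points M" for c q
    using that covector_cotangent by (simp add: points_cotangent_bundle)
  show ?thesis
  proof
    assume L: "\<forall>x\<in>points TM. \<forall>u\<in>tangent_space TM x. \<forall>v\<in>tangent_space TM x.
      canonical_form M (F x) (tangent_map TM TM F x u) (tangent_map TM TM F x v) = canonical_form M x u v"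
    have "\<exists>c\<in>charts_at M q. closed_at \<alpha> c q" if q: "q \<in> points M" for q
      using local[OF zero[OF q]] L zero[OF q] by (metis fst_conv)
    then show "\<alpha> \<in> closed_forms M" using \<alpha> by (simp add: closed_forms_iff)
  next
    assume "\<alpha> \<in> closed_forms M"
    then show "\<forall>x\<in>points TM. \<forall>u\<in>tangent_space TM x. \<forall>v\<in>tangent_space TM x.
      canonical_form M (F x) (tangent_map TM TM F x u) (tangent_map TM TM F x v) = canonical_form M x u v"
      using local closed_forms_closed_at by blast
  qed
qed

end

section \<open>Linearity of tangent maps and pullback of covectors\<close>

lemma tangent_map_add:
  assumes "smooth_map M N f" "p \<in> points M"
  shows "tangent_map M N f p (\<lambda>c. u c + v c) = (\<lambda>d. tangent_map M N f p u d + tangent_map M N f p v d)"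
  using linear_add[OF has_derivative_linear[OF smooth_map_derivative[OF assms(1) chart_at_charts_at[OF assms(2)]]]]
  by (auto simp: tangent_map_def)

lemma tangent_map_scaleR:
  assumes "smooth_map M N f" "p \<in> points M"
  shows "tangent_map M N f p (\<lambda>c. r *\<^sub>R u c) = (\<lambda>d. r *\<^sub>R tangent_map M N f p u d)"
  using linear_scale[OF has_derivative_linear[OF smooth_map_derivative[OF assms(1) chart_at_charts_at[OF assms(2)]]]]
  by (auto simp: tangent_map_def)

lemma pullback_cotangent:
  assumes "smooth_atlas M" "smooth_atlas N" "smooth_map M N f" "p \<in> points M" "\<xi> \<in> cotangent_space N (f p)"
  shows "(\<lambda>w\<in>tangent_space M p. \<xi> (tangent_map M N f p w)) \<in> cotangent_space M p"
  by (rule cotangent_spaceI)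
    (simp_all add: tangent_space_add[OF assms(1)] tangent_space_scaleR[OF assms(1)]
      tangent_map_add[OF assms(3,4)] tangent_map_scaleR[OF assms(3,4)] tangent_map_tangent[OF assms(1-4)]
      cotangent_space_add[OF assms(5)] cotangent_space_scaleR[OF assms(5)])

context finite_dim_atlas
begin

section \<open>The vector space of closed one-forms\<close>

text \<open>Restriction to the manifold, and in \<open>covec_add\<close> to the tangent space, keeps
  sums within the extensional functions that \<open>smooth_form1\<close> requires.\<close>

definition form_add :: "('a, 'e) form1 \<Rightarrow> ('a, 'e) form1 \<Rightarrow> ('a, 'e) form1" where
  "form_add \<alpha> \<beta> = (\<lambda>q\<in>points M. covec_add M q (\<alpha> q) (\<beta> q))"

definition form_scale :: "real \<Rightarrow> ('a, 'e) form1 \<Rightarrow> ('a, 'e) form1" where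
  "form_scale r \<alpha> = (\<lambda>q\<in>points M. covec_scale M q r (\<alpha> q))"

definition form_zero :: "('a, 'e) form1" where
  "form_zero = (\<lambda>q\<in>points M. \<lambda>v\<in>tangent_space M q. 0)"

lemma covector_zero: "covector M c q 0 = (\<lambda>v\<in>tangent_space M q. 0)"
  by (simp add: covector_def)

lemma zero_cotangent: "(\<lambda>v\<in>tangent_space M q. 0) \<in> cotangent_space M q"
  using covector_cotangent[of _ q 0] unfolding covector_zero .

lemma form_add_PiE:
  assumes "\<alpha> \<in> smooth_form1 M" "\<beta> \<in> smooth_form1 M"
  shows "form_add \<alpha> \<beta> \<in> (\<Pi>\<^sub>E p\<in>points M. cotangent_space M p)"
  by (rule PiE_I) (simp_all add: form_add_def covec_add_cotangent assms[THEN smooth_form1_cotangent])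

lemma form_scale_PiE:
  assumes "\<alpha> \<in> smooth_form1 M"
  shows "form_scale r \<alpha> \<in> (\<Pi>\<^sub>E p\<in>points M. cotangent_space M p)"
  by (rule PiE_I) (simp_all add: form_scale_def covec_scale_cotangent smooth_form1_cotangent[OF assms])

lemma local_rep_add:
  assumes "\<alpha> \<in> smooth_form1 M" "\<beta> \<in> smooth_form1 M" "c \<in> M" "x \<in> cmap c ` cdom c"
  shows "local_rep M c (form_add \<alpha> \<beta>) x = local_rep M c \<alpha> x + local_rep M c \<beta> x"
  using chart_imageD[OF assms(3,4)] assms(1,2)
  by (simp add: local_rep_def form_add_def momentum_add smooth_form1_cotangent)

lemma local_rep_scale:
  assumes "\<alpha> \<in> smooth_form1 M" "c \<in> M" "x \<in> cmap c ` cdom c"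
  shows "local_rep M c (form_scale r \<alpha>) x = r *\<^sub>R local_rep M c \<alpha> x"
  using chart_imageD[OF assms(2,3)] assms(1)
  by (simp add: local_rep_def form_scale_def momentum_scale smooth_form1_cotangent)

lemma local_rep_zero:
  assumes "c \<in> M" "x \<in> cmap c ` cdom c"
  shows "local_rep M c form_zero x = 0"
  using chart_imageD[OF assms] momentum_covector[of c "cinv c x" 0] unfolding covector_zero
  by (simp add: local_rep_def form_zero_def)

lemma form_add_smooth:
  assumes "\<alpha> \<in> smooth_form1 M" "\<beta> \<in> smooth_form1 M"
  shows "form_add \<alpha> \<beta> \<in> smooth_form1 M"
  unfolding smooth_form1_iff
proof (intro conjI ballI form_add_PiE assms)
  fix c assume c: "c \<in> M"
  show "C_infinity_on (local_rep M c (form_add \<alpha> \<beta>)) (cmap c ` cdom c)"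
    by (rule iffD2[OF C_infinity_on_cong[OF local_rep_add[OF assms c]]], assumption)
      (rule C_infinity_on_add[OF local_rep_smooth[OF assms(1) c] local_rep_smooth[OF assms(2) c]])
qed

lemma form_scale_smooth:
  assumes "\<alpha> \<in> smooth_form1 M"
  shows "form_scale r \<alpha> \<in> smooth_form1 M"
  unfolding smooth_form1_iff
proof (intro conjI ballI form_scale_PiE assms)
  fix c assume c: "c \<in> M"
  show "C_infinity_on (local_rep M c (form_scale r \<alpha>)) (cmap c ` cdom c)"
    by (rule iffD2[OF C_infinity_on_cong[OF local_rep_scale[OF assms c]]], assumption)
      (rule C_infinity_on_linear[OF bounded_linear_scaleR_right local_rep_smooth[OF assms c]])
qed

lemma form_zero_smooth: "form_zero \<in> smooth_form1 M"
  unfolding smooth_form1_iff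
proof (intro conjI ballI)
  show "form_zero \<in> (\<Pi>\<^sub>E p\<in>points M. cotangent_space M p)"
    using zero_cotangent by (auto simp: form_zero_def)
  fix c assume c: "c \<in> M"
  show "C_infinity_on (local_rep M c form_zero) (cmap c ` cdom c)"
    by (rule iffD2[OF C_infinity_on_cong[OF local_rep_zero[OF c]]], assumption)
      (rule C_infinity_on_const[OF open_chart_image[OF atlas c]])
qed

lemma local_rep_derivative_eqI:
  assumes "c \<in> charts_at M q" "\<And>x. x \<in> cmap c ` cdom c \<Longrightarrow> local_rep M c \<alpha> x = f x"
    and "(f has_derivative f') (at (cmap c q))"
  shows "frechet_derivative (local_rep M c \<alpha>) (at (cmap c q)) = f'"
proof -
  have "(local_rep M c \<alpha> has_derivative f') (at (cmap c q))"
    by (rule has_derivative_transform_within_open[OF assms(3)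
          open_chart_image[OF atlas charts_atD(1)[OF assms(1)]] chart_image_charts_at[OF assms(1)]])
      (simp add: assms(2))
  from frechet_derivative_at[OF this] show ?thesis by (rule sym)
qed

lemma form_add_closed:
  assumes "\<alpha> \<in> closed_forms M" "\<beta> \<in> closed_forms M"
  shows "form_add \<alpha> \<beta> \<in> closed_forms M"
proof -
  have sm: "\<alpha> \<in> smooth_form1 M" "\<beta> \<in> smooth_form1 M" using assms by (simp_all add: closed_forms_iff)
  have "closed_at (form_add \<alpha> \<beta>) c q" if c: "c \<in> charts_at M q" for c q
    using closed_forms_closed_at[OF assms(1) c] closed_forms_closed_at[OF assms(2) c]
    unfolding closed_at_def
    by (simp add: blinfun.add_left local_rep_derivative_eqI[OF c local_rep_add[OF sm charts_atD(1)[OF c]]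
          has_derivative_add[OF local_rep_derivative[OF sm(1) c] local_rep_derivative[OF sm(2) c]]])
  then show ?thesis
    using form_add_smooth[OF sm] points_charts_at by (auto simp: closed_forms_iff)
qed

lemma form_scale_closed:
  assumes "\<alpha> \<in> closed_forms M"
  shows "form_scale r \<alpha> \<in> closed_forms M"
proof -
  have sm: "\<alpha> \<in> smooth_form1 M" using assms by (simp add: closed_forms_iff)
  have "closed_at (form_scale r \<alpha>) c q" if c: "c \<in> charts_at M q" for c q
    using closed_forms_closed_at[OF assms c]
    unfolding closed_at_def
    by (simp add: blinfun.scaleR_left local_rep_derivative_eqI[OF c local_rep_scale[OF sm charts_atD(1)[OF c]]
          has_derivative_scaleR_right[OF local_rep_derivative[OF sm c]]])
  then show ?thesis
    using form_scale_smooth[OF sm] points_charts_at by (auto simp: closed_forms_iff)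
qed

lemma form_zero_closed: "form_zero \<in> closed_forms M"
proof -
  have "closed_at form_zero c q" if c: "c \<in> charts_at M q" for c q
    unfolding closed_at_def
    by (simp add: local_rep_derivative_eqI[OF c local_rep_zero[OF charts_atD(1)[OF c]] has_derivative_const])
  then show ?thesis
    using form_zero_smooth points_charts_at by (auto simp: closed_forms_iff)
qed

lemma fst_cotangent_chart: "fst (cmap (cotangent_chart M c) x) = cmap c (fst x)"
  by (cases x) (simp add: cmap_cotangent_chart)

lemma snd_cotangent_chart: "snd (cmap (cotangent_chart M c) x) = momentum M c (fst x) (snd x)"
  by (cases x) (simp add: cmap_cotangent_chart)

section \<open>Symplectomorphisms over the identity\<close>

text \<open>The inverse of a translation is the translation by the negative form. The original
  covector is recovered exactly because it is extensional.\<close>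

lemma fibre_translation_neg:
  assumes "\<alpha> \<in> smooth_form1 M" "x \<in> points TM"
  shows "fibre_translation M (form_scale (- 1) \<alpha>) (fibre_translation M \<alpha> x) = x"
    and "fibre_translation M \<alpha> (fibre_translation M (form_scale (- 1) \<alpha>) x) = x"
proof -
  obtain q \<xi> where x: "x = (q, \<xi>)" "q \<in> points M" "\<xi> \<in> cotangent_space M q"
    using assms(2) by (auto simp: points_cotangent_bundle)
  have "(\<lambda>v\<in>tangent_space M q. \<xi> v) = \<xi>"
    using cotangent_space_extensional[OF x(3)] by (simp add: extensional_restrict)
  then show "fibre_translation M (form_scale (- 1) \<alpha>) (fibre_translation M \<alpha> x) = x"
    "fibre_translation M \<alpha> (fibre_translation M (form_scale (- 1) \<alpha>) x) = x"
    by (simp_all add: x(1,2) fibre_translation_def form_scale_def covec_scale_def cong: restrict_cong)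
qed

lemma symplectomorphism_fibre_translation:
  assumes "\<alpha> \<in> closed_forms M"
  shows "symplectomorphism TM (canonical_form M) (fibre_translation M \<alpha>)"
proof -
  let ?F = "fibre_translation M \<alpha>" and ?G = "fibre_translation M (form_scale (- 1) \<alpha>)"
  have \<alpha>: "\<alpha> \<in> smooth_form1 M" using assms by (simp add: closed_forms_iff)
  note G = form_scale_smooth[OF \<alpha>, of "- 1"]
  have bij: "bij_betw ?F (points TM) (points TM)"
    using fibre_translation_neg[OF \<alpha>] fibre_translation_point[OF \<alpha>] fibre_translation_point[OF G]
    by (intro bij_betw_byWitness[where f'="?G"]) blast+
  \<comment> \<open>The two inverses are compared on the bundle only, which is enough for
    smoothness.\<close>
  have "?G x = inv_into (points TM) ?F x" if x: "x \<in> points TM" for x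
    using fibre_translation_neg(2)[OF \<alpha> x] fibre_translation_point[OF G x] bij
    by (metis bij_betw_inv_into_left)
  then have "smooth_map TM TM (inv_into (points TM) ?F)"
    using smooth_map_cong[OF _ smooth_map_fibre_translation[OF G]] by metis
  then show ?thesis
    using bij smooth_map_fibre_translation[OF \<alpha>] symplectic_translation_iff[OF \<alpha> refl] assms
    by (simp add: symplectomorphism_def diffeomorphism_def)
qed

text \<open>
  In canonical coordinates \<open>F (x, p) = (x, f (x, p))\<close>, and evaluating the canonical form on a vertical
  vector and an arbitrary one gives \<open>\<partial>f/\<partial>p = id\<close>, so \<open>f (x, p) - p\<close> does not depend on \<open>p\<close>.
\<close>

lemma symplectic_over_identity_momentum:
  assumes F: "smooth_map TM TM F" and fibre: "\<And>x. x \<in> points TM \<Longrightarrow> fst (F x) = fst x"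
    and symp: "\<And>x u v. x \<in> points TM \<Longrightarrow> u \<in> tangent_space TM x \<Longrightarrow> v \<in> tangent_space TM x \<Longrightarrow>
      canonical_form M (F x) (tangent_map TM TM F x u) (tangent_map TM TM F x v) = canonical_form M x u v"
    and q: "q \<in> points M" and \<xi>: "\<xi> \<in> cotangent_space M q"
  shows "snd (F (q, \<xi>)) = covec_add M q \<xi> (snd (F (q, \<lambda>v\<in>tangent_space M q. 0)))"
proof -
  have pt: "(q, \<eta>) \<in> points TM" if "\<eta> \<in> cotangent_space M q" for \<eta>
    using that q by (simp add: points_cotangent_bundle)
  have img: "snd (F (q, \<eta>)) \<in> cotangent_space M q" if "\<eta> \<in> cotangent_space M q" for \<eta>
  proof -
    have "F (q, \<eta>) \<in> points TM" using F pt[OF that] by (auto simp: smooth_map_def)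
    then show ?thesis using fibre[OF pt[OF that]] by (auto simp: points_cotangent_bundle)
  qed
  \<comment> \<open>One chart, selected at the zero covector, serves the entire fibre over
    \<open>q\<close>.\<close>
  obtain c where c: "c \<in> charts_at M q" and c0: "chart_at TM (q, \<lambda>v\<in>tangent_space M q. 0) = cotangent_chart M c"
    using chart_at_cotangent_bundle[OF pt[OF zero_cotangent]] by auto
  have chart: "chart_at TM (q, \<eta>) = cotangent_chart M c" if "\<eta> \<in> cotangent_space M q" for \<eta>
    using chart_at_fibre[OF pt[OF that] pt[OF zero_cotangent]] c0 by simp
  let ?C = "cotangent_chart M c" and ?W = "cmap c ` cdom c \<times> (UNIV :: ('e \<Rightarrow>\<^sub>L real) set)"
  let ?\<Phi> = "cmap ?C \<circ> F \<circ> cinv ?C"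
  note cM = charts_atD[OF c]
  have C: "?C \<in> TM" using cM(1) by (simp add: cotangent_bundle_def)
  have "F x \<in> cdom ?C" if "x \<in> cdom ?C" for x
  proof -
    have "x \<in> points TM" using that C by (auto simp: points_def)
    then have "fst (F x) = fst x" "F x \<in> points TM" using fibre F by (auto simp: smooth_map_def)
    then show ?thesis using that by (cases "F x") (auto simp: cdom_cotangent_chart points_cotangent_bundle)
  qed
  then have dom: "cdom ?C \<inter> F -` cdom ?C = cdom ?C" by blast
  have \<Phi>: "C_infinity_on ?\<Phi> ?W"
    using smooth_map_local[OF F C C] unfolding dom unfolding cdom_cotangent_chart image_cotangent_chart[OF cM(1) order_refl] .
  have \<Phi>_fst: "fst (?\<Phi> y) = fst y" if "y \<in> ?W" for y
  proof -
    have y: "fst y \<in> cmap c ` cdom c" using that by auto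
    have "(cinv c (fst y), covector M c (cinv c (fst y)) (snd y)) \<in> points TM"
      using chart_imageD(2)[OF cM(1) y] covector_cotangent by (simp add: points_cotangent_bundle)
    from fibre[OF this] show ?thesis
      using cinv_cotangent_chart[OF cM(1) y, of "snd y"] cmap_cinv[OF y]
      by (simp add: fst_cotangent_chart)
  qed
  have y: "(cmap c q, \<pi>) \<in> ?W" for \<pi> using cM(2) by simp
  have D: "(?\<Phi> has_derivative canonical_derivative F c (q, covector M c q \<pi>)) (at (cmap c q, \<pi>))" for \<pi>
    using C_infinity_on_has_derivative[OF \<Phi> y]
    by (simp add: canonical_derivative_def cmap_cotangent_chart momentum_covector[OF c])
  have D_fst: "fst (canonical_derivative F c (q, covector M c q \<pi>) a) = fst a" for \<pi> a
  proof -
    have "((\<lambda>y. fst (?\<Phi> y)) has_derivative (\<lambda>a. fst (canonical_derivative F c (q, covector M c q \<pi>) a)))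
        (at (cmap c q, \<pi>))"
      by (rule bounded_linear.has_derivative[OF bounded_linear_fst D])
    then have "(fst has_derivative (\<lambda>a. fst (canonical_derivative F c (q, covector M c q \<pi>) a)))
        (at (cmap c q, \<pi>))"
      by (rule has_derivative_transform_within_open[OF _ C_infinity_on_open[OF \<Phi>] y \<Phi>_fst])
    from fun_cong[OF has_derivative_unique[OF this bounded_linear_imp_has_derivative[OF bounded_linear_fst]], of a]
    show ?thesis .
  qed
  have D_vertical: "snd (canonical_derivative F c (q, covector M c q \<pi>) (0, u)) = u" for \<pi> u
  proof (rule blinfun_eqI)
    fix v
    let ?x = "(q, covector M c q \<pi>)"
    have c': "c \<in> charts_at M (fst ?x)" using c by simp
    have "\<forall>u\<in>tangent_space TM ?x. \<forall>v\<in>tangent_space TM ?x.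
        canonical_form M (F ?x) (tangent_map TM TM F ?x u) (tangent_map TM TM F ?x v) = canonical_form M ?x u v"
      using symp[OF pt[OF covector_cotangent]] by blast
    then have "\<forall>a b. blinfun_apply (snd (canonical_derivative F c ?x b)) (fst (canonical_derivative F c ?x a)) -
        blinfun_apply (snd (canonical_derivative F c ?x a)) (fst (canonical_derivative F c ?x b)) =
        blinfun_apply (snd b) (fst a) - blinfun_apply (snd a) (fst b)"
      using symplectic_coordinates[OF F _ pt[OF covector_cotangent] c' chart[OF covector_cotangent]] fibre
      by blast
    \<comment> \<open>The horizontal vector \<open>(v, 0)\<close> tests the image of the vertical
      vector \<open>(0, u)\<close>. That image has base component zero, so the unknown momentum part
      of the image of \<open>(v, 0)\<close> drops out.\<close>
    from this[unfolded D_fst, rule_format, of "(v, 0)" "(0, u)"]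
    show "blinfun_apply (snd (canonical_derivative F c (q, covector M c q \<pi>) (0, u))) v = blinfun_apply u v"
      by simp
  qed
  have "((\<lambda>\<pi>. snd (?\<Phi> (cmap c q, \<pi>)) - \<pi>) has_derivative (\<lambda>u. 0)) (at \<pi>)" for \<pi>
  proof -
    have "((\<lambda>\<pi>. (cmap c q, \<pi>)) has_derivative (\<lambda>u. (0, u))) (at \<pi>)"
      by (intro has_derivative_Pair has_derivative_const has_derivative_ident)
    from has_derivative_compose[OF this D]
    have "((\<lambda>\<pi>. snd (?\<Phi> (cmap c q, \<pi>)) - \<pi>) has_derivative
        (\<lambda>u. snd (canonical_derivative F c (q, covector M c q \<pi>) (0, u)) - u)) (at \<pi>)"
      by (intro has_derivative_diff has_derivative_ident bounded_linear.has_derivative[OF bounded_linear_snd])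
    then show ?thesis by (simp add: D_vertical)
  qed
  \<comment> \<open>The fibre coordinate ranges over a whole vector space, which is convex, so a
    vanishing derivative forces constancy.\<close>
  then have const: "snd (?\<Phi> (cmap c q, \<pi>)) - \<pi> = snd (?\<Phi> (cmap c q, 0)) - 0" for \<pi>
    by (intro has_derivative_zero_unique[of UNIV]) auto
  have \<Phi>_snd: "snd (?\<Phi> (cmap c q, \<pi>)) = momentum M c q (snd (F (q, covector M c q \<pi>)))" for \<pi>
    using fibre[OF pt[OF covector_cotangent[of c q \<pi>]]]
      cinv_cotangent_chart[OF cM(1) chart_image_charts_at[OF c], of \<pi>]
    by (simp add: cinv_cmap_charts_at[OF c] snd_cotangent_chart)
  have "momentum M c q (snd (F (q, \<xi>))) =
      momentum M c q (covec_add M q \<xi> (snd (F (q, \<lambda>v\<in>tangent_space M q. 0))))"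
    using const[of "momentum M c q \<xi>"]
    unfolding \<Phi>_snd covector_momentum[OF c \<xi>] covector_zero momentum_add[OF c \<xi> img[OF zero_cotangent]]
    by (simp add: algebra_simps)
  then show ?thesis
    by (rule momentum_inject[OF c img[OF \<xi>] covec_add_cotangent[OF \<xi> img[OF zero_cotangent]]])
qed

text \<open>The form is read off from the zero section. Its smoothness has to be established before
  \<open>symplectic_translation_iff\<close> can turn symplecticity of \<open>F\<close> into
  closedness.\<close>

lemma symplectomorphism_over_identity:
  assumes "symplectomorphism TM (canonical_form M) F"
    and fibre: "\<And>x. x \<in> points TM \<Longrightarrow> fst (F x) = fst x"
  obtains \<alpha> where "\<alpha> \<in> closed_forms M" "\<And>x. x \<in> points TM \<Longrightarrow> F x = fibre_translation M \<alpha> x"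
proof -
  have F: "smooth_map TM TM F"
    and symp: "\<And>x u v. x \<in> points TM \<Longrightarrow> u \<in> tangent_space TM x \<Longrightarrow> v \<in> tangent_space TM x \<Longrightarrow>
      canonical_form M (F x) (tangent_map TM TM F x u) (tangent_map TM TM F x v) = canonical_form M x u v"
    using assms(1) unfolding symplectomorphism_def diffeomorphism_def by blast+
  define \<alpha> where "\<alpha> = (\<lambda>q\<in>points M. snd (F (q, \<lambda>v\<in>tangent_space M q. 0)))"
  have F\<alpha>: "F x = fibre_translation M \<alpha> x" if x: "x \<in> points TM" for x
  proof -
    obtain q \<xi> where x': "x = (q, \<xi>)" "q \<in> points M" "\<xi> \<in> cotangent_space M q"
      using x by (auto simp: points_cotangent_bundle)
    have "F x = (q, snd (F x))" using fibre[OF x] by (simp add: x'(1) prod_eq_iff)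
    also have "snd (F x) = covec_add M q \<xi> (\<alpha> q)"
      using symplectic_over_identity_momentum[OF F fibre symp x'(2,3)] by (simp add: x'(1,2) \<alpha>_def)
    finally show ?thesis by (simp add: x'(1) fibre_translation_apply)
  qed
  have "\<alpha> \<in> smooth_form1 M"
    unfolding smooth_form1_iff
  proof (intro conjI ballI)
    show "\<alpha> \<in> (\<Pi>\<^sub>E p\<in>points M. cotangent_space M p)"
    proof (rule PiE_I)
      fix q assume q: "q \<in> points M"
      then have z: "(q, \<lambda>v\<in>tangent_space M q. 0) \<in> points TM"
        using zero_cotangent by (simp add: points_cotangent_bundle)
      then have "F (q, \<lambda>v\<in>tangent_space M q. 0) \<in> points TM" using F by (auto simp: smooth_map_def)
      then show "\<alpha> q \<in> cotangent_space M q"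
        using fibre[OF z] q by (auto simp: \<alpha>_def points_cotangent_bundle)
    qed (simp add: \<alpha>_def)
    fix c assume c: "c \<in> M"
    let ?C = "cotangent_chart M c"
    have C: "?C \<in> TM" using c by (simp add: cotangent_bundle_def)
    have \<Phi>: "C_infinity_on (cmap ?C \<circ> F \<circ> cinv ?C) (cmap ?C ` (cdom ?C \<inter> F -` cdom ?C))"
      by (rule smooth_map_local[OF F C C])
    \<comment> \<open>The local representative is the momentum part of the coordinate expression of
      \<open>F\<close> along \<open>x \<mapsto> (x, 0)\<close>, the zero section in
      coordinates.\<close>
    have "bounded_linear (\<lambda>x. (x, 0 :: 'e \<Rightarrow>\<^sub>L real))" by (intro bounded_linear_intros)
    from C_infinity_on_linear[OF bounded_linear_snd C_infinity_on_compose_affine[OF this \<Phi>, of 0]]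
    have sm: "C_infinity_on (\<lambda>x. snd ((cmap ?C \<circ> F \<circ> cinv ?C) (x, 0)))
        ((\<lambda>x. (x, 0)) -` (cmap ?C ` (cdom ?C \<inter> F -` cdom ?C)))"
      by simp
    have x: "snd ((cmap ?C \<circ> F \<circ> cinv ?C) (x, 0)) = local_rep M c \<alpha> x"
      "(x, 0) \<in> cmap ?C ` (cdom ?C \<inter> F -` cdom ?C)" if x: "x \<in> cmap c ` cdom c" for x
    proof -
      let ?q = "cinv c x"
      let ?z = "(?q, \<lambda>v\<in>tangent_space M ?q. 0)"
      note q = chart_imageD[OF c x]
      have cinv: "cinv ?C (x, 0) = ?z"
        using cinv_cotangent_chart[OF c x, of 0] by (simp add: covector_zero)
      have z: "?z \<in> points TM" using zero_cotangent q(2) by (simp add: points_cotangent_bundle)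
      have Fz: "F ?z = (?q, \<alpha> ?q)" using fibre[OF z] q(2) by (simp add: \<alpha>_def prod_eq_iff)
      show "snd ((cmap ?C \<circ> F \<circ> cinv ?C) (x, 0)) = local_rep M c \<alpha> x"
        by (simp add: cinv Fz cmap_cotangent_chart local_rep_def)
      have "?z \<in> cdom ?C" using charts_atD(2)[OF q(1)] zero_cotangent by (simp add: cdom_cotangent_chart)
      moreover have "F ?z \<in> points TM" using F z by (auto simp: smooth_map_def)
      then have "F ?z \<in> cdom ?C"
        using charts_atD(2)[OF q(1)] by (simp add: Fz cdom_cotangent_chart points_cotangent_bundle)
      moreover have "cmap ?C ?z = (x, 0)"
        using momentum_covector[OF q(1), of 0] by (simp add: cmap_cotangent_chart covector_zero cmap_cinv[OF x])
      ultimately show "(x, 0) \<in> cmap ?C ` (cdom ?C \<inter> F -` cdom ?C)" by (intro image_eqI[of _ _ ?z]) auto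
    qed
    show "C_infinity_on (local_rep M c \<alpha>) (cmap c ` cdom c)"
    proof (rule iffD1[OF C_infinity_on_cong C_infinity_on_subset[OF sm]])
      show "open (cmap c ` cdom c)" using open_chart_image[OF atlas c] .
    qed (use x in auto)
  qed
  then have "\<alpha> \<in> closed_forms M" using symplectic_translation_iff[OF _ F\<alpha>] symp by blast
  then show ?thesis using that F\<alpha> by blast
qed

end

section \<open>Equivariance and cohomology\<close>

text \<open>Equivariance and cochain equations concern one group element at a time, so the action is
  recorded as a family of smooth maps of the manifold; these arise as slices of the joint
  map.\<close>

locale smooth_group_action = finite_dim_atlas M + group_action G "points M" \<phi>
  for M :: "('a, 'e::real_normed_vector) atlas" and G :: "('g, 'm) monoid_scheme" (structure)
    and \<phi> :: "'g \<Rightarrow> 'a \<Rightarrow> 'a" +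
  assumes smooth_action: "g \<in> carrier G \<Longrightarrow> smooth_map M M (\<phi> g)"
begin

sublocale group G
  using group_hom group_hom.axioms(1) by blast

lemma action_point: "g \<in> carrier G \<Longrightarrow> q \<in> points M \<Longrightarrow> \<phi> g q \<in> points M"
  using element_image by blast

lemma action_inverse: "g \<in> carrier G \<Longrightarrow> q \<in> points M \<Longrightarrow> \<phi> (inv g) (\<phi> g q) = q"
  using orbit_sym_aux by blast

lemma tangent_action_tangent:
  "g \<in> carrier G \<Longrightarrow> q \<in> points M \<Longrightarrow> v \<in> tangent_space M q \<Longrightarrow>
    tangent_map M M (\<phi> g) q v \<in> tangent_space M (\<phi> g q)"
  by (rule tangent_map_tangent[OF atlas atlas smooth_action])

text \<open>Functoriality of the tangent map: the composite of the two actions is the identity on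
  the manifold.\<close>

lemma tangent_action_inverse:
  assumes "g \<in> carrier G" "q \<in> points M" "v \<in> tangent_space M q"
  shows "tangent_map M M (\<phi> (inv g)) (\<phi> g q) (tangent_map M M (\<phi> g) q v) = v"
proof -
  have "tangent_map M M (\<phi> (inv g)) (\<phi> g q) (tangent_map M M (\<phi> g) q v) =
      tangent_map M M (\<phi> (inv g) \<circ> \<phi> g) q v"
    using assms by (intro tangent_map_compose[OF atlas atlas] smooth_action) auto
  also have "\<dots> = v"
    using assms by (intro tangent_map_ident[OF atlas]) (simp_all add: action_inverse)
  finally show ?thesis .
qed

lemma tangent_action_inverse':
  assumes "g \<in> carrier G" "q \<in> points M" "w \<in> tangent_space M (\<phi> g q)"
  shows "tangent_map M M (\<phi> g) q (tangent_map M M (\<phi> (inv g)) (\<phi> g q) w) = w"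
  using tangent_action_inverse[of "inv g" "\<phi> g q" w] assms action_point action_inverse by simp

lemma affine_action_apply:
  "affine_action G M \<phi> A g (q, \<xi>) = (\<phi> g q, \<lambda>w\<in>tangent_space M (\<phi> g q).
    covec_add M q \<xi> (A [g] q) (tangent_map M M (\<phi> (inv g)) (\<phi> g q) w))"
  by (simp add: affine_action_def fibre_translation_apply cotangent_lift_def)

lemma affine_action_point:
  assumes "g \<in> carrier G" "A [g] \<in> smooth_form1 M" "x \<in> points TM"
  shows "affine_action G M \<phi> A g x \<in> points TM"
proof -
  obtain q \<xi> where x: "x = (q, \<xi>)" "q \<in> points M" "\<xi> \<in> cotangent_space M q"
    using assms(3) by (auto simp: points_cotangent_bundle)
  have "covec_add M q \<xi> (A [g] q) \<in> cotangent_space M q"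
    by (rule covec_add_cotangent[OF x(3) smooth_form1_cotangent[OF assms(2) x(2)]])
  \<comment> \<open>Writing the base point as the image of \<open>\<phi> g q\<close> under the
    inverse action exhibits the lifted covector as a pullback.\<close>
  then have "covec_add M q \<xi> (A [g] q) \<in> cotangent_space M (\<phi> (inv g) (\<phi> g q))"
    by (simp add: action_inverse[OF assms(1) x(2)])
  from pullback_cotangent[OF atlas atlas smooth_action action_point[OF assms(1) x(2)] this] assms(1) x(2)
  show ?thesis
    by (simp add: x(1) affine_action_apply points_cotangent_bundle action_point)
qed

text \<open>The value at \<open>g\<close> of the coboundary of the 0-cochain
  \<open>\<alpha>\<close>, that is, the pullback of \<open>\<alpha>\<close> by
  \<open>\<phi> g\<close> minus \<open>\<alpha>\<close>, as a plain expression without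
  restrictions.\<close>

definition form_delta :: "('a, 'e) form1 \<Rightarrow> 'g \<Rightarrow> 'a \<Rightarrow> ('a, 'e) tvec \<Rightarrow> real" where
  "form_delta \<alpha> g q v = \<alpha> (\<phi> g q) (tangent_map M M (\<phi> g) q v) - \<alpha> q v"

text \<open>Both sides contain the same transported \<open>\<xi>\<close>, which cancels; what
  remains compares one-forms at \<open>q\<close>.\<close>

lemma translation_equivariant_iff:
  assumes g: "g \<in> carrier G" and q: "q \<in> points M"
  shows "fibre_translation M \<alpha> (affine_action G M \<phi> A g (q, \<xi>)) =
      affine_action G M \<phi> B g (fibre_translation M \<alpha> (q, \<xi>)) \<longleftrightarrow>
    (\<forall>v\<in>tangent_space M q. B [g] q v = A [g] q v + form_delta \<alpha> g q v)"
proof -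
  let ?p = "\<phi> g q" and ?T = "tangent_map M M (\<phi> g) q" and ?S = "tangent_map M M (\<phi> (inv g)) (\<phi> g q)"
  have S: "?S w \<in> tangent_space M q" if "w \<in> tangent_space M ?p" for w
    using tangent_action_tangent[of "inv g" ?p w] that g q action_point action_inverse by simp
  have "fibre_translation M \<alpha> (affine_action G M \<phi> A g (q, \<xi>)) =
      affine_action G M \<phi> B g (fibre_translation M \<alpha> (q, \<xi>)) \<longleftrightarrow>
    (\<forall>w\<in>tangent_space M ?p. \<xi> (?S w) + A [g] q (?S w) + \<alpha> ?p w = \<xi> (?S w) + \<alpha> q (?S w) + B [g] q (?S w))"
    unfolding fibre_translation_apply affine_action_apply prod.inject
    using S by (auto simp: covec_add_def fun_eq_iff restrict_def)
  \<comment> \<open>Substitute \<open>w = ?T v\<close>: the tangent map at \<open>q\<close> is a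
    bijection onto the tangent space at \<open>?p\<close> with inverse \<open>?S\<close>.\<close>
  also have "\<dots> \<longleftrightarrow> (\<forall>v\<in>tangent_space M q. \<xi> v + A [g] q v + \<alpha> ?p (?T v) = \<xi> v + \<alpha> q v + B [g] q v)"
    using S tangent_action_inverse[OF g q] tangent_action_inverse'[OF g q] tangent_action_tangent[OF g q]
    by metis
  also have "\<dots> \<longleftrightarrow> (\<forall>v\<in>tangent_space M q. B [g] q v = A [g] q v + form_delta \<alpha> g q v)"
    by (auto simp: form_delta_def algebra_simps)
  finally show ?thesis .
qed

text \<open>The cochain \<open>A\<close> plus the coboundary of \<open>\<alpha>\<close>;
  \<open>make_cochain\<close> restores extensionality.\<close>

definition shifted :: "('g, 'a, 'e) cochain \<Rightarrow> ('a, 'e) form1 \<Rightarrow> ('g, 'a, 'e) cochain" where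
  "shifted A \<alpha> = make_cochain G M 1 (\<lambda>gs q v. A gs q v + form_delta \<alpha> (hd gs) q v)"

section \<open>Cohomology classes as orbits of shifts by closed forms\<close>

lemma tuples_0: "tuples G 0 = {[]}"
  by (auto simp: tuples_def)

lemma tuples_1: "gs \<in> tuples G (Suc 0) \<longleftrightarrow> (\<exists>g\<in>carrier G. gs = [g])"
  by (auto simp: tuples_def length_Suc_conv)

lemma make_cochain_cong:
  assumes "\<And>gs q v. gs \<in> tuples G n \<Longrightarrow> q \<in> points M \<Longrightarrow> v \<in> tangent_space M q \<Longrightarrow> f gs q v = f' gs q v"
  shows "make_cochain G M n f = make_cochain G M n f'"
  unfolding make_cochain_def using assms by (intro restrict_ext) simp

text \<open>A cochain is already extensional on all three levels: in the tuple, in the point and in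
  the tangent vector.\<close>

lemma make_cochain_self:
  assumes "A \<in> carrier (cochain_group G M n)"
  shows "make_cochain G M n A = A"
proof -
  have A: "A \<in> tuples G n \<rightarrow>\<^sub>E closed_forms M" using assms by (simp add: cochain_group_def)
  have "(\<lambda>v\<in>tangent_space M q. A gs q v) = A gs q" if "gs \<in> tuples G n" "q \<in> points M" for gs q
  proof -
    have "A gs \<in> smooth_form1 M" using A that(1) by (auto simp: closed_forms_def)
    then show ?thesis
      by (rule extensional_restrict[OF cotangent_space_extensional[OF smooth_form1_cotangent[OF _ that(2)]]])
  qed
  then have "make_cochain G M n A = (\<lambda>gs\<in>tuples G n. \<lambda>q\<in>points M. A gs q)"
    unfolding make_cochain_def by (intro restrict_ext) simp
  also have "\<dots> = (\<lambda>gs\<in>tuples G n. A gs)"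
  proof (rule restrict_ext)
    fix gs assume "gs \<in> tuples G n"
    then have "A gs \<in> extensional (points M)"
      using A by (auto simp: closed_forms_def smooth_form1_def PiE_def)
    then show "(\<lambda>q\<in>points M. A gs q) = A gs" by (rule extensional_restrict)
  qed
  also have "\<dots> = A" using A by (intro extensional_restrict) (simp add: PiE_def)
  finally show ?thesis .
qed

lemma cohomology_class_eq:
  "cohomology_class G M \<phi> 1 A = shifted A ` closed_forms M"
proof -
  have delta: "mult (cocycle_group G M \<phi> 1) (coboundary G M \<phi> 0 a) A = shifted A (a [])" for a
  proof -
    have "mult (cocycle_group G M \<phi> 1) (coboundary G M \<phi> 0 a) A =
        make_cochain G M 1 (\<lambda>gs q v. coboundary G M \<phi> 0 a gs q v + A gs q v)"
      by (simp add: cocycle_group_def cochain_group_def)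
    also have "\<dots> = shifted A (a [])"
      unfolding shifted_def
      by (rule make_cochain_cong) (auto simp: tuples_1 one_coboundary form_delta_def pullback1_def)
    finally show ?thesis .
  qed
  \<comment> \<open>The only 0-tuple is the empty list, so a 0-cochain amounts to its value there,
    an arbitrary closed form.\<close>
  have "(\<lambda>a. a []) ` carrier (cochain_group G M 0) = closed_forms M"
  proof
    show "(\<lambda>a. a []) ` carrier (cochain_group G M 0) \<subseteq> closed_forms M"
      by (auto simp: cochain_group_def tuples_0)
    show "closed_forms M \<subseteq> (\<lambda>a. a []) ` carrier (cochain_group G M 0)"
    proof
      fix \<alpha> assume "\<alpha> \<in> closed_forms M"
      then have "(\<lambda>gs\<in>{[]}. \<alpha>) \<in> carrier (cochain_group G M 0)"
        by (auto simp: cochain_group_def tuples_0)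
      then show "\<alpha> \<in> (\<lambda>a. a []) ` carrier (cochain_group G M 0)" by (rule rev_image_eqI) simp
    qed
  qed
  moreover have "cohomology_class G M \<phi> 1 A =
      (\<lambda>a. shifted A (a [])) ` carrier (cochain_group G M 0)"
    unfolding cohomology_class_def coboundaries_def r_coset_def
    by (auto simp: delta[unfolded One_nat_def])
  ultimately show ?thesis by (metis image_image)
qed

lemma form_delta_add:
  assumes "g \<in> carrier G" "q \<in> points M" "v \<in> tangent_space M q"
  shows "form_delta (form_add \<alpha> \<beta>) g q v = form_delta \<alpha> g q v + form_delta \<beta> g q v"
  using assms by (simp add: form_delta_def form_add_def covec_add_def action_point tangent_action_tangent)

lemma form_delta_scale:
  assumes "g \<in> carrier G" "q \<in> points M" "v \<in> tangent_space M q"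
  shows "form_delta (form_scale r \<alpha>) g q v = r * form_delta \<alpha> g q v"
  using assms
  by (simp add: form_delta_def form_scale_def covec_scale_def action_point tangent_action_tangent right_diff_distrib)

lemma form_delta_zero:
  assumes "g \<in> carrier G" "q \<in> points M" "v \<in> tangent_space M q"
  shows "form_delta form_zero g q v = 0"
  using assms by (simp add: form_delta_def form_zero_def action_point tangent_action_tangent)

lemma shifted_shifted: "shifted (shifted A \<alpha>) \<beta> = shifted A (form_add \<alpha> \<beta>)"
  unfolding shifted_def
  by (rule make_cochain_cong) (auto simp: tuples_1 make_cochain_def form_delta_add)

lemma shifted_zero:
  assumes "A \<in> carrier (cochain_group G M 1)"
  shows "shifted A form_zero = A"
proof -
  have "shifted A form_zero = make_cochain G M 1 A"
    unfolding shifted_def by (rule make_cochain_cong) (auto simp: tuples_1 form_delta_zero)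
  then show ?thesis by (simp only: make_cochain_self[OF assms])
qed

text \<open>Shifting by the difference of \<open>\<beta>\<close> and \<open>\<alpha>\<close> undoes
  the first shift and performs the one by \<open>\<beta>\<close>.\<close>

lemma shifted_neg: "shifted (shifted A \<alpha>) (form_add (form_scale (- 1) \<alpha>) \<beta>) = shifted A \<beta>"
  unfolding shifted_def
  by (rule make_cochain_cong) (auto simp: tuples_1 make_cochain_def form_delta_add form_delta_scale)

text \<open>Classes are orbits under shifts, and closed forms contain zero and are stable under sums
  and negatives. Hence each cochain lies in its own orbit and two orbits with a common shift
  coincide.\<close>

lemma cohomology_class_eq_iff:
  assumes "A \<in> carrier (cochain_group G M 1)" "B \<in> carrier (cochain_group G M 1)"
  shows "cohomology_class G M \<phi> 1 A = cohomology_class G M \<phi> 1 B \<longleftrightarrow>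
    (\<exists>\<alpha>\<in>closed_forms M. B = shifted A \<alpha>)"
proof
  assume "cohomology_class G M \<phi> 1 A = cohomology_class G M \<phi> 1 B"
  moreover have "B \<in> cohomology_class G M \<phi> 1 B"
    unfolding cohomology_class_eq using form_zero_closed shifted_zero[OF assms(2)] by (metis imageI)
  ultimately show "\<exists>\<alpha>\<in>closed_forms M. B = shifted A \<alpha>" unfolding cohomology_class_eq by blast
next
  assume "\<exists>\<alpha>\<in>closed_forms M. B = shifted A \<alpha>"
  then obtain \<alpha> where \<alpha>: "\<alpha> \<in> closed_forms M" and B: "B = shifted A \<alpha>" by blast
  have "shifted A \<beta> \<in> shifted B ` closed_forms M" if "\<beta> \<in> closed_forms M" for \<beta>
    using form_add_closed[OF form_scale_closed[OF \<alpha>] that] shifted_neg[of A \<alpha> \<beta>]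
    unfolding B by (metis imageI)
  moreover have "shifted B \<beta> \<in> shifted A ` closed_forms M" if "\<beta> \<in> closed_forms M" for \<beta>
    using form_add_closed[OF \<alpha> that] unfolding B shifted_shifted by blast
  ultimately show "cohomology_class G M \<phi> 1 A = cohomology_class G M \<phi> 1 B"
    unfolding cohomology_class_eq by blast
qed

section \<open>Equivariance of translations and equality of classes\<close>

lemma eq_shifted_iff:
  assumes "B \<in> carrier (cochain_group G M 1)"
  shows "B = shifted A \<alpha> \<longleftrightarrow>
    (\<forall>g\<in>carrier G. \<forall>q\<in>points M. \<forall>v\<in>tangent_space M q. B [g] q v = A [g] q v + form_delta \<alpha> g q v)"
proof
  assume "B = shifted A \<alpha>"
  then show "\<forall>g\<in>carrier G. \<forall>q\<in>points M. \<forall>v\<in>tangent_space M q. B [g] q v = A [g] q v + form_delta \<alpha> g q v"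
    by (simp add: shifted_def make_cochain_def tuples_1)
next
  assume "\<forall>g\<in>carrier G. \<forall>q\<in>points M. \<forall>v\<in>tangent_space M q. B [g] q v = A [g] q v + form_delta \<alpha> g q v"
  then have "make_cochain G M 1 B = shifted A \<alpha>"
    unfolding shifted_def by (intro make_cochain_cong) (auto simp: tuples_1)
  then show "B = shifted A \<alpha>" by (simp only: make_cochain_self[OF assms])
qed

lemma translation_equivariant_iff_shifted:
  assumes "B \<in> carrier (cochain_group G M 1)"
  shows "(\<forall>g\<in>carrier G. \<forall>x\<in>points TM. fibre_translation M \<alpha> (affine_action G M \<phi> A g x) =
      affine_action G M \<phi> B g (fibre_translation M \<alpha> x)) \<longleftrightarrow> B = shifted A \<alpha>"
proof -
  \<comment> \<open>The condition over \<open>q\<close> is the same for all covectors; the zero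
    covector shows that each fibre has one, so the condition can be extracted at every
    \<open>q\<close>.\<close>
  have "(\<forall>x\<in>points TM. fibre_translation M \<alpha> (affine_action G M \<phi> A g x) =
      affine_action G M \<phi> B g (fibre_translation M \<alpha> x)) \<longleftrightarrow>
    (\<forall>q\<in>points M. \<forall>v\<in>tangent_space M q. B [g] q v = A [g] q v + form_delta \<alpha> g q v)"
    if g: "g \<in> carrier G" for g
    unfolding points_cotangent_bundle
    using translation_equivariant_iff[OF g] zero_cotangent by (simp add: Sigma_def) blast
  then show ?thesis unfolding eq_shifted_iff[OF assms] by blast
qed

lemma equivariant_symplectomorphism_iff:
  assumes A: "A \<in> carrier (cochain_group G M 1)" and B: "B \<in> carrier (cochain_group G M 1)"
  shows "(\<exists>F. symplectomorphism TM (canonical_form M) F \<and> (\<forall>x\<in>points TM. fst (F x) = fst x) \<and>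
      (\<forall>g\<in>carrier G. \<forall>x\<in>points TM. F (affine_action G M \<phi> A g x) = affine_action G M \<phi> B g (F x)))
    \<longleftrightarrow> cohomology_class G M \<phi> 1 A = cohomology_class G M \<phi> 1 B"
  unfolding cohomology_class_eq_iff[OF assms]
proof
  assume "\<exists>F. symplectomorphism TM (canonical_form M) F \<and> (\<forall>x\<in>points TM. fst (F x) = fst x) \<and>
      (\<forall>g\<in>carrier G. \<forall>x\<in>points TM. F (affine_action G M \<phi> A g x) = affine_action G M \<phi> B g (F x))"
  then obtain F where F: "symplectomorphism TM (canonical_form M) F" "\<And>x. x \<in> points TM \<Longrightarrow> fst (F x) = fst x"
    and equi: "\<forall>g\<in>carrier G. \<forall>x\<in>points TM. F (affine_action G M \<phi> A g x) = affine_action G M \<phi> B g (F x)"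
    by blast
  obtain \<alpha> where \<alpha>: "\<alpha> \<in> closed_forms M" "\<And>x. x \<in> points TM \<Longrightarrow> F x = fibre_translation M \<alpha> x"
    by (rule symplectomorphism_over_identity[OF F]) blast+
  \<comment> \<open>Ensures that the affine action stays in the bundle, the set on which
    \<open>F\<close> is known to be a translation.\<close>
  have "A [g] \<in> smooth_form1 M" if "g \<in> carrier G" for g
    using A that by (auto simp: cochain_group_def closed_forms_def tuples_def)
  then have "\<forall>g\<in>carrier G. \<forall>x\<in>points TM. fibre_translation M \<alpha> (affine_action G M \<phi> A g x) =
      affine_action G M \<phi> B g (fibre_translation M \<alpha> x)"
    using equi \<alpha>(2) affine_action_point by metis
  then show "\<exists>\<alpha>\<in>closed_forms M. B = shifted A \<alpha>"
    using translation_equivariant_iff_shifted[OF B] \<alpha>(1) by blast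
next
  assume "\<exists>\<alpha>\<in>closed_forms M. B = shifted A \<alpha>"
  then obtain \<alpha> where \<alpha>: "\<alpha> \<in> closed_forms M" and "B = shifted A \<alpha>" by blast
  then have "\<forall>g\<in>carrier G. \<forall>x\<in>points TM. fibre_translation M \<alpha> (affine_action G M \<phi> A g x) =
      affine_action G M \<phi> B g (fibre_translation M \<alpha> x)"
    using translation_equivariant_iff_shifted[OF B] by blast
  moreover have "\<forall>x\<in>points TM. fst (fibre_translation M \<alpha> x) = fst x"
    by (auto simp: fibre_translation_apply)
  ultimately show "\<exists>F. symplectomorphism TM (canonical_form M) F \<and> (\<forall>x\<in>points TM. fst (F x) = fst x) \<and>
      (\<forall>g\<in>carrier G. \<forall>x\<in>points TM. F (affine_action G M \<phi> A g x) = affine_action G M \<phi> B g (F x))"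
    using symplectomorphism_fibre_translation[OF \<alpha>] by blast
qed

end

theorem theorem2p4:
  fixes G :: "('g, 'm) monoid_scheme"
    and L :: "('g, 'f::real_normed_vector) atlas"
    and Q :: "('q, 'e::real_normed_vector) atlas"
    and \<phi> :: "'g \<Rightarrow> 'q \<Rightarrow> 'q"
    and A B :: "('g, 'q, 'e) cochain"
  assumes "lie_group G L"
    and "smooth_manifold Q"
    and "smooth_action G L Q \<phi>"
    and "A \<in> carrier (cocycle_group G Q \<phi> 1)"
    and "B \<in> carrier (cocycle_group G Q \<phi> 1)"
    and "smooth_map (prod_atlas L Q) (cotangent_bundle Q) (\<lambda>(g, q). (q, A [g] q))"
    and "smooth_map (prod_atlas L Q) (cotangent_bundle Q) (\<lambda>(g, q). (q, B [g] q))"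
  shows "(\<exists>F. symplectomorphism (cotangent_bundle Q) (canonical_form Q) F \<and>
              (\<forall>x\<in>points (cotangent_bundle Q). fst (F x) = fst x) \<and>
              (\<forall>g\<in>carrier G. \<forall>x\<in>points (cotangent_bundle Q).
                 F (affine_action G Q \<phi> A g x) = affine_action G Q \<phi> B g (F x)))
         \<longleftrightarrow> cohomology_class G Q \<phi> 1 A = cohomology_class G Q \<phi> 1 B"
proof -
  note atlas = smooth_manifold_atlas[OF assms(2)]
  interpret smooth_group_action Q G \<phi>
  proof (intro smooth_group_action.intro smooth_group_action_axioms.intro finite_dim_atlas.intro)
    show "smooth_atlas Q" "finite_dim TYPE('e)"
      using atlas smooth_manifold_finite_dim[OF assms(2)] .
    show "group_action G (points Q) \<phi>" using assms(3) by (simp add: smooth_action_def)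
    \<comment> \<open>The map of a single group element is the slice of the joint action map at that
      element.\<close>
    show "smooth_map Q Q (\<phi> g)" if "g \<in> carrier G" for g
    proof (rule smooth_map_slice[where f=\<phi>])
      show "smooth_atlas L" "g \<in> points L"
        using assms(1) that by (simp_all add: lie_group_def smooth_manifold_def)
      show "smooth_map (prod_atlas L Q) Q (\<lambda>(g, q). \<phi> g q)"
        using assms(3) by (simp add: smooth_action_def)
    qed (rule atlas)
  qed
  show ?thesis
    using assms(4,5) by (intro equivariant_symplectomorphism_iff) (simp_all add: cocycle_group_def)
qed

end
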